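(* Let $E: y^2=x^3+c$ be a Mordell curve for any nonzero sixth-power-free integer $c$. Then $\Phi^{M}_{\mathbb{Q}}(3) = \{\mathbb{Z}/9\mathbb{Z}, \mathbb{Z}/6\mathbb{Z},\mathbb{Z}/3\mathbb{Z},\mathbb{Z}/2\mathbb{Z},\{\mathcal{O}\}\}$. Moreover, if $K/\mathbb{Q}$ is a cubic field and $T$ is the torsion subgroup of $E(K)$, then $T$ is isomorphic to one of the following groups: (1) $\mathbb{Z}/9\mathbb{Z}$, if $c=16$ and $K=\mathbb{Q}(r)$ with $r$ satisfying $r^3-3r^2+1=0$; (2) $\mathbb{Z}/6\mathbb{Z}$, if $c$ is both a square and a cube in $K$, or if $c=-27$ and $4$ is a cube in $K$; (3) $\mathbb{Z}/3\mathbb{Z}$, if $c$ ($\neq 16$) is a square but not a cube in $K$; or if $c=16$ and $K\neq\mathbb{Q}(r)$ with $r$ satisfying $r^3-3r^2+1=0$; or if $4c$ is a cube and $-3c$ is a square in $K$; (4) $\mathbb{Z}/2\mathbb{Z}$, if $c$ ($\neq -27$) is a cube but not a square in $K$, or if $c=-27$ but $4$ is not a cube in $K$; (5) $\{\mathcal{O}\}$, otherwise.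
   Context: A Mordell curve over a number field $K$ is an elliptic curve $y^2=x^3+c$ with $c\in K$, $c\neq 0$. $\mathcal{O}$ is the identity of the group $E(K)$. $\Phi^{M}_{\mathbb{Q}}(d)$ is the set of isomorphism classes of groups $E(K)_{tors}$, where $K$ runs over all number fields of degree $d$ and $E$ runs over all Mordell curves $y^2=x^3+c$ with $c\in\mathbb{Q}$. "Square (cube) in $K$" means square (cube) of an element of $K$.
   Formalization: Case (2) also includes c = -108 and c = -432 when 4 is a cube in K, and cases (3) and (4) exclude pairs already in case (2); as printed, c = -108 over K = Q(2^(1/3)) falls under both (3) and (4), although its torsion is Z/6Z. *)

theory Defs
  imports Complex_Main "HOL-Algebra.Algebra" "HOL-Algebra.Algebraic_Closure_Type"
begin

text \<open>
  Number fields are represented by subfields of the complex numbers; every number field embeds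
  into the complex numbers, and the group \<open>E(K)\<close> depends on \<open>K\<close> only up to isomorphism.
\<close>

abbreviation complex_ring :: "complex ring" where
  "complex_ring \<equiv> ring_of_type_algebra"

definition number_field_of_degree :: "nat \<Rightarrow> complex set \<Rightarrow> bool" where
  "number_field_of_degree d K \<longleftrightarrow>
     subfield K complex_ring \<and> ring.dimension complex_ring d \<rat> K"

text \<open>The field generated by \<open>r\<close> contains the prime field, so this is \<open>\<rat>(r)\<close>.\<close>

definition adjoin_rat :: "complex \<Rightarrow> complex set" where
  "adjoin_rat r = generate_field complex_ring {r}"

definition square_in :: "'a::field set \<Rightarrow> 'a \<Rightarrow> bool" where
  "square_in K a \<longleftrightarrow> (\<exists>b\<in>K. a = b ^ 2)"

definition cube_in :: "'a::field set \<Rightarrow> 'a \<Rightarrow> bool" where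
  "cube_in K a \<longleftrightarrow> (\<exists>b\<in>K. a = b ^ 3)"

definition sixth_power_free :: "int \<Rightarrow> bool" where
  "sixth_power_free c \<longleftrightarrow> (\<forall>n. n ^ 6 dvd c \<longrightarrow> is_unit n)"

datatype 'a point = Infinity | Affine 'a 'a

text \<open>
  The chord-and-tangent law on \<open>y\<^sup>2 = x\<^sup>3 + c\<close>. The formulas do not involve \<open>c\<close>. On the curve,
  \<open>x\<^sub>1 = x\<^sub>2\<close> and \<open>y\<^sub>1 \<noteq> - y\<^sub>2\<close> force \<open>y\<^sub>1 = y\<^sub>2 \<noteq> 0\<close>, which is the tangent case.
\<close>

fun mordell_add :: "'a::field_char_0 point \<Rightarrow> 'a point \<Rightarrow> 'a point" where
  "mordell_add Infinity Q = Q"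
| "mordell_add P Infinity = P"
| "mordell_add (Affine x1 y1) (Affine x2 y2) =
     (if x1 = x2 \<and> y1 = - y2 then Infinity
      else let m = (if x1 = x2 then 3 * x1 ^ 2 / (2 * y1) else (y2 - y1) / (x2 - x1));
               x3 = m ^ 2 - x1 - x2
           in Affine x3 (m * (x1 - x3) - y1))"

definition mordell_group :: "'a::field_char_0 set \<Rightarrow> 'a \<Rightarrow> 'a point monoid" where
  "mordell_group K c =
     \<lparr>carrier = insert Infinity {Affine x y | x y. x \<in> K \<and> y \<in> K \<and> y ^ 2 = x ^ 3 + c},
      monoid.mult = mordell_add, one = Infinity\<rparr>"

definition torsion_subgroup :: "('a, 'b) monoid_scheme \<Rightarrow> ('a, 'b) monoid_scheme" where
  "torsion_subgroup G =
     G\<lparr>carrier := {x \<in> carrier G. \<exists>n::nat. n > 0 \<and> x [^]\<^bsub>G\<^esub> n = \<one>\<^bsub>G\<^esub>}\<rparr>"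

text \<open>
  Isomorphism classes are represented by their members with carrier in \<open>int\<close>, so that groups on
  different types can be compared. Nothing is lost for countable groups: each of them is
  isomorphic to a group on integers.
\<close>

definition iso_class :: "('a, 'b) monoid_scheme \<Rightarrow> int monoid set" where
  "iso_class G = {H. Group.group H \<and> H \<cong> G}"

text \<open>The set \<open>\<Phi>\<^sup>M\<^sub>\<rat>(d)\<close>.\<close>

definition Phi_M_Q :: "nat \<Rightarrow> int monoid set set" where
  "Phi_M_Q d = {iso_class (torsion_subgroup (mordell_group K (of_rat c))) | K (c::rat).
     number_field_of_degree d K \<and> c \<noteq> 0}"

end

theory Submission
  imports Defs
begin

text \<open>
  On \<open>y\<^sup>2 = x\<^sup>3 + c\<close> put \<open>X = x\<^sup>3 / c\<close>. The isogeny \<open>\<surd>-3\<close> acts on \<open>X\<close> by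
  \<open>f X = - (X + 4)\<^sup>3 / (27 X\<^sup>2)\<close>, and tripling acts by \<open>f \<circ> f\<close>. A torsion point of order prime
  to 3 therefore gives a periodic point of \<open>f\<close> in \<open>K\<close>. Extend the 3-adic valuation to the cubic
  field \<open>K\<close>. Following the valuations of \<open>X\<close>, \<open>X + 4\<close> and \<open>X - 8\<close> along the orbit, and using that
  values have denominator at most 3, one finds that the only periodic point is \<open>X = -1\<close>, that is
  \<open>y = 0\<close>. In the same way \<open>f (f X) = -4\<close> has no solution in \<open>K\<close>, because a solution would
  produce the value \<open>4/9\<close>. So every torsion point is killed by 18. A point of order 9 satisfies
  \<open>f X = -4\<close>, which is the equation \<open>r\<^sup>3 - 3 r\<^sup>2 + 1 = 0\<close> for \<open>X = 4 r\<^sup>3\<close>; as this cyclic cubic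
  field is not pure, \<open>c / 16\<close> must be a rational cube.

  Associativity of the group law is proved by interpolating three points by \<open>y = q x\<close> with \<open>q\<close>
  quadratic; degenerate configurations are moved into general position by adding an auxiliary
  point.
\<close>

section \<open>The group law\<close>

text \<open>The orbit argument rests on
  \<open>f a + 1 = - (a - 8) ^ 2 * (a + 1) / (27 * a ^ 2)\<close>: the fixed point -1 has 8 as its
  double second preimage. A point whose difference from 8 has value at least 2 gains at least 2 * 2
  - 3 = 1 in closeness to -1 and cannot come back. Points of nonzero value run off to infinity. In
  between only few values of \<open>s = (a - 8) / 3\<close> survive: 1/3 is excluded by looking one
  step ahead, 1/2 because \<open>c * (X + 1) = y ^ 2\<close> would give \<open>y\<close> a value
  with denominator 4; only here does the ordinate matter. No ideal theory enters. A subring of the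
  complex numbers maximal without 1/3 exists by Zorn and is a valuation ring by Chevalley's
  argument; relations of degree at most 3 make the values rational. The case distinction has one
  subtle overlap. Points of order 3 come from \<open>c\<close> being a square, or from
  \<open>4 c\<close> being a cube and \<open>- 3 c\<close> a square. For sixth-power-free
  \<open>c\<close> the second condition meets "\<open>c\<close> is a cube" exactly when
  \<open>c\<close> is -27, -108 or -432 and 4 is a cube in \<open>K\<close>; the group is then
  cyclic of order 6.\<close>

notation mordell_add (infixl \<open>\<boxplus>\<close> 65)

fun point_neg :: "'a::field_char_0 point \<Rightarrow> 'a point" where
  "point_neg Infinity = Infinity"
| "point_neg (Affine x y) = Affine x (- y)"

definition curve :: "'a::field_char_0 \<Rightarrow> 'a point set" where
  "curve c = insert Infinity {Affine x y | x y. y ^ 2 = x ^ 3 + c}"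

lemma Infinity_in_curve [simp]: "Infinity \<in> curve c"
  by (simp add: curve_def)

lemma Affine_in_curve [simp]: "Affine x y \<in> curve c \<longleftrightarrow> y ^ 2 = x ^ 3 + c"
  by (auto simp: curve_def)

declare mordell_add.simps(3) [simp del]

lemma add_Infinity_right [simp]: "P \<boxplus> Infinity = P"
  by (cases P) auto

lemma point_neg_neg [simp]: "point_neg (point_neg P) = P"
  by (cases P) auto

lemma point_neg_in_curve [simp]: "point_neg P \<in> curve c \<longleftrightarrow> P \<in> curve c"
  by (cases P) auto

lemma add_point_neg [simp]: "P \<boxplus> point_neg P = Infinity" "point_neg P \<boxplus> P = Infinity"
  by (cases P; simp add: mordell_add.simps(3))+

lemma add_opposite: "x1 = x2 \<and> y1 = - y2 \<Longrightarrow> Affine x1 y1 \<boxplus> Affine x2 y2 = Infinity"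
  by (simp add: mordell_add.simps(3))

text \<open>
  The coefficient form of
  \<open>t\<^sup>3 + c - (m t + b)\<^sup>2 = (t - x\<^sub>1) (t - x\<^sub>2) (t - x\<^sub>3)\<close>: the line \<open>y = m x + b\<close> meets the
  curve in points with abscissae \<open>x\<^sub>1, x\<^sub>2, x\<^sub>3\<close>, counted with multiplicity.
\<close>

definition cuts :: "'a::field_char_0 \<Rightarrow> 'a \<Rightarrow> 'a \<Rightarrow> 'a \<Rightarrow> 'a \<Rightarrow> 'a \<Rightarrow> bool" where
  "cuts c m b x1 x2 x3 \<longleftrightarrow> x1 + x2 + x3 = m ^ 2 \<and> x1 * x2 + x1 * x3 + x2 * x3 = - 2 * m * b
     \<and> x1 * x2 * x3 = b ^ 2 - c"

lemma cutsD:
  assumes "cuts c m b x1 x2 x3"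
  shows "x1 + x2 + x3 = m ^ 2" "x1 * x2 + x1 * x3 + x2 * x3 = - 2 * m * b" "x1 * x2 * x3 = b ^ 2 - c"
  using assms by (auto simp: cuts_def)

lemma cuts_commute: "cuts c m b x1 x2 x3 \<Longrightarrow> cuts c m b x2 x1 x3"
  by (auto simp: cuts_def algebra_simps)

lemma cuts_eval: "cuts c m b x1 x2 x3 \<Longrightarrow> t ^ 3 + c - (m * t + b) ^ 2 = (t - x1) * (t - x2) * (t - x3)"
  using cutsD[of c m b x1 x2 x3] by Groebner_Basis.algebra

text \<open>Chord and tangent become one case: later proofs use only the line
  \<open>y = m x + b\<close> and the factorisation \<open>cuts\<close>, in which a tangent is a
  double root.\<close>

lemma add_cases_line:
  fixes x1 :: "'a::field_char_0"
  assumes 1: "y1 ^ 2 = x1 ^ 3 + c" and 2: "y2 ^ 2 = x2 ^ 3 + c" and ne: "\<not> (x1 = x2 \<and> y1 = - y2)"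
  obtains m b x3 where "Affine x1 y1 \<boxplus> Affine x2 y2 = Affine x3 (- (m * x3 + b))"
    "y1 = m * x1 + b" "y2 = m * x2 + b" "cuts c m b x1 x2 x3"
proof -
  define m where "m = (if x1 = x2 then 3 * x1 ^ 2 / (2 * y1) else (y2 - y1) / (x2 - x1))"
  define b where "b = y1 - m * x1"
  define x3 where "x3 = m ^ 2 - x1 - x2"
  have sum: "Affine x1 y1 \<boxplus> Affine x2 y2 = Affine x3 (- (m * x3 + b))"
  proof -
    have "Affine x1 y1 \<boxplus> Affine x2 y2 = Affine x3 (m * (x1 - x3) - y1)"
      unfolding mordell_add.simps(3) if_not_P[OF ne] Let_def m_def[symmetric] x3_def by (rule refl)
    moreover have "m * (x1 - x3) - y1 = - (m * x3 + b)" by (simp add: b_def algebra_simps)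
    ultimately show ?thesis by simp
  qed
  have y: "y1 = m * x1 + b" "y2 = m * x2 + b \<and> cuts c m b x1 x2 x3"
  proof -
    show "y1 = m * x1 + b" by (simp add: b_def)
    show "y2 = m * x2 + b \<and> cuts c m b x1 x2 x3"
    proof (cases "x1 = x2")
      case True
      have "y1 ^ 2 = y2 ^ 2" using 1 2 True by simp
      then have yy: "y1 = y2" using ne True by (auto simp: power2_eq_iff)
      have "y1 \<noteq> 0" using yy ne True by auto
      then have m: "2 * m * y1 = 3 * x1 ^ 2" using True by (simp add: m_def)
      show ?thesis
        unfolding cuts_def x3_def b_def True[symmetric] yy[symmetric]
        apply (intro conjI)
        subgoal by simp
        subgoal by simp
        subgoal using m by Groebner_Basis.algebra
        subgoal using m 1 by Groebner_Basis.algebra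
        done
    next
      case False
      then have m: "m * (x2 - x1) = y2 - y1" by (simp add: m_def)
      \<comment> \<open>The difference of the two curve equations, to be cancelled by
        \<open>x2 - x1\<close>; this avoids dividing by \<open>y1 + y2\<close>, which may
        vanish.\<close>
      have "(x2 - x1) * (m * (y1 + y2)) = (x2 - x1) * (x1 ^ 2 + x1 * x2 + x2 ^ 2)"
      proof -
        have "(x2 - x1) * (m * (y1 + y2)) = y2 ^ 2 - y1 ^ 2" using m by Groebner_Basis.algebra
        also have "\<dots> = x2 ^ 3 - x1 ^ 3" using 1 2 by simp
        also have "\<dots> = (x2 - x1) * (x1 ^ 2 + x1 * x2 + x2 ^ 2)" by Groebner_Basis.algebra
        finally show ?thesis .
      qed
      then have "m * (y1 + y2) = x1 ^ 2 + x1 * x2 + x2 ^ 2" using False by simp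
      then have m2: "2 * m * y1 + m ^ 2 * (x2 - x1) = x1 ^ 2 + x1 * x2 + x2 ^ 2"
        using m by Groebner_Basis.algebra
      have "y2 = m * x2 + b" using m by (simp add: b_def algebra_simps)
      moreover have "cuts c m b x1 x2 x3"
        unfolding cuts_def x3_def b_def
        apply (intro conjI)
        subgoal by simp
        subgoal using m2 by Groebner_Basis.algebra
        subgoal using m2 1 by Groebner_Basis.algebra
        done
      ultimately show ?thesis by simp
    qed
  qed
  show thesis using that[OF sum] y by auto
qed

text \<open>Converse of \<open>add_cases_line\<close>: the slope is forced, by two distinct
  abscissae or, at a double root, by the first two symmetric functions, which combine to
  \<open>2 m y1 = 3 x1 ^ 2\<close>.\<close>

lemma line_imp_add:
  fixes x1 :: "'a::field_char_0"
  assumes y: "y1 = m * x1 + b" "y2 = m * x2 + b" and cut: "cuts c m b x1 x2 x3"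
    and ne: "\<not> (x1 = x2 \<and> y1 = - y2)"
  shows "Affine x1 y1 \<boxplus> Affine x2 y2 = Affine x3 (- (m * x3 + b))"
proof -
  have "m = (if x1 = x2 then 3 * x1 ^ 2 / (2 * y1) else (y2 - y1) / (x2 - x1))"
  proof (cases "x1 = x2")
    case True
    then have "y1 \<noteq> 0" using ne y by (metis neg_equal_0_iff_equal)
    moreover have "2 * m * y1 = 3 * x1 ^ 2" using cutsD[OF cut] y True by Groebner_Basis.algebra
    ultimately show ?thesis using True by (simp add: field_simps)
  next
    case False
    then show ?thesis using y by (simp add: field_simps)
  qed
  then have m: "(if x1 = x2 then 3 * x1 ^ 2 / (2 * y1) else (y2 - y1) / (x2 - x1)) = m" by (rule sym)
  have x3: "m ^ 2 - x1 - x2 = x3" using cutsD(1)[OF cut] by (simp add: algebra_simps)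
  have "Affine x1 y1 \<boxplus> Affine x2 y2 = Affine x3 (m * (x1 - x3) - y1)"
    unfolding mordell_add.simps(3) if_not_P[OF ne] Let_def m x3 by (rule refl)
  moreover have "m * (x1 - x3) - y1 = - (m * x3 + b)" using y(1) by (simp add: algebra_simps)
  ultimately show ?thesis by simp
qed

lemma cuts_on_curve:
  assumes "cuts c m b x1 x2 x3"
  shows "(m * x3 + b) ^ 2 = x3 ^ 3 + c"
  using cuts_eval[OF assms, of x3] by simp

lemma add_cases [consumes 2, case_names left right opposite line]:
  assumes "P \<in> curve c" "Q \<in> curve c"
  obtains "P = Infinity" | "Q = Infinity" | "Q = point_neg P"
  | m b x1 x2 x3 where "P = Affine x1 (m * x1 + b)" "Q = Affine x2 (m * x2 + b)" "cuts c m b x1 x2 x3"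
    "\<not> (x1 = x2 \<and> m * x1 + b = - (m * x2 + b))" "P \<boxplus> Q = Affine x3 (- (m * x3 + b))"
proof (cases P; cases Q)
  fix x1 y1 x2 y2 assume PQ: "P = Affine x1 y1" "Q = Affine x2 y2"
  show thesis
  proof (cases "x1 = x2 \<and> y1 = - y2")
    case False
    obtain m b x3 where "Affine x1 y1 \<boxplus> Affine x2 y2 = Affine x3 (- (m * x3 + b))"
      "y1 = m * x1 + b" "y2 = m * x2 + b" "cuts c m b x1 x2 x3"
      by (rule add_cases_line[OF _ _ False]) (use assms PQ in auto)
    then show thesis using that(4)[of x1 m b x2 x3] False PQ by simp
  qed (use that(3) PQ in simp)
qed (use that in blast)+

lemma add_in_curve [simp]:
  assumes "P \<in> curve c" "Q \<in> curve c"
  shows "P \<boxplus> Q \<in> curve c"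
  using assms
proof (cases rule: add_cases)
  case (line m b x1 x2 x3)
  then show ?thesis using cuts_on_curve[OF line(3)] by (simp add: power2_commute add.commute flip: minus_add_distrib)
qed (use assms in auto)

lemma add_commute:
  assumes "P \<in> curve c" "Q \<in> curve c"
  shows "P \<boxplus> Q = Q \<boxplus> P"
  using assms
proof (cases rule: add_cases)
  case (line m b x1 x2 x3)
  have "Affine x2 (m * x2 + b) \<boxplus> Affine x1 (m * x1 + b) = Affine x3 (- (m * x3 + b))"
    by (rule line_imp_add[OF refl refl cuts_commute[OF line(3)]]) (use line(4) in auto)
  then show ?thesis using line by simp
qed (use assms in auto)

lemma point_neg_add:
  assumes "P \<in> curve c" "Q \<in> curve c"
  shows "point_neg (P \<boxplus> Q) = point_neg P \<boxplus> point_neg Q"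
  using assms
proof (cases rule: add_cases)
  case (line m b x1 x2 x3)
  then have "cuts c (- m) (- b) x1 x2 x3" by (simp add: cuts_def)
  then have "Affine x1 (- (m * x1 + b)) \<boxplus> Affine x2 (- (m * x2 + b)) = Affine x3 (- (- m * x3 + (- b)))"
    by (rule line_imp_add[rotated 2]) (use line(4) in auto)
  then show ?thesis using line by simp
qed (use assms in auto)

text \<open>The reflected line through \<open>P\<close> and \<open>Q\<close> passes through
  \<open>P + Q\<close>, \<open>- Q\<close> and \<open>- P\<close>. The only obstruction would be
  \<open>P + Q = Q\<close> with ordinate 0, which makes \<open>Q\<close> a singular point and
  \<open>c\<close> zero. This cancellation comes before associativity and is used to prove
  it.\<close>

lemma add_cancel_right:
  assumes c: "c \<noteq> 0" and "P \<in> curve c" "Q \<in> curve c"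
  shows "(P \<boxplus> Q) \<boxplus> point_neg Q = P"
  using assms(2,3)
proof (cases rule: add_cases)
  case (line m b x1 x2 x3)
  have "\<not> (x3 = x2 \<and> - (m * x3 + b) = m * x2 + b)"
  proof
    assume 3: "x3 = x2 \<and> - (m * x3 + b) = m * x2 + b"
    then have "- (m * x2 + b) = m * x2 + b" by metis
    then have "2 * (m * x2 + b) = 0" by (metis add.left_inverse mult_2)
    then have y2: "m * x2 + b = 0" by (simp only: mult_eq_0_iff zero_neq_numeral[symmetric] simp_thms)
    have "3 * x2 ^ 2 = 2 * m * (m * x2 + b)" using cutsD(1,2)[OF line(3)] 3 by Groebner_Basis.algebra
    then have "x2 = 0" using y2 by simp
    then show False using assms line(2) y2 by auto
  qed
  moreover have "cuts c (- m) (- b) x3 x2 x1" using cutsD[OF line(3)] unfolding cuts_def by (simp add: ac_simps)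
  ultimately have "Affine x3 (- (m * x3 + b)) \<boxplus> Affine x2 (- (m * x2 + b)) = Affine x1 (- (- m * x1 + (- b)))"
    by (intro line_imp_add) auto
  then show ?thesis using line by simp
qed (use add_point_neg(1)[of Q] in auto)

lemma add_right_cancel:
  assumes c: "c \<noteq> 0" and "P \<in> curve c" "P' \<in> curve c" "Q \<in> curve c" and eq: "P \<boxplus> Q = P' \<boxplus> Q"
  shows "P = P'"
  using add_cancel_right[OF c assms(2,4)] add_cancel_right[OF c assms(3,4)] eq by metis

section \<open>Associativity of the chord-and-tangent law\<close>

text \<open>With \<open>\<delta>\<close> as leading coefficient of the parabola
  \<open>y = a x + b + \<delta> (x - x1) (x - x2)\<close>, the first conclusion is Vieta's formula
  for the abscissae of its four intersections with the curve; the second says that the third point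
  of the line \<open>y = d x + e\<close> lies on the parabola.\<close>

lemma third_line:
  fixes x1 :: "'a::field_char_0"
  assumes cut: "cuts c a b x1 x2 x12" and cut': "cuts c d e x12 x3 xS"
    and y12: "d * x12 + e = - (a * x12 + b)" and delta: "(a + d) * \<delta> = 1"
  shows "\<delta> ^ 2 * (xS - x1 - x2 + x3) = 1 - 2 * a * \<delta>"
    and "d * xS + e = a * xS + b + \<delta> * (xS - x1) * (xS - x2)"
proof -
  have 1: "(a + d) * (d - a) = xS + x3 - x1 - x2"
    using cutsD[OF cut] cutsD[OF cut'] by Groebner_Basis.algebra
  have 2: "(a + d) * (e - b) = x1 * x2 - x3 * xS"
    using cutsD[OF cut] cutsD[OF cut'] y12 by Groebner_Basis.algebra
  show "\<delta> ^ 2 * (xS - x1 - x2 + x3) = 1 - 2 * a * \<delta>"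
    using 1 delta by Groebner_Basis.algebra
  show "d * xS + e = a * xS + b + \<delta> * (xS - x1) * (xS - x2)"
    using 1 2 delta by Groebner_Basis.algebra
qed

text \<open>\<open>cuts_eval\<close> at \<open>x3\<close> factors a difference of squares: one
  factor is \<open>\<delta>\<close> times \<open>(x3 - x1) (x3 - x2)\<close>, the other is
  \<open>a + d\<close> times \<open>x3 - x12\<close>.\<close>

lemma slope_sum:
  fixes x1 :: "'a::field_char_0"
  assumes cut: "cuts c a b x1 x2 x12" and y3: "y3 ^ 2 = x3 ^ 3 + c" and ne: "x3 \<noteq> x12" "x3 \<noteq> x1" "x3 \<noteq> x2"
    and y12: "d * x12 + e = - (a * x12 + b)" and "d * x3 + e = y3"
    and delta: "\<delta> * ((x3 - x1) * (x3 - x2)) = y3 - (a * x3 + b)"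
  shows "(a + d) * \<delta> = 1"
proof -
  have "(a + d) * (x3 - x12) = y3 + a * x3 + b" using assms(6,7) by Groebner_Basis.algebra
  moreover have "(y3 + a * x3 + b) * (y3 - (a * x3 + b)) = (x3 - x1) * (x3 - x2) * (x3 - x12)"
    using cuts_eval[OF cut, of x3] y3 by Groebner_Basis.algebra
  ultimately have "((a + d) * \<delta>) * ((x3 - x1) * (x3 - x2) * (x3 - x12)) = 1 * ((x3 - x1) * (x3 - x2) * (x3 - x12))"
    using delta by Groebner_Basis.algebra
  then show ?thesis using ne by simp
qed

text \<open>
  Both lines through \<open>A + B\<close>, \<open>C\<close> and through \<open>B + C\<close>, \<open>A\<close> meet the interpolating
  parabola \<open>y = a x + b + \<delta> (x - x\<^sub>1) (x - x\<^sub>2)\<close> in the same fourth point.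
\<close>

lemma fourth_point_eq:
  fixes x1 :: "'a::field_char_0"
  assumes cuts: "cuts c a b x1 x2 xU" "cuts c d e xU x3 xS" "cuts c a' b' x2 x3 xW" "cuts c d' e' xW x1 xT"
    and y: "y2 = a * x2 + b" "y2 = a' * x2 + b'"
    and U: "d * xU + e = - (a * xU + b)" and W: "d' * xW + e' = - (a' * xW + b')"
    and aa: "\<delta> * (x1 - x3) = a - a'" and s: "(a + d) * \<delta> = 1" "(a' + d') * \<delta> = 1"
  shows "Affine xS (- (d * xS + e)) = Affine xT (- (d' * xT + e'))"
proof -
  have d0: "\<delta> \<noteq> 0" using s by auto
  note l = third_line[OF cuts(1,2) U s(1)] and l' = third_line[OF cuts(3,4) W s(2)]
  have "\<delta> ^ 2 * xS = \<delta> ^ 2 * xT" using l(1) l'(1) aa by Groebner_Basis.algebra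
  then have ST: "xS = xT" using d0 by simp
  have "d * xS + e = d' * xT + e'" using l(2) l'(2) aa ST y by Groebner_Basis.algebra
  then show ?thesis using ST by simp
qed

lemma add_assoc_chords:
  assumes c: "(c::'a::field_char_0) \<noteq> 0" and A: "y1 ^ 2 = x1 ^ 3 + c" and B: "y2 ^ 2 = x2 ^ 3 + c" and C: "y3 ^ 2 = x3 ^ 3 + c"
    and ne: "x1 \<noteq> x2" "x2 \<noteq> x3" "x1 \<noteq> x3"
    and U: "Affine x1 y1 \<boxplus> Affine x2 y2 = Affine xU yU" "xU \<noteq> x3"
    and W: "Affine x2 y2 \<boxplus> Affine x3 y3 = Affine xW yW" "xW \<noteq> x1"
  shows "(Affine x1 y1 \<boxplus> Affine x2 y2) \<boxplus> Affine x3 y3 = Affine x1 y1 \<boxplus> (Affine x2 y2 \<boxplus> Affine x3 y3)"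
proof -
  obtain a b where ab: "y1 = a * x1 + b" "y2 = a * x2 + b" "cuts c a b x1 x2 xU" "yU = - (a * xU + b)"
    using add_cases_line[OF A B] ne U by (metis point.inject)
  obtain a' b' where ab': "y2 = a' * x2 + b'" "y3 = a' * x3 + b'" "cuts c a' b' x2 x3 xW" "yW = - (a' * xW + b')"
    using add_cases_line[OF B C] ne W by (metis point.inject)
  have Uc: "yU ^ 2 = xU ^ 3 + c" and Wc: "yW ^ 2 = xW ^ 3 + c"
    using add_in_curve[of "Affine x1 y1" c "Affine x2 y2"] add_in_curve[of "Affine x2 y2" c "Affine x3 y3"] A B C U W by auto
  obtain d e xS where de: "Affine xU yU \<boxplus> Affine x3 y3 = Affine xS (- (d * xS + e))"
      "yU = d * xU + e" "y3 = d * x3 + e" "cuts c d e xU x3 xS"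
    using add_cases_line[OF Uc C] U by metis
  obtain d' e' xT where de': "Affine xW yW \<boxplus> Affine x1 y1 = Affine xT (- (d' * xT + e'))"
      "yW = d' * xW + e'" "y1 = d' * x1 + e'" "cuts c d' e' xW x1 xT"
    using add_cases_line[OF Wc A] W by metis
  \<comment> \<open>Chosen so that the parabola over the first chord passes through the third
    point.\<close>
  define \<delta> where "\<delta> = (y3 - (a * x3 + b)) / ((x3 - x1) * (x3 - x2))"
  have del: "\<delta> * ((x3 - x1) * (x3 - x2)) = y3 - (a * x3 + b)" using ne by (simp add: \<delta>_def)
  \<comment> \<open>Built on the chord through the second and third points, the parabola has the
    same leading coefficient, so \<open>slope_sum\<close> applies to both bracketings with one
    \<open>\<delta>\<close>.\<close>
  have "((x3 - x1) * (x3 - x2)) * (\<delta> * (x1 - x3)) = ((x3 - x1) * (x3 - x2)) * (a - a')"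
    using del ab(2) ab'(1,2) by Groebner_Basis.algebra
  then have aa: "\<delta> * (x1 - x3) = a - a'" using ne by simp
  then have del': "\<delta> * ((x1 - x2) * (x1 - x3)) = y1 - (a' * x1 + b')"
    using ab(1,2) ab'(1) by Groebner_Basis.algebra
  have s: "(a + d) * \<delta> = 1"
    using slope_sum[OF ab(3) C, of d e \<delta>] ne U ab de del by auto
  have s': "(a' + d') * \<delta> = 1"
    using slope_sum[OF ab'(3) A, of d' e' \<delta>] ne W ab' de' del' by auto
  have "Affine xU yU \<boxplus> Affine x3 y3 = Affine xW yW \<boxplus> Affine x1 y1"
    unfolding de(1) de'(1)
    by (rule fourth_point_eq[OF ab(3) de(4) ab'(3) de'(4) ab(2) ab'(1) _ _ aa s s'])
      (use ab ab' de de' in auto)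
  also have "\<dots> = Affine x1 y1 \<boxplus> Affine xW yW" using Wc A by (intro add_commute[of _ c]) auto
  finally show ?thesis using U W by simp
qed

lemma add_assoc_tangent:
  assumes c: "(c::'a::field_char_0) \<noteq> 0" and A: "y1 ^ 2 = x1 ^ 3 + c" and C: "y3 ^ 2 = x3 ^ 3 + c"
    and ne: "y1 \<noteq> 0" "x1 \<noteq> x3"
    and U: "Affine x1 y1 \<boxplus> Affine x1 y1 = Affine xU yU" "xU \<noteq> x3"
    and W: "Affine x1 y1 \<boxplus> Affine x3 y3 = Affine xW yW" "xW \<noteq> x1"
  shows "(Affine x1 y1 \<boxplus> Affine x1 y1) \<boxplus> Affine x3 y3 = Affine x1 y1 \<boxplus> (Affine x1 y1 \<boxplus> Affine x3 y3)"
proof -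
  have y1: "\<not> (x1 = x1 \<and> y1 = - y1)" using ne by (simp add: eq_neg_iff_add_eq_0)
  obtain a b where ab: "y1 = a * x1 + b" "cuts c a b x1 x1 xU" "yU = - (a * xU + b)"
    using add_cases_line[OF A A y1] U by (metis point.inject)
  obtain a' b' where ab': "y1 = a' * x1 + b'" "y3 = a' * x3 + b'" "cuts c a' b' x1 x3 xW" "yW = - (a' * xW + b')"
    using add_cases_line[OF A C] ne W by (metis point.inject)
  have Uc: "yU ^ 2 = xU ^ 3 + c" and Wc: "yW ^ 2 = xW ^ 3 + c"
    using add_in_curve[of "Affine x1 y1" c "Affine x1 y1"] add_in_curve[of "Affine x1 y1" c "Affine x3 y3"] A C U W by auto
  obtain d e xS where de: "Affine xU yU \<boxplus> Affine x3 y3 = Affine xS (- (d * xS + e))"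
      "yU = d * xU + e" "y3 = d * x3 + e" "cuts c d e xU x3 xS"
    using add_cases_line[OF Uc C] U by metis
  obtain d' e' xT where de': "Affine xW yW \<boxplus> Affine x1 y1 = Affine xT (- (d' * xT + e'))"
      "yW = d' * xW + e'" "y1 = d' * x1 + e'" "cuts c d' e' xW x1 xT"
    using add_cases_line[OF Wc A] W by metis
  define \<delta> where "\<delta> = (y3 - (a * x3 + b)) / ((x3 - x1) * (x3 - x1))"
  have del: "\<delta> * ((x3 - x1) * (x3 - x1)) = y3 - (a * x3 + b)" using ne by (simp add: \<delta>_def)
  have "(x3 - x1) * (\<delta> * (x1 - x3)) = (x3 - x1) * (a - a')"
    using del ab(1) ab'(1,2) by Groebner_Basis.algebra
  then have aa: "\<delta> * (x1 - x3) = a - a'" using ne by simp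
  have s: "(a + d) * \<delta> = 1"
    using slope_sum[OF ab(2) C, of d e \<delta>] ne U ab de del by auto
  \<comment> \<open>\<open>slope_sum\<close> cannot serve the second bracketing: the point to be
    added, over \<open>x1\<close>, already lies on the chord. The tangent slope takes its
    place.\<close>
  have ty: "2 * a * y1 = 3 * x1 ^ 2" using ab(1) cutsD[OF ab(2)] by Groebner_Basis.algebra
  have "(x3 - x1) * (2 * y1 * \<delta>) = (x3 - x1) * (x1 - xW)"
  proof -
    have "(x3 - x1) * (2 * y1 * \<delta>) = 2 * y1 * a' - 3 * x1 ^ 2" using aa ty by Groebner_Basis.algebra
    also have "\<dots> = (x3 - x1) * (x1 - xW)" using ab'(1,2) cutsD[OF ab'(3)] by Groebner_Basis.algebra
    finally show ?thesis .
  qed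
  then have "2 * y1 * \<delta> = x1 - xW" using ne by simp
  moreover have "(a' + d') * (x1 - xW) = 2 * y1" using ab'(1,4) de'(2,3) by Groebner_Basis.algebra
  ultimately have "((a' + d') * \<delta>) * (x1 - xW) = 1 * (x1 - xW)" by Groebner_Basis.algebra
  then have s': "(a' + d') * \<delta> = 1" using W by simp
  have "Affine xU yU \<boxplus> Affine x3 y3 = Affine xW yW \<boxplus> Affine x1 y1"
    unfolding de(1) de'(1)
    by (rule fourth_point_eq[OF ab(2) de(4) ab'(3) de'(4) ab(1) ab'(1) _ _ aa s s'])
      (use ab ab' de de' in auto)
  also have "\<dots> = Affine x1 y1 \<boxplus> Affine xW yW" using Wc A by (intro add_commute[of _ c]) auto
  finally show ?thesis using U W by simp
qed

lemma same_abscissa: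
  assumes "Affine x y \<in> curve c" "Affine x y' \<in> curve c"
  shows "Affine x y' = Affine x y \<or> Affine x y' = point_neg (Affine x y)"
proof -
  have "y' ^ 2 = y ^ 2" using assms by simp
  then show ?thesis by (auto simp: power2_eq_iff)
qed

lemma add_eq_Infinity:
  assumes "P \<in> curve c" "Q \<in> curve c" "c \<noteq> 0" "P \<boxplus> Q = Infinity"
  shows "P = point_neg Q"
  using add_cancel_right[OF assms(3,1,2)] assms(4) by simp

text \<open>
  For fixed \<open>P\<close> and \<open>W\<close>, only finitely many \<open>D\<close> force one of the four additions in
  \<open>(P + W) + D = P + (W + D)\<close>, apart from \<open>P + W\<close>, not to be a chord addition.
\<close>

definition special_points :: "complex point \<Rightarrow> complex point \<Rightarrow> complex point set" where
  "special_points P W = {Infinity, P, point_neg P, W, point_neg W, P \<boxplus> W, point_neg (P \<boxplus> W),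
     P \<boxplus> point_neg W, point_neg P \<boxplus> point_neg W}"

lemma add_assoc_generic:
  assumes c: "c \<noteq> 0" and P: "P \<in> curve c" and W: "W \<in> curve c" and D: "D \<in> curve c"
    and PW: "P \<boxplus> W \<noteq> Infinity" and sp: "D \<notin> special_points P W"
  shows "(P \<boxplus> W) \<boxplus> D = P \<boxplus> (W \<boxplus> D)"
proof (cases P; cases W; cases D)
  fix x1 y1 x2 y2 x3 y3
  assume e: "P = Affine x1 y1" "W = Affine x2 y2" "D = Affine x3 y3"
  have DW: "D \<boxplus> W = W \<boxplus> D" using D W by (rule add_commute)
  obtain xU yU where U: "P \<boxplus> W = Affine xU yU" using PW by (cases "P \<boxplus> W") auto
  have Uc: "Affine xU yU \<in> curve c" using U P W add_in_curve[of P c W] by simp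
  have "W \<boxplus> D \<noteq> Infinity"
    using add_eq_Infinity[OF D W c] sp DW by (auto simp: special_points_def)
  then obtain xW yW where V: "W \<boxplus> D = Affine xW yW" by (cases "W \<boxplus> D") auto
  have Vc: "Affine xW yW \<in> curve c" using V D W add_in_curve[of W c D] by simp
  have neq: "x3 \<noteq> x" if Q: "Affine x y \<in> curve c" "D \<noteq> Affine x y" "D \<noteq> point_neg (Affine x y)" for x y
    using same_abscissa[of x y c y3] Q D e by auto
  have ne: "x3 \<noteq> x1" "x3 \<noteq> x2" "xU \<noteq> x3"
  proof -
    have "D \<noteq> P" "D \<noteq> point_neg P" "D \<noteq> W" "D \<noteq> point_neg W" "D \<noteq> P \<boxplus> W" "D \<noteq> point_neg (P \<boxplus> W)"
      using sp by (simp_all add: special_points_def)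
    then show "x3 \<noteq> x1" "x3 \<noteq> x2" "xU \<noteq> x3"
      using neq[of x1 y1] neq[of x2 y2] neq[of xU yU] P W Uc unfolding U unfolding e by auto
  qed
  have neW: "xW \<noteq> x1"
  proof
    assume "xW = x1"
    then have "D \<boxplus> W = P \<or> D \<boxplus> W = point_neg P"
      using same_abscissa[of x1 y1 c yW] P Vc V DW unfolding e by auto
    then have "D = P \<boxplus> point_neg W \<or> D = point_neg P \<boxplus> point_neg W"
      using add_cancel_right[OF c D W] by metis
    then show False using sp by (auto simp: special_points_def)
  qed
  show ?thesis
  proof (cases "x1 = x2")
    case True
    have "P \<noteq> point_neg W" using PW by auto
    then have "W = P" using same_abscissa[of x1 y1 c y2] P W True unfolding e by (metis point_neg_neg)
    then have y: "x1 = x2" "y1 = y2" using e by auto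
    have "y1 \<noteq> 0" using \<open>P \<noteq> point_neg W\<close> y e by auto
    then show ?thesis
      using add_assoc_tangent[of c y1 x1 y3 x3 xU yU xW yW] c P D ne neW U V unfolding e by (simp add: y)
  next
    case False
    then show ?thesis
      using add_assoc_chords[of c y1 x1 y2 x2 y3 x3 xU yU xW yW] c P W D ne neW U V unfolding e by auto
  qed
qed (use sp in \<open>auto simp: special_points_def\<close>)

text \<open>The supply of auxiliary points. Over \<open>K\<close> there may be only finitely many,
  so associativity is proved over the complex numbers and inherited by \<open>E c\<close>.\<close>

lemma infinite_curve: "infinite (curve (c :: complex))"
proof
  assume "finite (curve c)"
  moreover have "range (\<lambda>x. Affine x (csqrt (x ^ 3 + c))) \<subseteq> curve c" by auto
  moreover have "inj (\<lambda>x. Affine x (csqrt (x ^ 3 + c)))" by (auto intro!: injI)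
  ultimately show False using infinite_UNIV_char_0 by (metis finite_imageD finite_subset)
qed

lemma add_assoc:
  fixes c :: complex
  assumes c: "c \<noteq> 0" and A: "A \<in> curve c" and B: "B \<in> curve c" and C: "C \<in> curve c"
  shows "(A \<boxplus> B) \<boxplus> C = A \<boxplus> (B \<boxplus> C)"
proof -
  note cl = add_in_curve[where c = c]
  have AB: "A \<boxplus> B \<in> curve c" and BC: "B \<boxplus> C \<in> curve c" using A B C by auto
  consider "A \<boxplus> B = Infinity" | "B \<boxplus> C = Infinity" | "(A \<boxplus> B) \<boxplus> C = Infinity"
    | "A \<boxplus> (B \<boxplus> C) = Infinity" | "A \<boxplus> B \<noteq> Infinity" "B \<boxplus> C \<noteq> Infinity" "(A \<boxplus> B) \<boxplus> C \<noteq> Infinity"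
      "A \<boxplus> (B \<boxplus> C) \<noteq> Infinity" by blast
  then show ?thesis
  proof cases
    case 1
    then have AB': "A = point_neg B" using add_eq_Infinity[OF A B c] by simp
    have "A \<boxplus> (B \<boxplus> C) = (C \<boxplus> B) \<boxplus> point_neg B"
      using add_commute[OF B C] add_commute[OF A BC] AB' by simp
    then show ?thesis using add_cancel_right[OF c C B] 1 by simp
  next
    case 2
    then have "B = point_neg C" using add_eq_Infinity[OF B C c] by simp
    then show ?thesis using add_cancel_right[OF c A, of "point_neg C"] C 2 by simp
  next
    case 3
    then have Cn: "C = point_neg A \<boxplus> point_neg B"
      using add_eq_Infinity[OF AB C c] point_neg_add[OF A B] by (metis point_neg_neg)
    have "B \<boxplus> C = (point_neg A \<boxplus> point_neg B) \<boxplus> point_neg (point_neg B)"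
      using add_commute[OF B C] Cn by simp
    also have "\<dots> = point_neg A" by (rule add_cancel_right[OF c]) (use A B in auto)
    finally show ?thesis using 3 by simp
  next
    case 4
    then have An: "A = point_neg C \<boxplus> point_neg B"
      using add_eq_Infinity[OF A BC c] point_neg_add[OF B C] add_commute[of "point_neg B" c "point_neg C"] B C by simp
    have "A \<boxplus> B = (point_neg C \<boxplus> point_neg B) \<boxplus> point_neg (point_neg B)" using An by simp
    also have "\<dots> = point_neg C" by (rule add_cancel_right[OF c]) (use C B in auto)
    finally show ?thesis using 4 by simp
  next
    case 5
    \<comment> \<open>The first three sets serve the rebracketings with \<open>D\<close> itself; the
      translate by \<open>- C\<close> keeps \<open>C + D\<close> away from the special points of
      \<open>A\<close> and \<open>B\<close>. Comparing the four equations leaves only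
      \<open>D\<close> to be cancelled.\<close>
    let ?S = "special_points (A \<boxplus> B) C \<union> special_points B C \<union> special_points A (B \<boxplus> C)
      \<union> (\<lambda>Q. Q \<boxplus> point_neg C) ` special_points A B"
    have "finite ?S" by (simp add: special_points_def)
    then have "infinite (curve c - ?S)" using infinite_curve by (rule Diff_infinite_finite)
    then have "curve c - ?S \<noteq> {}" by (rule infinite_imp_nonempty)
    then obtain D where D: "D \<in> curve c" and sp: "D \<notin> ?S" by blast
    have CD: "C \<boxplus> D \<in> curve c" using C D by simp
    have "C \<boxplus> D \<notin> special_points A B"
      using add_cancel_right[OF c D C] add_commute[OF C D] sp by (metis UnCI image_eqI)
    then have "(A \<boxplus> B) \<boxplus> (C \<boxplus> D) = A \<boxplus> (B \<boxplus> (C \<boxplus> D))"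
      using add_assoc_generic[OF c A B CD 5(1)] by simp
    moreover have "((A \<boxplus> B) \<boxplus> C) \<boxplus> D = (A \<boxplus> B) \<boxplus> (C \<boxplus> D)"
      using add_assoc_generic[OF c AB C D 5(3)] sp by simp
    moreover have "(B \<boxplus> C) \<boxplus> D = B \<boxplus> (C \<boxplus> D)"
      using add_assoc_generic[OF c B C D 5(2)] sp by simp
    moreover have "(A \<boxplus> (B \<boxplus> C)) \<boxplus> D = A \<boxplus> ((B \<boxplus> C) \<boxplus> D)"
      using add_assoc_generic[OF c A BC D 5(4)] sp by simp
    ultimately have eq: "((A \<boxplus> B) \<boxplus> C) \<boxplus> D = (A \<boxplus> (B \<boxplus> C)) \<boxplus> D" by simp
    show ?thesis by (rule add_right_cancel[OF c _ _ D eq]) (use A B C in auto)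
  qed
qed

section \<open>Subfields of the complex numbers and the group of \<open>K\<close>-points\<close>

locale complex_subfield =
  fixes K :: "complex set"
  assumes one_mem: "1 \<in> K"
    and add_mem: "\<And>x y. x \<in> K \<Longrightarrow> y \<in> K \<Longrightarrow> x + y \<in> K"
    and uminus_mem: "\<And>x. x \<in> K \<Longrightarrow> - x \<in> K"
    and mult_mem: "\<And>x y. x \<in> K \<Longrightarrow> y \<in> K \<Longrightarrow> x * y \<in> K"
    and inverse_mem: "\<And>x. x \<in> K \<Longrightarrow> inverse x \<in> K"
begin

lemma zero_mem: "0 \<in> K"
  using add_mem[OF one_mem uminus_mem[OF one_mem]] by simp

lemma diff_mem: "x \<in> K \<Longrightarrow> y \<in> K \<Longrightarrow> x - y \<in> K"
  using add_mem[of x "- y"] uminus_mem[of y] by simp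

lemma divide_mem: "x \<in> K \<Longrightarrow> y \<in> K \<Longrightarrow> x / y \<in> K"
  using mult_mem[of x "inverse y"] inverse_mem[of y] by (simp add: divide_inverse)

lemma power_mem: "x \<in> K \<Longrightarrow> x ^ n \<in> K"
  by (induction n) (auto intro: one_mem mult_mem)

lemma of_nat_mem: "of_nat n \<in> K"
  by (induction n) (auto intro: zero_mem one_mem add_mem)

lemma of_int_mem: "of_int n \<in> K"
  by (cases n) (auto intro: of_nat_mem uminus_mem simp del: of_nat_Suc)

lemma numeral_mem: "numeral n \<in> K"
  using of_nat_mem[of "numeral n"] by simp

lemma of_rat_mem: "of_rat q \<in> K"
  by (cases q) (auto simp: of_rat_rat intro: divide_mem of_int_mem)

lemma Rats_mem: "x \<in> \<rat> \<Longrightarrow> x \<in> K"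
  by (auto simp: Rats_def intro: of_rat_mem)

lemmas mem_intros = zero_mem one_mem add_mem uminus_mem mult_mem inverse_mem diff_mem divide_mem
  power_mem of_nat_mem of_int_mem numeral_mem of_rat_mem

abbreviation E :: "complex \<Rightarrow> complex point monoid" where
  "E c \<equiv> mordell_group K c"

lemma carrier_E: "carrier (E c) = {P \<in> curve c. \<forall>x y. P = Affine x y \<longrightarrow> x \<in> K \<and> y \<in> K}"
  by (auto simp: mordell_group_def curve_def)

lemma mult_E [simp]: "monoid.mult (E c) = (\<boxplus>)"
  by (simp add: mordell_group_def)

lemma one_E [simp]: "one (E c) = Infinity"
  by (simp add: mordell_group_def)

lemma Affine_in_E: "Affine x y \<in> carrier (E c) \<longleftrightarrow> x \<in> K \<and> y \<in> K \<and> y ^ 2 = x ^ 3 + c"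
  by (auto simp: carrier_E)

lemma Infinity_in_E: "Infinity \<in> carrier (E c)"
  by (auto simp: carrier_E)

lemma point_neg_in_E: "P \<in> carrier (E c) \<Longrightarrow> point_neg P \<in> carrier (E c)"
  by (cases P) (auto simp: carrier_E intro: uminus_mem)

lemma comm_group_E:
  assumes c: "c \<noteq> 0"
  shows "comm_group (E c)"
proof (rule comm_groupI)
  fix P Q assume PQ: "P \<in> carrier (E c)" "Q \<in> carrier (E c)"
  then have cur: "P \<boxplus> Q \<in> curve c" by (auto simp: carrier_E)
  have "x \<in> K \<and> y \<in> K" if "P \<boxplus> Q = Affine x y" for x y
    using that PQ
    by (cases P; cases Q)
      (auto simp: carrier_E mordell_add.simps(3) Let_def split: if_splits intro!: mem_intros)
  then show "P \<otimes>\<^bsub>E c\<^esub> Q \<in> carrier (E c)" using cur by (simp add: carrier_E)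
  show "P \<otimes>\<^bsub>E c\<^esub> Q = Q \<otimes>\<^bsub>E c\<^esub> P" using PQ by (auto simp: carrier_E intro: add_commute)
next
  fix P Q R assume "P \<in> carrier (E c)" "Q \<in> carrier (E c)" "R \<in> carrier (E c)"
  then show "P \<otimes>\<^bsub>E c\<^esub> Q \<otimes>\<^bsub>E c\<^esub> R = P \<otimes>\<^bsub>E c\<^esub> (Q \<otimes>\<^bsub>E c\<^esub> R)"
    using add_assoc[OF c] by (auto simp: carrier_E)
next
  fix P assume "P \<in> carrier (E c)"
  then show "\<exists>Q\<in>carrier (E c). Q \<otimes>\<^bsub>E c\<^esub> P = \<one>\<^bsub>E c\<^esub>"
    using point_neg_in_E by (intro bexI[of _ "point_neg P"]) auto
qed (auto simp: Infinity_in_E)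

end

section \<open>Extending the 3-adic valuation\<close>

definition is_subring :: "complex set \<Rightarrow> bool" where
  "is_subring R \<longleftrightarrow> 1 \<in> R \<and> (\<forall>x\<in>R. \<forall>y\<in>R. x + y \<in> R \<and> x * y \<in> R) \<and> (\<forall>x\<in>R. - x \<in> R)"

lemma is_subringD:
  assumes "is_subring R"
  shows "1 \<in> R" "x \<in> R \<Longrightarrow> y \<in> R \<Longrightarrow> x + y \<in> R" "x \<in> R \<Longrightarrow> y \<in> R \<Longrightarrow> x * y \<in> R" "x \<in> R \<Longrightarrow> - x \<in> R"
    "x \<in> R \<Longrightarrow> y \<in> R \<Longrightarrow> x - y \<in> R" "0 \<in> R"
proof -
  show a: "1 \<in> R" "x \<in> R \<Longrightarrow> y \<in> R \<Longrightarrow> x + y \<in> R" "x \<in> R \<Longrightarrow> y \<in> R \<Longrightarrow> x * y \<in> R" "x \<in> R \<Longrightarrow> - x \<in> R" for x y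
    using assms by (auto simp: is_subring_def)
  show "x \<in> R \<Longrightarrow> y \<in> R \<Longrightarrow> x - y \<in> R" using a(2)[of x "- y"] a(4)[of y] by simp
  show "0 \<in> R" using a(2)[of 1 "- 1"] a(1) a(4)[of 1] by simp
qed

lemma subring_power: "is_subring R \<Longrightarrow> x \<in> R \<Longrightarrow> x ^ n \<in> R"
  by (induction n) (auto intro: is_subringD)

lemma subring_sum: "is_subring R \<Longrightarrow> (\<And>i. i \<in> A \<Longrightarrow> f i \<in> R) \<Longrightarrow> sum f A \<in> R"
  by (induction A rule: infinite_finite_induct) (auto intro: is_subringD)

lemma subring_of_nat: "is_subring R \<Longrightarrow> of_nat n \<in> R"
  by (induction n) (auto intro: is_subringD)

lemma subring_of_int: "is_subring R \<Longrightarrow> of_int n \<in> R"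
  by (cases n) (auto intro: is_subringD subring_of_nat simp del: of_nat_Suc)

lemma subring_numeral: "is_subring R \<Longrightarrow> numeral n \<in> R"
  using subring_of_nat[of R "numeral n"] by simp

text \<open>Maximality among the subrings omitting 1/3 will make \<open>R\<close> a valuation ring
  in which 3 is not a unit, as in Chevalley's extension theorem.\<close>

locale maximal_subring =
  fixes R :: "complex set"
  assumes sr: "is_subring R" and third: "1 / 3 \<notin> R"
    and maximal: "\<And>S. is_subring S \<Longrightarrow> R \<subseteq> S \<Longrightarrow> 1 / 3 \<notin> S \<Longrightarrow> S = R"
begin

lemmas R_intros = is_subringD[OF sr] subring_power[OF sr] subring_sum[OF sr] subring_of_int[OF sr]
  subring_numeral[OF sr]

lemma power_one_minus_triple:
  assumes b: "b \<in> R"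
  shows "\<exists>b'\<in>R. (1 - 3 * b) ^ n = 1 - 3 * b'"
proof (induction n)
  case 0
  then show ?case by (intro bexI[of _ 0]) (auto intro: R_intros)
next
  case (Suc n)
  then obtain b' where b': "b' \<in> R" "(1 - 3 * b) ^ n = 1 - 3 * b'" by auto
  then have "(1 - 3 * b) ^ Suc n = (1 - 3 * b) * (1 - 3 * b')" by simp
  also have "\<dots> = 1 - 3 * (b + b' - 3 * b * b')" by (simp add: algebra_simps)
  finally have "(1 - 3 * b) ^ Suc n = 1 - 3 * (b + b' - 3 * b * b')" .
  then show ?case using b b' by (intro bexI[of _ "b + b' - 3 * b * b'"]) (auto intro: R_intros)
qed

text \<open>If the localisation of \<open>R\<close> at \<open>u = 1 - 3 b\<close> contained 1/3,
  then \<open>u ^ n = 3 a\<close>; but \<open>u ^ n\<close> again has the form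
  \<open>1 - 3 b'\<close>, which would put 1/3 into \<open>R\<close>. So the localisation equals
  \<open>R\<close> by maximality.\<close>

lemma one_minus_triple_unit:
  assumes b: "b \<in> R"
  shows "1 - 3 * b \<noteq> 0" "1 / (1 - 3 * b) \<in> R"
proof -
  define u where "u = 1 - 3 * b"
  show nz: "1 - 3 * b \<noteq> 0"
  proof
    assume "1 - 3 * b = 0"
    then have "b = 1 / 3" by (simp add: field_simps)
    then show False using b third by metis
  qed
  then have u0: "u \<noteq> 0" by (simp add: u_def)
  have u: "u \<in> R" using b by (auto simp: u_def intro: R_intros)
  define S where "S = {a / u ^ n | a n. a \<in> R}"
  have SI: "x \<in> S" if "x = a / u ^ n" "a \<in> R" for x a n
    using that by (auto simp: S_def)
  have "is_subring S"
    unfolding is_subring_def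
  proof (intro conjI ballI)
    show "1 \<in> S" unfolding S_def using R_intros(1) by (intro CollectI exI[of _ 1] exI[of _ 0]) auto
    fix x y assume "x \<in> S" "y \<in> S"
    then obtain a m c n where xy: "x = a / u ^ m" "y = c / u ^ n" "a \<in> R" "c \<in> R" by (auto simp: S_def)
    have "x = (a * u ^ n) / u ^ (m + n)" "y = (c * u ^ m) / u ^ (m + n)" using xy u0 by (simp_all add: power_add)
    then have "x + y = (a * u ^ n + c * u ^ m) / u ^ (m + n)" by (simp add: add_divide_distrib)
    then show "x + y \<in> S" by (rule SI) (use xy u in \<open>auto intro: R_intros\<close>)
    have "x * y = (a * c) / u ^ (m + n)" using xy by (simp add: power_add)
    then show "x * y \<in> S" by (rule SI) (use xy u in \<open>auto intro: R_intros\<close>)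
  next
    fix x assume "x \<in> S"
    then obtain a m where x: "x = a / u ^ m" "a \<in> R" by (auto simp: S_def)
    then have "- x = (- a) / u ^ m" by simp
    then show "- x \<in> S" by (rule SI) (use x in \<open>auto intro: R_intros\<close>)
  qed
  moreover have "R \<subseteq> S"
  proof
    fix x assume "x \<in> R"
    then show "x \<in> S" unfolding S_def by (intro CollectI exI[of _ x] exI[of _ 0]) auto
  qed
  moreover have "1 / 3 \<notin> S"
  proof
    assume "1 / 3 \<in> S"
    then obtain a n where a: "1 / 3 = a / u ^ n" "a \<in> R" by (auto simp: S_def)
    obtain b' where b': "b' \<in> R" "u ^ n = 1 - 3 * b'" using power_one_minus_triple[OF b] u_def by blast
    have "u ^ n = 3 * a" using a u0 by (simp add: field_simps)
    then have "1 / 3 = a + b'" using b' by (simp add: field_simps)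
    then show False using third a b' R_intros(2)[of a b'] by simp
  qed
  ultimately have "S = R" by (rule maximal)
  moreover have "1 / u \<in> S" unfolding S_def using R_intros(1) by (intro CollectI exI[of _ 1]) auto
  ultimately show "1 / (1 - 3 * b) \<in> R" by (simp add: u_def)
qed

definition R_poly :: "complex poly \<Rightarrow> bool" where
  "R_poly p \<longleftrightarrow> (\<forall>i. Polynomial.coeff p i \<in> R)"

lemma R_poly_intros:
  "a \<in> R \<Longrightarrow> R_poly (Polynomial.monom a n)" "R_poly p \<Longrightarrow> R_poly q \<Longrightarrow> R_poly (p + q)" "R_poly p \<Longrightarrow> R_poly q \<Longrightarrow> R_poly (p - q)"
  "R_poly p \<Longrightarrow> R_poly q \<Longrightarrow> R_poly (p * q)" "R_poly p \<Longrightarrow> R_poly (- p)" "a \<in> R \<Longrightarrow> R_poly p \<Longrightarrow> R_poly (Polynomial.smult a p)"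
  "a \<in> R \<Longrightarrow> R_poly p \<Longrightarrow> R_poly (pCons a p)" "R_poly 0" "R_poly 1"
  by (auto simp: R_poly_def Polynomial.coeff_mult coeff_pCons Polynomial.coeff_1 split: nat.splits intro!: R_intros)

text \<open>The ring \<open>R[z]\<close> is strictly larger than \<open>R\<close>, so by maximality
  it contains 1/3.\<close>

lemma third_in_extension:
  assumes "z \<notin> R"
  shows "\<exists>p. R_poly p \<and> 3 * poly p z = 1"
proof (rule ccontr)
  assume no: "\<not> ?thesis"
  define S where "S = {poly p z | p. R_poly p}"
  have "is_subring S"
    unfolding is_subring_def
  proof (intro conjI ballI)
    show "1 \<in> S" unfolding S_def by (intro CollectI exI[of _ 1]) (auto intro: R_poly_intros)
    fix x y assume "x \<in> S" "y \<in> S"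
    then obtain p q where xy: "x = poly p z" "y = poly q z" "R_poly p" "R_poly q" by (auto simp: S_def)
    show "x + y \<in> S" unfolding S_def using xy by (intro CollectI exI[of _ "p + q"]) (auto intro: R_poly_intros)
    show "x * y \<in> S" unfolding S_def using xy by (intro CollectI exI[of _ "p * q"]) (auto intro: R_poly_intros)
  next
    fix x assume "x \<in> S"
    then obtain p where x: "x = poly p z" "R_poly p" by (auto simp: S_def)
    show "- x \<in> S" unfolding S_def using x by (intro CollectI exI[of _ "- p"]) (auto intro: R_poly_intros)
  qed
  moreover have "R \<subseteq> S"
  proof
    fix x assume "x \<in> R"
    then show "x \<in> S" unfolding S_def by (intro CollectI exI[of _ "[:x:]"]) (auto intro: R_poly_intros)
  qed
  moreover have "1 / 3 \<notin> S"
  proof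
    assume "1 / 3 \<in> S"
    then obtain p where p: "1 / 3 = poly p z" "R_poly p" by (auto simp: S_def)
    then have "3 * poly p z = 1" by (simp add: field_simps)
    then show False using no p by blast
  qed
  ultimately have "S = R" by (rule maximal)
  moreover have "z \<in> S" unfolding S_def
    by (intro CollectI exI[of _ "[:0, 1:]"]) (auto intro!: R_poly_intros R_intros)
  ultimately show False using assms by simp
qed

definition relation_degree :: "complex \<Rightarrow> nat \<Rightarrow> bool" where
  "relation_degree z n \<longleftrightarrow> (\<exists>p. R_poly p \<and> Polynomial.degree p \<le> n \<and> 3 * poly p z = 1)"

lemma relation_degree_pos: "relation_degree z n \<Longrightarrow> n > 0"
proof (rule ccontr)
  assume "relation_degree z n" "\<not> n > 0"
  then obtain p where p: "R_poly p" "Polynomial.degree p = 0" "3 * poly p z = 1" by (auto simp: relation_degree_def)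
  then obtain a where a: "p = [:a:]" by (metis degree_eq_zeroE)
  then have "3 * a = 1" using p by simp
  then have "a = 1 / 3" by (simp add: eq_divide_eq mult.commute)
  moreover have "a \<in> R" using p(1) a by (auto simp: R_poly_def dest: spec[of _ 0])
  ultimately show False using third by metis
qed

text \<open>In the relation for \<open>1 / z\<close> the constant term can be absorbed, since
  \<open>1 - 3 q0\<close> is a unit. Solving for \<open>z\<close> and multiplying by
  \<open>z ^ (n - 1)\<close> expresses \<open>z ^ n\<close> by lower powers over \<open>R\<close>,
  which removes the top term from the relation for \<open>z\<close>.\<close>

lemma relation_degree_lower:
  assumes z: "z \<noteq> 0" and n: "relation_degree z n" and m: "relation_degree (1 / z) m" and mn: "m \<le> n"
  shows "relation_degree z (n - 1)"
proof -
  obtain p where p: "R_poly p" "Polynomial.degree p \<le> n" "3 * poly p z = 1" using n by (auto simp: relation_degree_def)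
  obtain q where q: "R_poly q" "Polynomial.degree q \<le> m" "3 * poly q (1 / z) = 1" using m by (auto simp: relation_degree_def)
  have m0: "m > 0" and n0: "n > 0" using relation_degree_pos n m by auto
  obtain q0 s where s: "q = pCons q0 s" by (metis pCons_cases)
  have q0: "q0 \<in> R" using q(1) s by (auto simp: R_poly_def dest: spec[of _ 0])
  have sR: "Polynomial.coeff s i \<in> R" for i
    using q(1) s by (metis R_poly_def coeff_pCons_Suc)
  define u where "u = 1 - 3 * q0"
  have u: "u \<noteq> 0" "1 / u \<in> R" using one_minus_triple_unit[OF q0] by (auto simp: u_def)
  have sdeg: "Polynomial.degree s \<le> m - 1" 
  proof (cases "s = 0")
    case False
    then have "Polynomial.degree q = Suc (Polynomial.degree s)" using s by (simp add: degree_pCons_eq)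
    then show ?thesis using q(2) by simp
  qed simp
  have "3 * (q0 + poly s (1 / z) / z) = 1" using q(3) s by simp
  then have "z * (3 * (q0 + poly s (1 / z) / z)) = z" by simp
  moreover have "z * (3 * (q0 + poly s (1 / z) / z)) = 3 * q0 * z + 3 * poly s (1 / z)"
    using z by (simp add: distrib_left)
  ultimately have "3 * q0 * z + 3 * poly s (1 / z) = z" by metis
  then have "u * z = 3 * poly s (1 / z)" by (simp add: u_def left_diff_distrib diff_eq_eq add.commute)
  then have "z = 3 * (1 / u) * poly s (1 / z)" using u by (simp add: eq_divide_eq mult.commute)
  then have zn: "z ^ n = 3 * (1 / u) * (z ^ (n - 1) * poly s (1 / z))"
    using n0 by (metis (no_types, lifting) mult.assoc mult.commute power_minus_mult)
  \<comment> \<open>Here \<open>m \<le> n\<close> matters: it keeps the natural-number exponents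
    \<open>n - 1 - i\<close> from being truncated.\<close>
  have zs: "z ^ (n - 1) * poly s (1 / z) = (\<Sum>i\<le>Polynomial.degree s. Polynomial.coeff s i * z ^ (n - 1 - i))"
  proof -
    have "poly s (1 / z) = (\<Sum>i\<le>Polynomial.degree s. Polynomial.coeff s i * (1 / z) ^ i)"
      by (rule poly_altdef)
    then have "z ^ (n - 1) * poly s (1 / z) = (\<Sum>i\<le>Polynomial.degree s. z ^ (n - 1) * (Polynomial.coeff s i * (1 / z) ^ i))"
      by (simp add: sum_distrib_left)
    also have "\<dots> = (\<Sum>i\<le>Polynomial.degree s. Polynomial.coeff s i * z ^ (n - 1 - i))"
    proof (rule sum.cong)
      fix i assume "i \<in> {..Polynomial.degree s}"
      then have "i \<le> n - 1" using mn sdeg by auto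
      then have "z ^ (n - 1) = z ^ (n - 1 - i) * z ^ i" by (metis power_add le_add_diff_inverse2)
      then show "z ^ (n - 1) * (Polynomial.coeff s i * (1 / z) ^ i) = Polynomial.coeff s i * z ^ (n - 1 - i)"
        using z by (simp add: power_one_over field_simps)
    qed simp
    finally show ?thesis .
  qed
  define h where "h = (\<Sum>i\<le>Polynomial.degree s. Polynomial.monom (Polynomial.coeff s i) (n - 1 - i))"
  have ph: "poly h z = z ^ (n - 1) * poly s (1 / z)"
    unfolding zs h_def by (simp add: poly_sum poly_monom)
  have hR: "R_poly h" unfolding h_def R_poly_def
    by (auto simp: Polynomial.coeff_sum intro!: R_intros sR split: if_splits)
  have hdeg: "Polynomial.degree h \<le> n - 1" unfolding h_def
    by (intro degree_sum_le) (auto intro: order.trans[OF Polynomial.degree_monom_le])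
  define a where "a = Polynomial.coeff p n"
  have aR: "a \<in> R" using p(1) by (auto simp: a_def R_poly_def)
  define p' where "p' = (p - Polynomial.monom a n) + Polynomial.smult (3 * (1 / u) * a) h"
  have "R_poly p'" unfolding p'_def
    by (intro R_poly_intros p(1) aR hR R_intros(3) u(2) R_intros(10))
  moreover have "Polynomial.degree p' \<le> n - 1"
  proof -
    have "Polynomial.degree (p - Polynomial.monom a n) \<le> n - 1"
    proof (rule degree_le, intro allI impI)
      fix i assume "n - 1 < i"
      then show "Polynomial.coeff (p - Polynomial.monom a n) i = 0"
        using p(2) by (cases "i = n") (auto simp: a_def coeff_eq_0)
    qed
    then show ?thesis unfolding p'_def
      using hdeg degree_add_le degree_smult_le order.trans by blast
  qed
  moreover have "poly p' z = poly p z"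
    using zn ph by (simp add: p'_def poly_monom)
  ultimately show ?thesis using p(3) by (auto simp: relation_degree_def intro!: exI[of _ p'])
qed

text \<open>Otherwise both \<open>z\<close> and \<open>1 / z\<close> satisfy relations, and the
  larger of the two minimal degrees could be lowered.\<close>

lemma R_or_inverse:
  assumes z: "z \<noteq> 0"
  shows "z \<in> R \<or> 1 / z \<in> R"
proof (rule ccontr)
  assume no: "\<not> ?thesis"
  have ex: "\<exists>n. relation_degree z n" "\<exists>n. relation_degree (1 / z) n"
    using third_in_extension[of z] third_in_extension[of "1 / z"] no by (auto simp: relation_degree_def)
  define n m where "n = (LEAST n. relation_degree z n)" and "m = (LEAST n. relation_degree (1 / z) n)"
  have n: "relation_degree z n" and m: "relation_degree (1 / z) m"
    unfolding n_def m_def using ex by (auto intro: LeastI_ex)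
  have pos: "n > 0" "m > 0" using n m relation_degree_pos by auto
  show False
  proof (cases "m \<le> n")
    case True
    then have "relation_degree z (n - 1)" using relation_degree_lower[OF z n m] by simp
    then show False using pos Least_le[of "relation_degree z" "n - 1"] unfolding n_def by auto
  next
    case False
    then have "relation_degree (1 / z) (m - 1)" using relation_degree_lower[of "1 / z" m n] n m z by simp
    then show False using pos Least_le[of "relation_degree (1 / z)" "m - 1"] unfolding m_def by auto
  qed
qed

end

lemma third_not_int: "(1 / 3 :: complex) \<notin> \<int>"
proof
  assume "(1 / 3 :: complex) \<in> \<int>"
  then obtain n :: int where "(1 / 3 :: complex) = of_int n" by (auto elim: Ints_cases)
  then have "3 * (of_int n :: complex) = 3 * (1 / 3)" by metis
  then have "(of_int (3 * n) :: complex) = of_int 1" by simp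
  then have "3 * n = 1" by (simp only: of_int_eq_iff)
  then show False by presburger
qed

lemma exists_maximal_subring: "\<exists>R. maximal_subring R"
proof -
  define \<A> where "\<A> = {S. is_subring S \<and> 1 / 3 \<notin> S}"
  have "\<int> \<in> \<A>" using third_not_int by (auto simp: \<A>_def is_subring_def)
  moreover have "\<Union>\<C> \<in> \<A>" if ne: "\<C> \<noteq> {}" and ch: "subset.chain \<A> \<C>" for \<C>
  proof -
    have sub: "is_subring S" "1 / 3 \<notin> S" if "S \<in> \<C>" for S
      using ch that by (auto simp: subset.chain_def \<A>_def)
    have tot: "S \<subseteq> T \<or> T \<subseteq> S" if "S \<in> \<C>" "T \<in> \<C>" for S T
      using ch that by (auto simp: subset.chain_def)
    have "is_subring (\<Union>\<C>)"
      unfolding is_subring_def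
    proof (intro conjI ballI)
      show "1 \<in> \<Union>\<C>" using ne sub is_subringD(1) by blast
      fix x y assume "x \<in> \<Union>\<C>" "y \<in> \<Union>\<C>"
      then obtain S where "S \<in> \<C>" "x \<in> S" "y \<in> S" using tot by blast
      then show "x + y \<in> \<Union>\<C>" "x * y \<in> \<Union>\<C>" using sub(1) is_subringD by blast+
    next
      fix x assume "x \<in> \<Union>\<C>"
      then show "- x \<in> \<Union>\<C>" using sub(1) is_subringD by blast
    qed
    then show ?thesis using sub by (auto simp: \<A>_def)
  qed
  ultimately obtain M where "M \<in> \<A>" "\<forall>S\<in>\<A>. M \<subseteq> S \<longrightarrow> S = M"
    using subset_Zorn_nonempty[of \<A>] by blast
  then have "maximal_subring M" by unfold_locales (auto simp: \<A>_def)
  then show ?thesis ..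
qed

section \<open>The valuation attached to the maximal subring\<close>

context maximal_subring
begin

definition unit :: "complex \<Rightarrow> bool" where
  "unit z \<longleftrightarrow> z \<noteq> 0 \<and> z \<in> R \<and> 1 / z \<in> R"

lemma unit_intros:
  "unit 1" "unit z \<Longrightarrow> unit w \<Longrightarrow> unit (z * w)" "unit z \<Longrightarrow> unit (1 / z)" "unit z \<Longrightarrow> unit (- z)"
proof -
  show "unit 1" using R_intros(1) by (simp add: unit_def)
  show "unit z \<Longrightarrow> unit w \<Longrightarrow> unit (z * w)"
    using R_intros(3)[of z w] R_intros(3)[of "1 / z" "1 / w"] by (simp add: unit_def)
  show "unit z \<Longrightarrow> unit (1 / z)" by (simp add: unit_def)
  show "unit z \<Longrightarrow> unit (- z)" using R_intros(4)[of z] R_intros(4)[of "1 / z"] by (simp add: unit_def)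
qed

lemma unit_factor:
  assumes "unit (x * y)" "x \<in> R" "y \<in> R"
  shows "unit x"
proof -
  have "1 / x = y * (1 / (x * y))" using assms(1) by (simp add: unit_def)
  then have "1 / x \<in> R" using assms R_intros(3)[of y "1 / (x * y)"] by (auto simp: unit_def)
  then show ?thesis using assms by (auto simp: unit_def)
qed

lemma unit_power: "unit z \<Longrightarrow> unit (z ^ n)"
  by (induction n) (auto intro: unit_intros)

lemma not_unit_3: "\<not> unit 3"
  using third by (simp add: unit_def)

text \<open>\<open>R\<close> is local: one of \<open>x / y\<close> and \<open>y / x\<close> lies in
  \<open>R\<close>, so the sum is a multiple of \<open>x\<close> or of \<open>y\<close>.\<close>

lemma nonunit_add:
  assumes x: "x \<in> R" "\<not> unit x" and y: "y \<in> R" "\<not> unit y"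
  shows "\<not> unit (x + y)"
proof
  assume u: "unit (x + y)"
  have *: False if xy: "x \<noteq> 0" "y \<noteq> 0" "x / y \<in> R" "y \<in> R" "\<not> unit y" "unit (x + y)" for x y
  proof -
    have "x + y = y * (1 + x / y)" using xy by (simp add: field_simps)
    then have "unit (y * (1 + x / y))" using xy by simp
    then have "unit y" by (rule unit_factor) (use xy in \<open>auto intro: R_intros\<close>)
    then show False using xy by simp
  qed
  show False
  proof (cases "x = 0 \<or> y = 0")
    case False
    then have "x / y \<in> R \<or> y / x \<in> R" using R_or_inverse[of "x / y"] by simp
    then show False using *[of x y] *[of y x] False x y u by (auto simp: add.commute)
  qed (use u x y in auto)
qed

lemma nonunit_sum:
  "(\<And>i. i \<in> A \<Longrightarrow> f i \<in> R \<and> \<not> unit (f i)) \<Longrightarrow> sum f A \<in> R \<and> \<not> unit (sum f A)"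
proof (induction A rule: infinite_finite_induct)
  case (insert a A)
  then show ?case using nonunit_add[of "f a" "sum f A"] R_intros(2)[of "f a" "sum f A"] by auto
qed (auto simp: unit_def intro: R_intros)

text \<open>Otherwise Bezout's identity with 3 would write 1 as a sum of two nonunits.\<close>

lemma unit_of_int:
  assumes "\<not> 3 dvd n"
  shows "unit (of_int n)"
proof (rule ccontr)
  assume nu: "\<not> unit (of_int n)"
  have "coprime 3 n" using assms by (intro prime_imp_coprime) auto
  then have "coprime n 3" by (simp add: coprime_commute)
  then obtain a b where ab: "a * n + b * 3 = 1" by (metis bezout_int coprime_iff_gcd_eq_1)
  have n: "of_int n \<in> R" by (rule R_intros)
  have "\<not> unit (of_int a * of_int n)"
    using unit_factor[of "of_int n" "of_int a"] nu n R_intros(9)[of a] by (auto simp: mult.commute)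
  moreover have "\<not> unit (of_int b * 3)"
    using unit_factor[of 3 "of_int b"] not_unit_3 R_intros(9)[of b] R_intros(10) by (auto simp: mult.commute)
  ultimately have "\<not> unit (of_int a * of_int n + of_int b * 3)"
    by (intro nonunit_add) (auto intro: R_intros)
  moreover have "(of_int a * of_int n + of_int b * 3 :: complex) = of_int (a * n + b * 3)" by simp
  ultimately show False using ab unit_intros(1) by simp
qed

text \<open>\<open>has_val z q\<close>: the valuation of \<open>z\<close>, normalised by \<open>3 \<mapsto> 1\<close>, is \<open>q\<close>.\<close>

definition has_val :: "complex \<Rightarrow> rat \<Rightarrow> bool" where
  "has_val z q \<longleftrightarrow> z \<noteq> 0 \<and> (\<exists>k l. k > 0 \<and> q = of_int l / of_nat k \<and> unit (z ^ k * 3 powi (- l)))"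

lemma has_valI: "z \<noteq> 0 \<Longrightarrow> k > 0 \<Longrightarrow> unit (z ^ k * 3 powi (- l)) \<Longrightarrow> has_val z (of_int l / of_nat k)"
  by (auto simp: has_val_def)

lemma has_val_mult:
  assumes "has_val z p" "has_val w q"
  shows "has_val (z * w) (p + q)"
proof -
  obtain k l where z: "z \<noteq> 0" "k > 0" "p = of_int l / of_nat k" "unit (z ^ k * 3 powi (- l))"
    using assms by (auto simp: has_val_def)
  obtain k' l' where w: "w \<noteq> 0" "k' > 0" "q = of_int l' / of_nat k'" "unit (w ^ k' * 3 powi (- l'))"
    using assms by (auto simp: has_val_def)
  have "unit ((z ^ k * 3 powi (- l)) ^ k' * (w ^ k' * 3 powi (- l')) ^ k)"
    using unit_intros(2)[OF unit_power[OF z(4)] unit_power[OF w(4)]] .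
  also have "(z ^ k * 3 powi (- l)) ^ k' * (w ^ k' * 3 powi (- l')) ^ k
      = (z * w) ^ (k * k') * 3 powi (- (l * int k' + l' * int k))"
  proof -
    have "3 powi (- (l * int k' + l' * int k)) = (3 :: complex) powi (- l * int k') * 3 powi (- l' * int k)"
      by (simp add: power_int_add[symmetric])
    also have "\<dots> = (3 powi (- l)) ^ k' * (3 powi (- l')) ^ k"
      by (simp only: power_int_mult power_int_of_nat)
    finally have e: "3 powi (- (l * int k' + l' * int k)) = (3 powi (- l)) ^ k' * ((3 :: complex) powi (- l')) ^ k" .
    show ?thesis unfolding e by (simp add: power_mult_distrib power_mult mult_ac) (simp add: power_mult[symmetric] mult_ac)
  qed
  finally have "unit ((z * w) ^ (k * k') * 3 powi (- (l * int k' + l' * int k)))" .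
  then have "has_val (z * w) (of_int (l * int k' + l' * int k) / of_nat (k * k'))"
    using z w by (intro has_valI) auto
  moreover have "of_int (l * int k' + l' * int k) / of_nat (k * k') = p + q"
    using z w by (simp add: field_simps)
  ultimately show ?thesis by simp
qed

lemma has_val_inverse:
  assumes "has_val z p"
  shows "has_val (1 / z) (- p)"
proof -
  obtain k l where z: "z \<noteq> 0" "k > 0" "p = of_int l / of_nat k" "unit (z ^ k * 3 powi (- l))"
    using assms by (auto simp: has_val_def)
  have "unit (1 / (z ^ k * 3 powi (- l)))" by (rule unit_intros(3)[OF z(4)])
  also have "1 / (z ^ k * 3 powi (- l)) = (1 / z) ^ k * 3 powi (- (- l))"
    by (simp add: power_int_minus power_one_over divide_inverse power_inverse)
  finally have "has_val (1 / z) (of_int (- l) / of_nat k)" using z by (intro has_valI) auto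
  then show ?thesis using z by simp
qed

text \<open>If \<open>z\<close> were outside \<open>R\<close>, then \<open>1 / z\<close> would lie
  in \<open>R\<close> and divide a unit, the cofactor being a product of powers of
  \<open>1 / z\<close> and of 3; so \<open>z\<close> would be in \<open>R\<close> after all.\<close>

lemma has_val_nonneg:
  assumes "has_val z p" "p \<ge> 0"
  shows "z \<in> R"
proof (rule ccontr)
  assume no: "z \<notin> R"
  obtain k l where z: "z \<noteq> 0" "k > 0" "p = of_int l / of_nat k" "unit (z ^ k * 3 powi (- l))"
    using assms by (auto simp: has_val_def)
  have l: "l \<ge> 0" using assms z by (simp add: zero_le_divide_iff)
  then obtain n where n: "l = int n" by (metis nonneg_int_cases)
  have i: "1 / z \<in> R" using R_or_inverse[of z] z no by auto
  have "unit (1 / (z ^ k * 3 powi (- l)))" by (rule unit_intros(3)[OF z(4)])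
  also have "1 / (z ^ k * 3 powi (- l)) = (1 / z) * ((1 / z) ^ (k - 1) * 3 ^ n)"
    using z n by (simp add: power_int_minus power_one_over divide_inverse power_inverse power_eq_if[of z k])
  finally have "unit (1 / z)" by (rule unit_factor) (use i in \<open>auto intro: R_intros\<close>)
  then show False using no by (simp add: unit_def)
qed

lemma has_val_R:
  assumes "has_val z p" "z \<in> R"
  shows "p \<ge> 0"
proof (rule ccontr)
  assume no: "\<not> p \<ge> 0"
  obtain k l where z: "z \<noteq> 0" "k > 0" "p = of_int l / of_nat k" "unit (z ^ k * 3 powi (- l))"
    using assms by (auto simp: has_val_def)
  have "of_int l / of_nat k < (0 :: rat)" using no z(3) by simp
  then have "(of_int l :: rat) < 0" using z(2) by (simp add: divide_less_0_iff)
  then have l: "l < 0" by simp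
  then obtain n where n: "- l = int (Suc n)" by (metis neg_int_cases minus_minus gr0_conv_Suc)
  have "z ^ k * 3 powi (- l) = 3 * (z ^ k * 3 ^ n)" unfolding n power_int_of_nat by simp
  then have "unit (3 * (z ^ k * 3 ^ n))" using z(4) by (simp only:)
  then have "unit 3" by (rule unit_factor) (use assms in \<open>auto intro: R_intros\<close>)
  then show False using not_unit_3 by simp
qed

lemma has_val_unique:
  assumes "has_val z p" "has_val z q"
  shows "p = q"
proof -
  have z: "z \<noteq> 0" using assms by (auto simp: has_val_def)
  have 1: "has_val 1 (q - p)" "has_val 1 (p - q)"
    using has_val_mult[OF assms(2) has_val_inverse[OF assms(1)]]
      has_val_mult[OF assms(1) has_val_inverse[OF assms(2)]] z by simp_all
  have "1 \<in> R" by (rule R_intros)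
  then show ?thesis using has_val_R[OF 1(1)] has_val_R[OF 1(2)] by simp
qed

text \<open>The ultrametric inequality, from \<open>1 + w / z \<in> R\<close>. A value of
  \<open>z + w\<close> is assumed because existence is established only for special elements, such
  as those of degree at most 3.\<close>

lemma has_val_add:
  assumes z: "has_val z p" and w: "has_val w q" and r: "has_val (z + w) r" and pq: "p \<le> q"
  shows "p \<le> r"
proof -
  have z0: "z \<noteq> 0" using z by (auto simp: has_val_def)
  have "has_val (w * (1 / z)) (q + - p)" by (intro has_val_mult has_val_inverse z w)
  then have "w / z \<in> R" using has_val_nonneg[of "w / z" "q - p"] pq by simp
  then have "1 + w / z \<in> R" by (intro R_intros)
  moreover have "(z + w) * (1 / z) = 1 + w / z" using z0 by (simp add: field_simps)
  moreover have "has_val ((z + w) * (1 / z)) (r + - p)" by (intro has_val_mult has_val_inverse z r)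
  ultimately show ?thesis using has_val_R by fastforce
qed

lemma has_val_3: "has_val 3 1"
  using has_valI[of 3 1 1] unit_intros by (simp add: power_int_minus)

lemma has_val_unit: "unit z \<Longrightarrow> has_val z 0"
  using has_valI[of z 1 0] by (simp add: unit_def)

lemma rational_unit_part:
  assumes q: "q \<in> \<rat>" "q \<noteq> (0 :: complex)"
  shows "\<exists>l. unit (q * 3 powi (- l))"
proof -
  have int: "\<exists>l. unit (of_int n * 3 powi (- l))" if n0: "n \<noteq> 0" for n :: int
  proof -
    obtain m where m: "n = 3 ^ multiplicity 3 n * m" "\<not> 3 dvd m"
      by (rule multiplicity_decompose'[of n "3 :: int"]) (use n0 in auto)
    then have "of_int n = 3 ^ multiplicity 3 n * (of_int m :: complex)"
      by (metis of_int_mult of_int_numeral of_int_power)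
    then have "of_int n * 3 powi (- int (multiplicity 3 n)) = (of_int m :: complex)"
      by (simp add: power_int_minus)
    then show ?thesis using unit_of_int[OF m(2)] by metis
  qed
  obtain a b :: int where ab: "b \<noteq> 0" "q = of_int a / of_int b"
    using q(1) by (metis Rats_cases' less_irrefl)
  then have "a \<noteq> 0" using q by auto
  then obtain l l' where l: "unit (of_int a * 3 powi (- l))" "unit (of_int b * 3 powi (- l'))"
    using int ab by blast
  then have "unit ((of_int a * 3 powi (- l)) * (1 / (of_int b * 3 powi (- l'))))"
    using unit_intros(2)[OF _ unit_intros(3)] by blast
  also have "(of_int a * 3 powi (- l)) * (1 / (of_int b * 3 powi (- l'))) = q * 3 powi (- (l - l'))"
    using ab by (simp add: power_int_minus power_int_diff field_simps)
  finally show ?thesis by blast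
qed

text \<open>A term of least valuation, phrased by divisibility since the terms are not yet known to
  have values.\<close>

lemma exists_dominating:
  assumes "finite A" "A \<noteq> {}" "\<And>a. a \<in> A \<Longrightarrow> f a \<noteq> (0 :: complex)"
  shows "\<exists>b\<in>A. \<forall>a\<in>A. f a / f b \<in> R"
  using assms
proof (induction A rule: finite_ne_induct)
  case (singleton x)
  then show ?case using R_intros(1) by simp
next
  case (insert x A)
  then obtain b where b: "b \<in> A" "\<forall>a\<in>A. f a / f b \<in> R" by auto
  have nz: "f x \<noteq> 0" "f b \<noteq> 0" using insert b by auto
  show ?case
  proof (cases "f x / f b \<in> R")
    case True
    then show ?thesis using b by auto
  next
    case False
    then have bx: "f b / f x \<in> R" using R_or_inverse[of "f x / f b"] nz by simp
    have "f a / f x \<in> R" if "a \<in> A" for a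
      using R_intros(3)[of "f a / f b" "f b / f x"] b bx that nz by simp
    then show ?thesis using nz R_intros(1) by (intro bexI[of _ x]) auto
  qed
qed

text \<open>In an algebraic relation of degree at most 3, two terms must have the same minimal valuation.\<close>

lemma has_val_cubic:
  assumes z: "z \<noteq> 0" and a: "\<And>i. a i \<in> \<rat>" and nz: "\<exists>i\<le>3. a i \<noteq> 0" and sum: "(\<Sum>i\<le>(3::nat). a i * z ^ i) = 0"
  shows "\<exists>k\<in>{1, 2, 3 :: nat}. \<exists>l. has_val z (of_int l / of_nat k)"
proof -
  define A where "A = {i. i \<le> (3::nat) \<and> a i \<noteq> 0}"
  define t where "t i = a i * z ^ i" for i
  have A: "finite A" "A \<noteq> {}" "\<And>i. i \<in> A \<Longrightarrow> t i \<noteq> 0" using nz z by (auto simp: A_def t_def)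
  obtain b where b: "b \<in> A" "\<forall>i\<in>A. t i / t b \<in> R" using exists_dominating[OF A(1,2), of t] A(3) by metis
  have "(\<Sum>i\<in>A. t i) = (\<Sum>i\<le>3. t i)"
    by (rule sum.mono_neutral_left) (auto simp: A_def t_def)
  then have s0: "(\<Sum>i\<in>A. t i / t b) = 0" using sum by (simp add: t_def sum_divide_distrib[symmetric])
  \<comment> \<open>After division by the dominant term the others sum to -1, so they cannot all be
    nonunits.\<close>
  have "\<exists>j\<in>A - {b}. unit (t j / t b)"
  proof (rule ccontr)
    assume "\<not> ?thesis"
    then have "\<not> unit (\<Sum>j\<in>A - {b}. t j / t b)" using b nonunit_sum[of "A - {b}" "\<lambda>j. t j / t b"] by blast
    moreover have "(\<Sum>j\<in>A - {b}. t j / t b) = - 1"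
      using s0 A b sum.remove[of A b "\<lambda>i. t i / t b"] by (simp add: add_eq_0_iff)
    ultimately show False using unit_intros(1) unit_intros(4)[of 1] by simp
  qed
  then obtain j where j: "j \<in> A" "j \<noteq> b" "unit (t j / t b)" by auto
  have main: ?thesis if ij: "i \<in> A" "j \<in> A" "i < j" "unit (t j / t i)" for i j
  proof -
    have "a j / a i \<in> \<rat>" "a j / a i \<noteq> 0" using a ij by (auto simp: A_def)
    then obtain l where l: "unit (a j / a i * 3 powi (- l))" using rational_unit_part by blast
    \<comment> \<open>The quotient contains \<open>z\<close> to a power of at most 3, and its
      rational factor is a unit times an integral power of 3: hence the denominators 1, 2,
      3.\<close>
    have "t j / t i = a j / a i * z ^ (j - i)"
      using ij z by (simp add: t_def power_diff)
    then have "unit (a j / a i * z ^ (j - i))" using ij by simp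
    then have "unit ((a j / a i * z ^ (j - i)) * (1 / (a j / a i * 3 powi (- l))))"
      using l unit_intros(2)[OF _ unit_intros(3)] by blast
    also have "(a j / a i * z ^ (j - i)) * (1 / (a j / a i * 3 powi (- l))) = z ^ (j - i) * 3 powi (- (- l))"
      using ij by (simp add: A_def power_int_minus field_simps)
    finally have "has_val z (of_int (- l) / of_nat (j - i))"
      using ij z by (intro has_valI) auto
    moreover have "j - i \<in> {1, 2, 3}" using ij by (auto simp: A_def)
    ultimately show ?thesis by blast
  qed
  show ?thesis
  proof (cases "b < j")
    case True
    then show ?thesis using main[of b j] b j by simp
  next
    case False
    have "unit (1 / (t j / t b))" using j(3) by (rule unit_intros)
    then show ?thesis using main[of j b] b j False by simp
  qed
qed

end

text \<open>
  On the function \<open>x\<^sup>3 / c\<close>, this is the isogeny \<open>\<surd>-3\<close> from \<open>y\<^sup>2 = x\<^sup>3 + c\<close> to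
  \<open>y\<^sup>2 = x\<^sup>3 - 27 c\<close>; its square is tripling.
\<close>

definition sqrt_neg3_map :: "complex \<Rightarrow> complex" where
  "sqrt_neg3_map a = - ((a + 4) ^ 3) / (27 * a ^ 2)"

text \<open>
  Every element of \<open>K\<close> having degree at most 3 over \<open>\<rat>\<close>, its value is a half or a third of
  an integer: this is \<open>v_denom\<close>.
\<close>

locale valued_subfield = complex_subfield +
  fixes v :: "complex \<Rightarrow> rat"
  assumes v_mult: "\<And>z w. z \<in> K \<Longrightarrow> w \<in> K \<Longrightarrow> z \<noteq> 0 \<Longrightarrow> w \<noteq> 0 \<Longrightarrow> v (z * w) = v z + v w"
    and v_add_le: "\<And>z w. z \<in> K \<Longrightarrow> w \<in> K \<Longrightarrow> z \<noteq> 0 \<Longrightarrow> w \<noteq> 0 \<Longrightarrow> z + w \<noteq> 0 \<Longrightarrow> v z \<le> v w \<Longrightarrow> v z \<le> v (z + w)"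
    and v_3: "v 3 = 1"
    and v_unit: "\<And>n. \<not> 3 dvd n \<Longrightarrow> v (of_int n) = 0"
    and v_rat: "\<And>q. q \<in> \<rat> \<Longrightarrow> q \<noteq> 0 \<Longrightarrow> v q \<in> \<int>"
    and v_denom: "\<And>z. z \<in> K \<Longrightarrow> z \<noteq> 0 \<Longrightarrow> v z \<in> \<int> \<or> 2 * v z \<in> \<int> \<or> 3 * v z \<in> \<int>"
begin

text \<open>\<open>vge q z\<close> is \<open>v z \<ge> q\<close> with the convention \<open>v 0 = \<infinity>\<close>.\<close>

definition vge :: "rat \<Rightarrow> complex \<Rightarrow> bool" where
  "vge q z \<longleftrightarrow> z = 0 \<or> q \<le> v z"

lemma v_power: "z \<in> K \<Longrightarrow> z \<noteq> 0 \<Longrightarrow> v (z ^ n) = of_nat n * v z"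
proof (induction n)
  case 0
  then show ?case using v_unit[of 1] by simp
next
  case (Suc n)
  then show ?case by (simp add: v_mult power_mem algebra_simps)
qed

lemma v_minus: "z \<in> K \<Longrightarrow> v (- z) = v z"
  using v_mult[of "- 1" z] v_unit[of "- 1"] by (cases "z = 0") (auto intro: mem_intros)

lemma v_divide: "z \<in> K \<Longrightarrow> w \<in> K \<Longrightarrow> z \<noteq> 0 \<Longrightarrow> w \<noteq> 0 \<Longrightarrow> v (z / w) = v z - v w"
  using v_mult[of "z / w" w] by (simp add: mem_intros)

lemma v_int: "\<not> 3 dvd n \<Longrightarrow> v (of_int (3 ^ k * n)) = of_nat k"
  using v_mult[of "3 ^ k" "of_int n"] v_power[of 3 k] v_unit[of n] v_3 by (auto simp: mem_intros)

lemma vge_mult: "z \<in> K \<Longrightarrow> w \<in> K \<Longrightarrow> vge p z \<Longrightarrow> vge q w \<Longrightarrow> vge (p + q) (z * w)"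
  by (cases "z = 0 \<or> w = 0") (auto simp: vge_def v_mult)

lemma vge_power: "z \<in> K \<Longrightarrow> n > 0 \<Longrightarrow> vge p z \<Longrightarrow> vge (of_nat n * p) (z ^ n)"
  by (cases "z = 0") (auto simp: vge_def v_power intro: mult_left_mono)

lemma vge_add:
  assumes "z \<in> K" "w \<in> K" "vge q z" "vge q w"
  shows "vge q (z + w)"
proof (cases "z = 0 \<or> w = 0 \<or> z + w = 0")
  case False
  then show ?thesis
    using assms v_add_le[of z w] v_add_le[of w z] by (cases "v z \<le> v w") (auto simp: vge_def add.commute)
qed (use assms in \<open>auto simp: vge_def\<close>)

lemma vge_minus: "z \<in> K \<Longrightarrow> vge q z \<Longrightarrow> vge q (- z)"
  by (auto simp: vge_def v_minus)

lemma vge_diff: "z \<in> K \<Longrightarrow> w \<in> K \<Longrightarrow> vge q z \<Longrightarrow> vge q w \<Longrightarrow> vge q (z - w)"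
  using vge_add[of z "- w" q] vge_minus[of w q] by (simp add: mem_intros)

lemma vge_mono: "vge q z \<Longrightarrow> p \<le> q \<Longrightarrow> vge p z"
  by (auto simp: vge_def)

lemma v_dominant:
  assumes z: "z \<in> K" "z \<noteq> 0" and w: "w \<in> K" and q: "vge q w" "v z < q"
  shows "z + w \<noteq> 0" "v (z + w) = v z"
proof -
  show nz: "z + w \<noteq> 0"
  proof
    assume "z + w = 0"
    then have "w = - z" by (simp add: add_eq_0_iff)
    then show False using z q by (auto simp: vge_def v_minus)
  qed
  have "vge (v z) (z + w)" using z w q by (intro vge_add) (auto simp: vge_def)
  then have 1: "v z \<le> v (z + w)" using nz by (simp add: vge_def)
  show "v (z + w) = v z"
  proof (rule ccontr)
    assume "v (z + w) \<noteq> v z"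
    then have lt: "v z < v (z + w)" using 1 by simp
    have "vge (min q (v (z + w))) (z + w + - w)"
      using z w q nz by (intro vge_add[of "z + w"]) (auto simp: vge_def v_minus mem_intros)
    then show False using z lt q by (auto simp: vge_def)
  qed
qed

lemma vge_int_mult:
  assumes "\<not> 3 dvd n" "z \<in> K" "vge p z"
  shows "vge (of_nat k + p) (of_int (3 ^ k * n) * z)"
proof -
  have "vge (of_nat k) (of_int (3 ^ k * n))" unfolding vge_def v_int[OF assms(1)] by simp
  then show ?thesis by (rule vge_mult[OF of_int_mem assms(2) _ assms(3)])
qed

text \<open>The constants of \<open>sqrt_neg3_map\<close> and of its expansion in
  \<open>f_param\<close>: 192 is 3 * 64 and 576 is 9 * 64.\<close>

lemma v_numerals:
  "v 4 = 0" "v 8 = 0" "v 27 = 3" "v 192 = 1" "v 576 = 2"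
  using v_int[of 4 0] v_int[of 8 0] v_int[of 1 3] v_int[of 64 1] v_int[of 64 2] by simp_all

lemma vge_numeral_mult:
  assumes "z \<in> K" "vge p z"
  shows "vge (1 + p) (84 * z)" "vge (1 + p) (24 * z)" "vge (2 + p) (144 * z)" "vge (3 + p) (432 * z)"
    "vge (1 + p) (3 * z)"
  using vge_int_mult[of 28 z p 1] vge_int_mult[of 8 z p 1] vge_int_mult[of 16 z p 2]
    vge_int_mult[of 16 z p 3] vge_int_mult[of 1 z p 1] assms by simp_all

lemma vge_192_aux:
  assumes "z \<in> K" "vge 0 z"
  shows "vge 1 (192 + (144 * z + 24 * z ^ 2))"
proof -
  have "vge 1 192" by (simp add: vge_def v_numerals)
  moreover have "vge 1 (144 * z)" by (rule vge_mono[OF vge_numeral_mult(3)[OF assms]]) simp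
  moreover have "vge 1 (24 * z ^ 2)"
    using vge_numeral_mult(2)[OF power_mem[OF assms(1)], of 0 2] vge_power[OF assms(1) _ assms(2), of 2] by simp
  ultimately show ?thesis using assms(1) by (intro vge_add mem_intros)
qed

section \<open>Valuations along orbits of \<open>f\<close>\<close>

abbreviation f :: "complex \<Rightarrow> complex" where
  "f \<equiv> sqrt_neg3_map"

lemma f_mem: "a \<in> K \<Longrightarrow> f a \<in> K"
  by (auto simp: sqrt_neg3_map_def intro!: mem_intros)

lemma v_f:
  assumes "a \<in> K" "a \<noteq> 0" "a + 4 \<noteq> 0"
  shows "f a \<noteq> 0" "v (f a) = 3 * v (a + 4) - 3 - 2 * v a"
proof -
  show "f a \<noteq> 0" using assms by (simp add: sqrt_neg3_map_def)
  have "v (f a) = v ((a + 4) ^ 3) - v (27 * a ^ 2)"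
    unfolding sqrt_neg3_map_def using assms by (simp add: v_divide v_minus mem_intros)
  then show "v (f a) = 3 * v (a + 4) - 3 - 2 * v a"
    using assms by (simp add: v_power v_mult mem_intros v_numerals)
qed

text \<open>Infinity attracts: a negative value drops by 3 at each step, and by
  \<open>v_f_pos\<close> a positive value turns negative at once. Only points of value 0 can be
  periodic.\<close>

lemma v_f_neg:
  assumes "a \<in> K" "a \<noteq> 0" "v a < 0"
  shows "f a \<noteq> 0" "v (f a) = v a - 3"
proof -
  have "a + 4 \<noteq> 0 \<and> v (a + 4) = v a"
    using v_dominant[of a 4 0] assms v_numerals by (auto simp: vge_def mem_intros)
  then show "f a \<noteq> 0" "v (f a) = v a - 3" using v_f[of a] assms by auto
qed

lemma v_f_pos:
  assumes "a \<in> K" "a \<noteq> 0" "v a > 0"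
  shows "f a \<noteq> 0" "v (f a) < 0"
proof -
  have "4 + a \<noteq> 0 \<and> v (4 + a) = v 4"
    using v_dominant[of 4 a "v a"] assms v_numerals by (auto simp: vge_def mem_intros)
  then show "f a \<noteq> 0" "v (f a) < 0" using v_f[of a] assms by (auto simp: add.commute v_numerals)
qed

lemma param_eq: "a = 8 + 3 * ((a - 8) / 3)" for a :: complex
  by (simp add: field_simps)

text \<open>In the coordinate \<open>s\<close>, centred at 8, one has
  \<open>a + 4 = 3 * (4 + s)\<close>; the cube cancels the 27 and
  \<open>f a = - ((4 + s) ^ 3) / a ^ 2\<close>. The two identities expand \<open>f a - 8\<close> and
  \<open>f a + 4\<close>.\<close>

lemma f_param:
  assumes "a \<noteq> 0" "a = 8 + 3 * s" "f a = 8 + 3 * s'"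
  shows "3 * a ^ 2 * s' = - (s ^ 3 + 84 * s ^ 2 + 432 * s + 576)"
    and "3 * a ^ 2 * (4 + s') = 192 + (144 * s + 24 * s ^ 2 - s ^ 3)"
proof -
  have "27 * a ^ 2 * (8 + 3 * s') = - ((a + 4) ^ 3)"
    using assms(1) unfolding assms(3)[symmetric] sqrt_neg3_map_def by simp
  then have "27 * (3 * a ^ 2 * s') = 27 * (- (s ^ 3 + 84 * s ^ 2 + 432 * s + 576))"
    using assms(2) by Groebner_Basis.algebra
  then show 1: "3 * a ^ 2 * s' = - (s ^ 3 + 84 * s ^ 2 + 432 * s + 576)"
    by (subst (asm) mult_left_cancel) simp_all
  show "3 * a ^ 2 * (4 + s') = 192 + (144 * s + 24 * s ^ 2 - s ^ 3)"
    using 1 assms(2) by Groebner_Basis.algebra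
qed

text \<open>With both values 0, \<open>v_f\<close> forces \<open>v (a + 4) = 1\<close>, and
  \<open>a + 4 = 3 * (4 + s)\<close>.\<close>

lemma unit_orbit_step:
  assumes a: "a \<in> K" "a \<noteq> 0" "v a = 0" and fX: "f a \<noteq> 0" "v (f a) = 0"
  defines "s \<equiv> (a - 8) / 3"
  shows "s \<in> K" "a = 8 + 3 * s" "vge 0 s" "v (4 + s) = 0" "4 + s \<noteq> 0"
proof -
  show sK: "s \<in> K" using a by (auto simp: s_def mem_intros)
  show Xs: "a = 8 + 3 * s" unfolding s_def by (rule param_eq)
  have X4: "a + 4 \<noteq> 0" using fX by (auto simp: sqrt_neg3_map_def)
  then have "v (a + 4) = 1" using v_f(2)[of a] a fX by simp
  moreover have e: "a + 4 = 3 * (4 + s)" by (simp add: Xs)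
  moreover show "4 + s \<noteq> 0" using X4 e by (metis mult_zero_right)
  ultimately show v4: "v (4 + s) = 0"
    using v_mult[of 3 "4 + s"] v_3 sK by (simp add: mem_intros)
  have "vge 0 ((4 + s) - 4)" using v4 v_numerals sK by (intro vge_diff) (auto simp: vge_def mem_intros)
  then show "vge 0 s" by simp
qed

lemma Ints_pos_cases:
  fixes r :: rat
  assumes "r \<in> \<int>" "r > 0"
  shows "r = 1 \<or> r \<ge> 2"
proof -
  obtain n where n: "r = of_int n" using assms(1) by (auto elim: Ints_cases)
  then have "n > 0" using assms(2) by simp
  then have "n = 1 \<or> n \<ge> 2" by linarith
  then show ?thesis using n by auto
qed

text \<open>The left side of \<open>f_param(2)\<close> has value 1; were \<open>v s = 0\<close>, the
  term \<open>- (s ^ 3)\<close> would dominate the right side and give it value 0. The bound 1/3 is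
  the least positive value that \<open>v_denom\<close> allows.\<close>

lemma unit_orbit_pos:
  assumes a: "a \<in> K" "a \<noteq> 0" "v a = 0" and fX: "f a \<noteq> 0" "v (f a) = 0" and ffX: "v (4 + (f a - 8) / 3) = 0"
    "4 + (f a - 8) / 3 \<noteq> 0"
  defines "s \<equiv> (a - 8) / 3"
  shows "s \<noteq> 0 \<Longrightarrow> v s \<ge> 1 / 3"
proof -
  assume s0: "s \<noteq> 0"
  note s = unit_orbit_step[OF a fX, folded s_def]
  define s' where "s' = (f a - 8) / 3"
  have s'K: "s' \<in> K" using f_mem[OF a(1)] by (auto simp: s'_def mem_intros)
  have e: "3 * a ^ 2 * (4 + s') = 192 + (144 * s + 24 * s ^ 2 - s ^ 3)"
    by (rule f_param(2)[OF a(2) s(2)]) (simp only: s'_def param_eq[symmetric])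
  have "v (3 * a ^ 2 * (4 + s')) = 1"
    using a s'K ffX v_3 by (simp add: v_mult v_power mem_intros s'_def)
  then have ve: "v (192 + (144 * s + 24 * s ^ 2 - s ^ 3)) = 1" using e by simp
  have "v s \<noteq> 0"
  proof
    assume vs: "v s = 0"
    have "vge 1 (192 + (144 * s + 24 * s ^ 2))" using s(1,3) by (rule vge_192_aux)
    then have "v (- (s ^ 3) + (192 + (144 * s + 24 * s ^ 2))) = v (- (s ^ 3))"
      using s s0 vs by (intro v_dominant(2)) (auto simp: v_minus v_power mem_intros)
    then show False using ve s(1) s0 vs by (simp add: v_minus v_power mem_intros algebra_simps)
  qed
  then have "v s > 0" using s(3) s0 by (simp add: vge_def)
  then show "v s \<ge> 1 / 3"
    using v_denom[OF s(1) s0] Ints_pos_cases[of "v s"] Ints_pos_cases[of "2 * v s"] Ints_pos_cases[of "3 * v s"]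
    by auto
qed

text \<open>\<open>v_denom\<close> in divisibility form, for refuting values with denominator 4 or
  9.\<close>

lemma value_not:
  assumes z: "z \<in> K" "z \<noteq> 0" and v: "of_int b * v z = of_int a" and ab: "\<not> b dvd 2 * a" "\<not> b dvd 3 * a"
  shows False
proof -
  have *: "b dvd 2 * a" if "2 * v z = of_int k" for k
  proof -
    have "(of_int (b * k) :: rat) = of_int (2 * a)" using that[symmetric] v by (simp add: mult.left_commute)
    then show ?thesis unfolding of_int_eq_iff by (metis dvd_triv_left)
  qed
  have "b dvd 3 * a" if "3 * v z = of_int k" for k
  proof -
    have "(of_int (b * k) :: rat) = of_int (3 * a)" using that[symmetric] v by (simp add: mult.left_commute)
    then show ?thesis unfolding of_int_eq_iff by (metis dvd_triv_left)
  qed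
  moreover have "2 * v z \<in> \<int> \<or> 3 * v z \<in> \<int>" using v_denom[OF z] by auto
  ultimately show False using * ab by (metis Ints_cases)
qed

lemma quarter_not_value:
  assumes y: "y \<in> K" "y \<noteq> 0" and n: "n \<in> \<int>" "2 * v y = n + 3 / 2"
  shows False
proof -
  obtain m where m: "n = of_int m" using n(1) by (auto elim: Ints_cases)
  have "\<not> 4 dvd 2 * (2 * m + 3)" "\<not> 4 dvd 3 * (2 * m + 3)" by presburger+
  moreover have "of_int 4 * v y = of_int (2 * m + 3)" using n m by simp
  ultimately show False using value_not[OF y] by blast
qed

text \<open>All that is remembered of the ordinate: \<open>y ^ 2 = c * (X + 1)\<close>. The factor
  \<open>d\<close> must vary because each application of \<open>f\<close> multiplies it by -27, the
  twist of the isogenous curve.\<close>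

definition twist_square :: "complex \<Rightarrow> bool" where
  "twist_square a \<longleftrightarrow> (\<exists>y\<in>K. \<exists>d\<in>\<rat>. d \<noteq> 0 \<and> y ^ 2 = d * (a + 1))"

lemma f_plus_one: "a \<noteq> 0 \<Longrightarrow> f a + 1 = - ((a - 8) ^ 2 * (a + 1)) / (27 * a ^ 2)"
  by (simp add: sqrt_neg3_map_def field_simps) Groebner_Basis.algebra

lemma twist_square_f:
  assumes "a \<in> K" "a \<noteq> 0" "twist_square a"
  shows "twist_square (f a)"
proof -
  obtain y d where y: "y \<in> K" "d \<in> \<rat>" "d \<noteq> 0" "y ^ 2 = d * (a + 1)"
    using assms by (auto simp: twist_square_def)
  have "(y * (a - 8) / a) ^ 2 = (- 27 * d) * (f a + 1)"
    using assms(2) by (simp add: f_plus_one power_mult_distrib power_divide y(4))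
  moreover have "y * (a - 8) / a \<in> K" using y assms by (intro mem_intros)
  moreover have "- 27 * d \<in> \<rat>" "- 27 * d \<noteq> 0" using y by auto
  ultimately show ?thesis unfolding twist_square_def by blast
qed

text \<open>From 1/3 up to 2/3, the only admissible smaller values are 1/3 and 1/2; each is refuted
  separately.\<close>

lemma unit_orbit_two_thirds:
  assumes a: "a \<in> K" "a \<noteq> 0" "v a = 0" and fX: "f a \<noteq> 0" "v (f a) = 0" and ffX: "f (f a) \<noteq> 0" "v (f (f a)) = 0"
    and fffX: "f (f (f a)) \<noteq> 0" "v (f (f (f a))) = 0" and y: "twist_square a"
  defines "s \<equiv> (a - 8) / 3"
  shows "vge (2 / 3) s"
proof (cases "s = 0")
  case False
  note s = unit_orbit_step[OF a fX, folded s_def]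
  note K1 = f_mem[OF a(1)] note K2 = f_mem[OF K1]
  define s' where "s' = (f a - 8) / 3"
  have s'K: "s' \<in> K" using K1 by (auto simp: s'_def mem_intros)
  have vs: "v s \<ge> 1 / 3" unfolding s_def
    by (rule unit_orbit_pos[OF a fX]) (use unit_orbit_step[OF K1 fX ffX] False s_def in auto)
  have vs': "s' \<noteq> 0 \<Longrightarrow> v s' \<ge> 1 / 3" unfolding s'_def
    by (rule unit_orbit_pos[OF K1 fX ffX]) (use unit_orbit_step[OF K2 ffX fffX] in auto)
  have "v s \<noteq> 1 / 3"
  proof
    assume v: "v s = 1 / 3"
    have e: "3 * a ^ 2 * s' = - (s ^ 3 + 84 * s ^ 2 + 432 * s + 576)"
      by (rule f_param(1)[OF a(2) s(2)]) (simp only: s'_def param_eq[symmetric])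
    \<comment> \<open>The term \<open>s ^ 3\<close> has value 1 and dominates, so the next
      coordinate \<open>s'\<close> has value 0, against \<open>vs'\<close>.\<close>
    have "vge (5 / 3) (84 * s ^ 2 + (432 * s + 576))"
      using vge_numeral_mult(1)[OF power_mem[OF s(1), of 2], of "2 / 3"] vge_numeral_mult(4)[OF s(1), of "1 / 3"] v s(1) False v_numerals
      by (intro vge_add) (auto intro!: mem_intros simp: vge_def v_power)
    then have "v (s ^ 3 + (84 * s ^ 2 + (432 * s + 576))) = v (s ^ 3) \<and> s ^ 3 + (84 * s ^ 2 + (432 * s + 576)) \<noteq> 0"
      using s False v v_dominant[of "s ^ 3" "84 * s ^ 2 + (432 * s + 576)" "5 / 3"] by (auto simp: v_power mem_intros)
    moreover have "3 * a ^ 2 * s' = - (s ^ 3 + (84 * s ^ 2 + (432 * s + 576)))" using e by (simp only: add.assoc)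
    moreover have "s ^ 3 + (84 * s ^ 2 + (432 * s + 576)) \<in> K" using s(1) by (intro mem_intros)
    ultimately have 1: "v (3 * a ^ 2 * s') = 1" "3 * a ^ 2 * s' \<noteq> 0"
      using s(1) v False by (simp_all only: v_minus neg_equal_0_iff_equal) (auto simp: v_power)
    then have "s' \<noteq> 0" by auto
    then have "v s' = 0" using 1 a s'K v_3 by (simp add: v_mult v_power mem_intros)
    then show False using vs' \<open>s' \<noteq> 0\<close> by simp
  qed
  moreover have "v s \<noteq> 1 / 2"
  proof
    assume v: "v s = 1 / 2"
    obtain y d where y: "y \<in> K" "d \<in> \<rat>" "d \<noteq> 0" "y ^ 2 = d * (a + 1)"
      using y by (auto simp: twist_square_def)
    \<comment> \<open>Now \<open>a + 1 = 3 * (s + 3)\<close> has value 3/2, and a square root of a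
      rational multiple of it has a value with denominator 4.\<close>
    have s3: "v (s + 3) = 1 / 2" "s + 3 \<noteq> 0"
      using v_dominant[of s 3 1] s v False v_3 by (auto simp: vge_def mem_intros)
    have yy: "y ^ 2 = d * (3 * (s + 3))" using y(4) s(2) by simp
    have s3K: "s + 3 \<in> K" "3 * (s + 3) \<in> K" using s(1) by (auto intro!: mem_intros)
    have nz: "3 * (s + 3) \<noteq> 0" using s3(2) by (simp only: mult_eq_0_iff) simp
    have "v (d * (3 * (s + 3))) = v d + (v 3 + v (s + 3))"
      using v_mult[OF Rats_mem[OF y(2)] s3K(2) y(3) nz] v_mult[OF numeral_mem s3K(1) _ s3(2), of "num.Bit1 num.One"]
      by simp
    then have vy: "v (y ^ 2) = v d + 3 / 2" "y \<noteq> 0"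
      using yy s3(1) v_3 nz y(3) by auto
    then have "2 * v y = v d + 3 / 2" using v_power[OF y(1) vy(2), of 2] by simp
    then show False using quarter_not_value y vy v_rat by blast
  qed
  moreover have "2 * v s \<in> \<int> \<Longrightarrow> 2 * v s = 1 \<or> 2 * v s \<ge> 2" "3 * v s \<in> \<int> \<Longrightarrow> 3 * v s = 1 \<or> 3 * v s \<ge> 2"
    "v s \<in> \<int> \<Longrightarrow> v s \<ge> 1"
    using Ints_pos_cases[of "2 * v s"] Ints_pos_cases[of "3 * v s"] Ints_pos_cases[of "v s"] vs by auto
  ultimately have "v s \<ge> 2 / 3" using v_denom[OF s(1) False] by (elim disjE; force)
  then show ?thesis by (simp add: vge_def)
qed (simp add: vge_def)

text \<open>Every term on the right of \<open>f_param(1)\<close> has value at least 2, and the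
  factor 3 on the left takes away one.\<close>

lemma unit_orbit_one:
  assumes a: "a \<in> K" "a \<noteq> 0" "v a = 0" and fX: "f a \<noteq> 0" "v (f a) = 0"
    and s23: "vge (2 / 3) ((a - 8) / 3)"
  shows "vge 1 ((f a - 8) / 3)"
proof (cases "(f a - 8) / 3 = 0")
  case False
  define s s' where "s = (a - 8) / 3" and "s' = (f a - 8) / 3"
  note s = unit_orbit_step[OF a fX, folded s_def]
  have s'K: "s' \<in> K" using f_mem[OF a(1)] by (auto simp: s'_def mem_intros)
  have s': "s' \<noteq> 0" using False by (simp add: s'_def)
  have e: "3 * a ^ 2 * s' = - (s ^ 3 + 84 * s ^ 2 + 432 * s + 576)"
    by (rule f_param(1)[OF a(2) s(2)]) (simp only: s'_def param_eq[symmetric])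
  have v: "vge (2 / 3) s" using s23 by (simp add: s_def)
  have "vge 2 (s ^ 3)" "vge 2 (84 * s ^ 2)" "vge 2 (432 * s)"
    using vge_power[OF s(1) _ v, of 3] vge_numeral_mult(1)[OF power_mem[OF s(1), of 2], of "4 / 3"] vge_power[OF s(1) _ v, of 2]
      vge_numeral_mult(4)[OF s(1) v] s(1)
    by (auto simp: mem_intros elim!: vge_mono)
  then have "vge 2 (- (s ^ 3 + 84 * s ^ 2 + 432 * s + 576))"
    using s(1) v_numerals by (intro vge_minus vge_add mem_intros) (auto simp: vge_def)
  then have "vge 2 (3 * a ^ 2 * s')" using e by simp
  then have "vge 1 s'"
    using a s' s'K v_3 by (simp add: vge_def v_mult v_power mem_intros)
  then show ?thesis by (simp only: s'_def)
qed (simp add: vge_def)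

lemma periodic_point:
  assumes a: "a \<in> K" and m: "m > 0" "(f ^^ m) a = a" and nz: "\<And>i. (f ^^ i) a \<noteq> 0" and y: "twist_square a"
  shows "a = - 1"
proof (rule ccontr)
  assume ne: "a \<noteq> - 1"
  define x where "x i = (f ^^ i) a" for i
  have xS: "x (Suc i) = f (x i)" for i by (simp add: x_def)
  have xK: "x i \<in> K" for i by (induction i) (use a f_mem in \<open>auto simp: x_def\<close>)
  have x0: "x i \<noteq> 0" for i using nz by (simp add: x_def)
  have per: "x (i + m) = x i" for i
    using m(2) by (simp add: x_def funpow_add)
  have nneg: "\<not> v (x i) < 0" for i
  proof
    assume neg: "v (x i) < 0"
    have "v (x (i + k)) = v (x i) - 3 * of_nat k" for k
    proof (induction k)
      case (Suc k)
      then have "v (x (i + k)) < 0" using neg by simp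
      then show ?case using v_f_neg(2)[OF xK x0] Suc xS[of "i + k"] by simp
    qed simp
    from this[of m] show False using per m by simp
  qed
  have v0: "v (x i) = 0" for i
    using nneg[of i] nneg[of "Suc i"] v_f_pos(2)[OF xK x0, of i] xS[of i] by fastforce
  have tw: "twist_square (x i)" for i
    by (induction i) (use y twist_square_f[OF xK x0] xS in \<open>auto simp: x_def\<close>)
  have fnz: "f (x i) \<noteq> 0" "f (f (x i)) \<noteq> 0" "f (f (f (x i))) \<noteq> 0"
      "v (f (x i)) = 0" "v (f (f (x i))) = 0" "v (f (f (f (x i)))) = 0" for i
    using x0[of "Suc i"] x0[of "Suc (Suc i)"] x0[of "Suc (Suc (Suc i))"]
      v0[of "Suc i"] v0[of "Suc (Suc i)"] v0[of "Suc (Suc (Suc i))"] by (simp_all only: xS simp_thms)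
  have "vge (2 / 3) ((x i - 8) / 3)" for i
    by (rule unit_orbit_two_thirds[OF xK x0 v0 fnz(1,4,2,5,3,6) tw])
  then have S: "vge 1 ((x (Suc i) - 8) / 3)" for i
    unfolding xS by (rule unit_orbit_one[OF xK x0 v0 fnz(1,4)])
  \<comment> \<open>Every point of a cycle is a successor.\<close>
  have s1: "vge 1 ((x i - 8) / 3)" for i
    using S[of "i + m - 1"] per[of i] m(1) by simp
  have s2: "vge 2 (x i - 8)" for i
    
  proof -
    have "vge (1 + 1) (3 * ((x i - 8) / 3))" by (intro vge_numeral_mult(5) s1 mem_intros xK)
    moreover have "3 * ((x i - 8) / 3) = x i - 8" by (simp add: field_simps)
    ultimately show ?thesis by (simp only: one_add_one)
  qed
  have fix1: "x (i + j) = - 1" if "x i = - 1" for i j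
    by (induction j) (use that in \<open>auto simp: xS sqrt_neg3_map_def\<close>)
  \<comment> \<open>As -1 is fixed, an orbit reaching it at \<open>i\<close> is still there at the
    multiple \<open>i * m\<close> of the period, where it equals \<open>a\<close>.\<close>
  have ne1: "x i \<noteq> - 1" for i
  proof
    assume "x i = - 1"
    then have "x (i + (i * m - i)) = - 1" by (rule fix1)
    moreover have "i + (i * m - i) = i * m" using m(1) by (cases m) auto
    moreover have "x (k * m) = a" for k
    proof (induction k)
      case (Suc k)
      have "x (Suc k * m) = x (k * m + m)" by (simp add: add.commute)
      then show ?case using per[of "k * m"] Suc by simp
    qed (simp add: x_def)
    ultimately show False using ne by simp
  qed
  \<comment> \<open>The gain is \<open>2 * 2 - 3\<close>; accumulated over one period it contradicts
    the return to the start.\<close>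
  have step: "v (x (Suc i) + 1) \<ge> v (x i + 1) + 1" for i
  proof -
    have nz1: "x i + 1 \<noteq> 0" "x (Suc i) + 1 \<noteq> 0" using ne1[of i] ne1[of "Suc i"] by (simp_all add: add_eq_0_iff2)
    have e: "x (Suc i) + 1 = - ((x i - 8) ^ 2 * (x i + 1)) / (27 * x i ^ 2)"
      unfolding xS by (rule f_plus_one[OF x0])
    then have n8: "x i - 8 \<noteq> 0" using nz1 by auto
    then have "v (x (Suc i) + 1) = 2 * v (x i - 8) + v (x i + 1) - 3"
      unfolding e using xK[of i] x0[of i] nz1 v0[of i] v_numerals
      by (simp add: v_divide v_minus v_mult v_power mem_intros)
    moreover have "v (x i - 8) \<ge> 2" using s2[of i] n8 by (simp add: vge_def)
    ultimately show ?thesis by simp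
  qed
  have "v (x i + 1) \<ge> v (x 0 + 1) + of_nat i" for i
  proof (induction i)
    case (Suc i)
    then show ?case using step[of i] by simp
  qed simp
  from this[of m] show False using per[of 0] m(1) by simp
qed

text \<open>For \<open>f b = - 4\<close> the left side of \<open>f_param(2)\<close> vanishes, so
  \<open>s\<close> is a root of a cubic that is Eisenstein at 3 and has value 1/3. One step further
  back, \<open>t ^ 3\<close> must have value 4/3, and 4/9 is not an admissible value of
  \<open>t\<close>.\<close>

lemma no_level_four:
  assumes a: "a \<in> K" and b: "f a = b" "f b = - 4"
  shows False
proof -
  have YK: "b \<in> K" using f_mem[OF a] b by simp
  have Y0: "b \<noteq> 0" using b by (auto simp: sqrt_neg3_map_def)
  have X0: "a \<noteq> 0" using b Y0 by (auto simp: sqrt_neg3_map_def)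
  have vf: "v (f b) = 0" "f b \<noteq> 0" using b v_numerals v_minus[of 4] by (auto simp: mem_intros)
  have vY: "v b = 0" using v_f_neg(2)[OF YK Y0] v_f_pos(2)[OF YK Y0] vf by fastforce
  have vX: "v a = 0" using v_f_neg(2)[OF a X0] v_f_pos(2)[OF a X0] vY b by fastforce
  have fX: "f a \<noteq> 0" "v (f a) = 0" using b Y0 vY by auto
  define s t where "s = (b - 8) / 3" and "t = (a - 8) / 3"
  note s = unit_orbit_step[OF YK Y0 vY vf(2,1), folded s_def]
  note t = unit_orbit_step[OF a X0 vX fX, folded t_def]
  have "3 * b ^ 2 * (4 + (- 4)) = 192 + (144 * s + 24 * s ^ 2 - s ^ 3)"
    by (rule f_param(2)) (use Y0 s b in auto)
  then have s3: "s ^ 3 = 192 + (144 * s + 24 * s ^ 2)" by (simp add: algebra_simps)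
  have s0: "s \<noteq> 0" using s3 by auto
  have vs0: "v s > 0"
  proof (rule ccontr)
    assume "\<not> v s > 0"
    then have v: "v s = 0" using s(3) s0 by (simp add: vge_def)
    have "vge 1 (192 + (144 * s + 24 * s ^ 2))" using s(1,3) by (rule vge_192_aux)
    then have "vge 1 (s ^ 3)" using s3 by simp
    then show False using v s0 s(1) by (simp add: vge_def v_power)
  qed
  have "vge (1 + v s) (144 * s + 24 * s ^ 2)"
    using vge_numeral_mult(3)[OF s(1), of "v s"] vge_numeral_mult(2)[OF power_mem[OF s(1), of 2], of "2 * v s"] s(1) vs0 s0
    by (intro vge_add) (auto intro!: mem_intros simp: vge_def v_power)
  then have "v (s ^ 3) = 1"
    unfolding s3 using v_dominant(2)[of 192 "144 * s + 24 * s ^ 2" "1 + v s"] s(1) vs0 v_numerals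
    by (auto simp: mem_intros)
  then have vs: "v s = 1 / 3" using s(1) s0 by (simp add: v_power)
  have e: "3 * a ^ 2 * s = - (t ^ 3 + 84 * t ^ 2 + 432 * t + 576)"
    by (rule f_param(1)) (use X0 t s b in auto)
  have "v (3 * a ^ 2 * s) = 4 / 3" using a X0 s(1) s0 vX v_3 vs by (simp add: v_mult v_power mem_intros)
  moreover have "3 * a ^ 2 * s = - (t ^ 3 + (84 * t ^ 2 + (432 * t + 576)))" using e by (simp only: add.assoc)
  moreover have "t ^ 3 + (84 * t ^ 2 + (432 * t + 576)) \<in> K" using t(1) by (intro mem_intros)
  moreover have "3 * a ^ 2 * s \<noteq> 0" using X0 s0 by simp
  ultimately have ve: "v (t ^ 3 + (84 * t ^ 2 + (432 * t + 576))) = 4 / 3" "t ^ 3 + (84 * t ^ 2 + (432 * t + 576)) \<noteq> 0"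
    by (simp_all only: v_minus neg_equal_0_iff_equal) auto
  have t0: "t \<noteq> 0" using ve(1) v_numerals by auto
  have vt: "v t \<ge> 0" using t(3) t0 by (simp add: vge_def)
  have parts: "vge (1 + 2 * v t) (84 * t ^ 2)" "vge (3 + v t) (432 * t)"
    using vge_numeral_mult(1)[OF power_mem[OF t(1), of 2], of "2 * v t"] vge_numeral_mult(4)[OF t(1), of "v t"] t(1) t0
    by (auto simp: mem_intros vge_def v_power)
  \<comment> \<open>Only \<open>t ^ 3\<close> can account for the value 4/3: the other terms have
    values at least \<open>1 + 2 * v t\<close>, \<open>3 + v t\<close> and 2.\<close>
  have "v t = 4 / 9"
  proof (rule ccontr)
    assume "v t \<noteq> 4 / 9"
    then consider "v t < 4 / 9" | "v t > 4 / 9" by fastforce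
    then show False
    proof cases
      case 1
      have "vge (min (1 + 2 * v t) 2) (84 * t ^ 2 + (432 * t + 576))"
        using parts t(1) vt v_numerals
        by (intro vge_add) (auto intro!: mem_intros elim!: vge_mono simp: vge_def[of _ 576])
      then have "v (t ^ 3 + (84 * t ^ 2 + (432 * t + 576))) = v (t ^ 3)"
        using t(1) t0 1 by (intro v_dominant(2)) (auto simp: mem_intros v_power)
      then show False using ve 1 t(1) t0 by (simp add: v_power)
    next
      case 2
      have "vge (min (3 * v t) (17 / 9)) (t ^ 3 + (84 * t ^ 2 + (432 * t + 576)))"
        using parts t(1) t0 vt v_numerals 2
        by (intro vge_add) (auto intro!: mem_intros elim!: vge_mono simp: vge_def[of _ 576] vge_def[of _ "t ^ 3"] v_power)
      then show False using ve 2 by (auto simp: vge_def)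
    qed
  qed
  then show False using value_not[OF t(1) t0, of 9 4] by simp
qed

end

section \<open>Cubic fields\<close>

lemma Rats_linear_relation_imp_Rats:
  fixes z :: complex
  assumes "a \<in> \<rat>" "b \<in> \<rat>" "b \<noteq> 0" "a + b * z = 0"
  shows "z \<in> \<rat>"
proof -
  have "z = - a / b" using assms by (simp add: field_simps add_eq_0_iff)
  then show ?thesis using assms by simp
qed

lemma Rats_no_cube_root_of_unity:
  fixes t :: complex
  assumes "t \<in> \<rat>"
  shows "t ^ 2 + t + 1 \<noteq> 0" "t ^ 2 - t + 1 \<noteq> 0"
proof -
  obtain q where q: "t = of_rat q" using assms by (auto elim: Rats_cases)
  have "q ^ 2 + q + 1 = (q + 1 / 2) ^ 2 + 3 / 4" "q ^ 2 - q + 1 = (q - 1 / 2) ^ 2 + 3 / 4"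
    by (simp_all add: power2_eq_square algebra_simps)
  then have "q ^ 2 + q + 1 > 0" "q ^ 2 - q + 1 > 0" by (simp_all only: add_nonneg_pos zero_le_power2 zero_less_divide_iff zero_less_numeral simp_thms)
  then have "q ^ 2 + q + 1 \<noteq> 0" "q ^ 2 - q + 1 \<noteq> 0" by auto
  then have "(of_rat (q ^ 2 + q + 1) :: complex) \<noteq> 0" "(of_rat (q ^ 2 - q + 1) :: complex) \<noteq> 0"
    by (simp_all only: of_rat_eq_0_iff not_False_eq_True)
  then show "t ^ 2 + t + 1 \<noteq> 0" "t ^ 2 - t + 1 \<noteq> 0"
    by (simp_all add: q of_rat_add of_rat_diff of_rat_power)
qed

text \<open>The polynomial has no root modulo 2: its homogeneous form is even only at two even
  arguments, against coprimality.\<close>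

lemma Rats_not_cubic_root:
  fixes r :: complex
  assumes "r \<in> \<rat>"
  shows "r ^ 3 - 3 * r ^ 2 + 1 \<noteq> 0"
proof
  assume r: "r ^ 3 - 3 * r ^ 2 + 1 = 0"
  obtain a b :: int where ab: "b > 0" "coprime a b" "r = of_int a / of_int b"
    using assms by (rule Rats_cases')
  have "(of_int a / of_int b) ^ 3 * of_int b ^ 3 = (of_int a ^ 3 :: complex)"
    "(of_int a / of_int b) ^ 2 * of_int b ^ 3 = (of_int a ^ 2 * of_int b :: complex)"
    using ab(1) by (simp_all add: power_divide power2_eq_square power3_eq_cube)
  then have "(of_int a ^ 3 - 3 * (of_int a ^ 2 * of_int b) + of_int b ^ 3 :: complex) = (r ^ 3 - 3 * r ^ 2 + 1) * of_int b ^ 3"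
    unfolding ab(3) by Groebner_Basis.algebra
  then have "(of_int (a ^ 3 - 3 * (a ^ 2 * b) + b ^ 3) :: complex) = of_int 0" using r by simp
  then have e: "a ^ 3 - 3 * (a ^ 2 * b) + b ^ 3 = 0" by (simp only: of_int_eq_iff)
  have "even (a ^ 3 - 3 * (a ^ 2 * b) + b ^ 3)" unfolding e by simp
  then have "even a \<and> even b" by auto
  then show False using ab(2) by (meson coprime_common_divisor odd_one)
qed

text \<open>Degree 3 in elementary terms: \<open>dependent4\<close> bounds the degree by 3 and
  \<open>not_spanned2\<close> rules out quadratic fields.\<close>

locale cubic_field = complex_subfield +
  assumes dependent4: "\<And>x0 x1 x2 x3. x0 \<in> K \<Longrightarrow> x1 \<in> K \<Longrightarrow> x2 \<in> K \<Longrightarrow> x3 \<in> K \<Longrightarrow>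
      \<exists>a0\<in>\<rat>. \<exists>a1\<in>\<rat>. \<exists>a2\<in>\<rat>. \<exists>a3\<in>\<rat>. (a0 \<noteq> 0 \<or> a1 \<noteq> 0 \<or> a2 \<noteq> 0 \<or> a3 \<noteq> 0)
        \<and> a0 * x0 + a1 * x1 + a2 * x2 + a3 * x3 = 0"
    and not_spanned2: "\<And>z. z \<in> K \<Longrightarrow> z \<notin> \<rat> \<Longrightarrow> \<exists>x\<in>K. \<forall>a\<in>\<rat>. \<forall>b\<in>\<rat>. x \<noteq> a + b * z"
begin

text \<open>The tower law by hand. A relation among 1, \<open>z\<close>, \<open>k\<close>,
  \<open>k * z\<close> reads \<open>(a0 + a1 * z) + (a2 + a3 * z) * k = 0\<close>; multiplying by
  the conjugate of \<open>a2 + a3 * z\<close> puts \<open>k\<close> into the span of 1 and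
  \<open>z\<close>.\<close>

lemma quadratic_imp_Rats:
  assumes z: "z \<in> K" and p: "p \<in> \<rat>" and q: "q \<in> \<rat>" and e: "z ^ 2 = p + q * z"
  shows "z \<in> \<rat>"
proof (rule ccontr)
  assume nz: "z \<notin> \<rat>"
  have lin: "b = 0" if "a \<in> \<rat>" "b \<in> \<rat>" "a + b * z = 0" for a b
    using Rats_linear_relation_imp_Rats that nz by blast
  obtain k where k: "k \<in> K" "\<And>a b. a \<in> \<rat> \<Longrightarrow> b \<in> \<rat> \<Longrightarrow> k \<noteq> a + b * z"
    using not_spanned2[OF z nz] by auto
  obtain a0 a1 a2 a3 where a: "a0 \<in> \<rat>" "a1 \<in> \<rat>" "a2 \<in> \<rat>" "a3 \<in> \<rat>" "a0 \<noteq> 0 \<or> a1 \<noteq> 0 \<or> a2 \<noteq> 0 \<or> a3 \<noteq> 0"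
    "a0 * 1 + a1 * z + a2 * k + a3 * (k * z) = 0"
    using dependent4[OF one_mem z k(1) mult_mem[OF k(1) z]] by blast
  have w: "a2 + a3 * z \<noteq> 0"
  proof
    assume w0: "a2 + a3 * z = 0"
    then have "a3 = 0" "a2 = 0" using lin[of a2 a3] a by auto
    moreover from this have "a1 = 0" "a0 = 0" using lin[of a0 a1] a by auto
    ultimately show False using a(5) by simp
  qed
  \<comment> \<open>The conjugate of \<open>a2 + a3 * z\<close>, since the conjugate of
    \<open>z\<close> is \<open>q - z\<close>; their product \<open>N\<close> is the norm.\<close>
  have w': "(a2 + a3 * q) + (- a3) * z \<noteq> 0"
  proof
    assume w0: "(a2 + a3 * q) + (- a3) * z = 0"
    have "- a3 = 0" by (rule lin[OF _ _ w0]) (use a q in auto)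
    then have "a3 = 0" by simp
    then show False using w w0 by simp
  qed
  define N where "N = a2 ^ 2 + a2 * a3 * q - a3 ^ 2 * p"
  have N: "(a2 + a3 * z) * ((a2 + a3 * q) + (- a3) * z) = N"
    using e unfolding N_def by Groebner_Basis.algebra
  then have N0: "N \<noteq> 0" using w w' by auto
  have NQ: "N \<in> \<rat>" using a p q by (auto simp: N_def)
  have "N * k = - (a0 * (a2 + a3 * q) - a1 * a3 * p) + (- (a1 * a2 - a0 * a3)) * z"
    using a(6) e unfolding N[symmetric] by Groebner_Basis.algebra
  then have "k = (- (a0 * (a2 + a3 * q) - a1 * a3 * p)) / N + ((- (a1 * a2 - a0 * a3)) / N) * z"
    using N0 by (metis add_divide_distrib nonzero_mult_div_cancel_left times_divide_eq_left)
  then show False using k(2) NQ a p q by (metis Rats_add Rats_diff Rats_divide Rats_minus_iff Rats_mult)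
qed

lemma square_Rats: "z \<in> K \<Longrightarrow> z ^ 2 \<in> \<rat> \<Longrightarrow> z \<in> \<rat>"
  using quadratic_imp_Rats[of z "z ^ 2" 0] by simp

text \<open>The ratio of two different cube roots would be a primitive cube root of unity, which is
  quadratic.\<close>

lemma cube_root_unique:
  assumes "x \<in> K" "y \<in> K" "x ^ 3 = y ^ 3"
  shows "x = y"
proof (rule ccontr)
  assume ne: "x \<noteq> y"
  then have y: "y \<noteq> 0" using assms by auto
  define t where "t = x / y"
  have t1: "t \<noteq> 1" using ne y by (auto simp: t_def)
  have "t ^ 3 = 1" using assms y by (simp add: t_def power_divide)
  then have "(t - 1) * (t ^ 2 + t + 1) = 0" by Groebner_Basis.algebra
  then have t: "t ^ 2 + t + 1 = 0" using t1 by simp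
  then have "t ^ 2 = - 1 + - 1 * t" by Groebner_Basis.algebra
  moreover have "t \<in> K" using assms by (auto simp: t_def intro: mem_intros)
  ultimately have "t \<in> \<rat>" by (intro quadratic_imp_Rats[of t "- 1" "- 1"]) auto
  then show False using Rats_no_cube_root_of_unity(1) t by blast
qed

lemma power_basis_independent:
  assumes z: "z \<in> K" "z \<notin> \<rat>" and a: "a \<in> \<rat>" "b \<in> \<rat>" "d \<in> \<rat>" and e: "a + b * z + d * z ^ 2 = 0"
  shows "a = 0" "b = 0" "d = 0"
proof -
  show d: "d = 0"
  proof (rule ccontr)
    assume "d \<noteq> 0"
    have "z ^ 2 = d * z ^ 2 / d" using \<open>d \<noteq> 0\<close> by simp
    also have "d * z ^ 2 = - a + - b * z" using e by Groebner_Basis.algebra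
    also have "(- a + - b * z) / d = - a / d + (- b / d) * z" by (simp add: add_divide_distrib diff_divide_distrib)
    finally have "z ^ 2 = - a / d + (- b / d) * z" .
    then show False using quadratic_imp_Rats[of z "- a / d" "- b / d"] z a by auto
  qed
  show b: "b = 0" using Rats_linear_relation_imp_Rats[of a b z] z a e d by auto
  show "a = 0" using e b d by simp
qed

lemma power_basis_spans:
  assumes z: "z \<in> K" "z \<notin> \<rat>" and x: "x \<in> K"
  obtains a b d where "a \<in> \<rat>" "b \<in> \<rat>" "d \<in> \<rat>" "x = a + b * z + d * z ^ 2"
proof -
  obtain a0 a1 a2 a3 where a: "a0 \<in> \<rat>" "a1 \<in> \<rat>" "a2 \<in> \<rat>" "a3 \<in> \<rat>" "a0 \<noteq> 0 \<or> a1 \<noteq> 0 \<or> a2 \<noteq> 0 \<or> a3 \<noteq> 0"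
    "a0 * 1 + a1 * z + a2 * z ^ 2 + a3 * x = 0"
    using dependent4[OF one_mem z(1) power_mem[OF z(1), of 2] x] by blast
  have "a3 \<noteq> 0" using power_basis_independent[OF z a(1,2,3)] a by auto
  then have "x = a3 * x / a3" by simp
  also have "a3 * x = - a0 + - a1 * z + - a2 * z ^ 2" using a(6) by Groebner_Basis.algebra
  also have "(- a0 + - a1 * z + - a2 * z ^ 2) / a3 = (- a0 / a3) + (- a1 / a3) * z + (- a2 / a3) * z ^ 2"
    by (simp add: add_divide_distrib diff_divide_distrib)
  finally have "x = (- a0 / a3) + (- a1 / a3) * z + (- a2 / a3) * z ^ 2" .
  then show thesis by (rule that[rotated 3]) (use a in auto)
qed

text \<open>Kummer theory in coordinates: as \<open>x ^ 3\<close> is rational, the coefficients of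
  \<open>z\<close> and \<open>z ^ 2\<close> in the expanded cube vanish.\<close>

lemma pure_cubic_cube_roots:
  assumes z: "z \<in> K" "z \<notin> \<rat>" "z ^ 3 \<in> \<rat>" and x: "x \<in> K" "x ^ 3 \<in> \<rat>"
  shows "\<exists>b\<in>\<rat>. x = b \<or> x = b * z \<or> x = b * z ^ 2"
proof -
  define q where "q = z ^ 3"
  obtain a b d where x': "a \<in> \<rat>" "b \<in> \<rat>" "d \<in> \<rat>" "x = a + b * z + d * z ^ 2"
    using power_basis_spans[OF z(1,2) x(1)] .
  have qQ: "q \<in> \<rat>" using z by (simp add: q_def)
  have "(a ^ 3 + q * b ^ 3 + q ^ 2 * d ^ 3 + 6 * a * b * d * q - x ^ 3)
      + 3 * (a ^ 2 * b + q * (a * d ^ 2 + b ^ 2 * d)) * z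
      + 3 * (a ^ 2 * d + a * b ^ 2 + q * b * d ^ 2) * z ^ 2 = 0"
    unfolding x'(4) q_def by Groebner_Basis.algebra
  note e' = power_basis_independent[OF z(1,2) _ _ _ this]
  have "3 * (a ^ 2 * b + q * (a * d ^ 2 + b ^ 2 * d)) = 0"
    by (rule e'(2)) (use x' x qQ in auto)
  moreover have "3 * (a ^ 2 * d + a * b ^ 2 + q * b * d ^ 2) = 0"
    by (rule e'(3)) (use x' x qQ in auto)
  ultimately have e: "a ^ 2 * b + q * (a * d ^ 2 + b ^ 2 * d) = 0" "a ^ 2 * d + a * b ^ 2 + q * b * d ^ 2 = 0"
    by (simp_all only: mult_eq_0_iff zero_neq_numeral[symmetric] simp_thms)
  \<comment> \<open>\<open>d\<close> times the first equation minus \<open>b\<close> times the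
    second.\<close>
  have "a * (q * d ^ 3 - b ^ 3) = 0" using e by Groebner_Basis.algebra
  moreover have "b = 0 \<and> d = 0" if "q * d ^ 3 = b ^ 3"
  proof -
    have "(z * d) ^ 3 = b ^ 3" using that by (simp add: q_def power_mult_distrib)
    then have zd: "z * d = b"
      by (rule cube_root_unique[OF mult_mem[OF z(1) Rats_mem[OF x'(3)]] Rats_mem[OF x'(2)]])
    have "d = 0" using Rats_linear_relation_imp_Rats[of "- b" d z] zd x' z by (auto simp: mult.commute)
    then show ?thesis using zd by simp
  qed
  ultimately consider "b = 0" "d = 0" | "a = 0" by auto
  then show ?thesis
  proof cases
    case 1
    then show ?thesis using x' by auto
  next
    case 2
    have "q \<noteq> 0" using z by (auto simp: q_def)
    then have "b = 0 \<or> d = 0" using e 2 by auto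
    then show ?thesis using x' 2 by auto
  qed
qed

text \<open>The cubic has square discriminant 81, hence is cyclic, unlike a pure cubic. In
  coordinates with respect to \<open>z\<close> the conflict appears as a rational root of
  \<open>u ^ 2 - u + 1\<close>.\<close>

lemma no_pure_cubic:
  assumes z: "z \<in> K" "z ^ 3 \<in> \<rat>" and r: "r \<in> K" "r ^ 3 - 3 * r ^ 2 + 1 = 0"
  shows "z \<in> \<rat>"
proof (rule ccontr)
  assume nz: "z \<notin> \<rat>"
  define q where "q = z ^ 3"
  obtain a b d where r': "a \<in> \<rat>" "b \<in> \<rat>" "d \<in> \<rat>" "r = a + b * z + d * z ^ 2"
    using power_basis_spans[OF z(1) nz r(1)] .
  have qQ: "q \<in> \<rat>" using z by (simp add: q_def)
  have rQ: "r \<notin> \<rat>" using Rats_not_cubic_root r(2) by blast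
  have "(a ^ 3 + q * b ^ 3 + q ^ 2 * d ^ 3 + 6 * a * b * d * q - 3 * a ^ 2 - 6 * b * d * q + 1)
      + 3 * (a ^ 2 * b + q * (a * d ^ 2 + b ^ 2 * d) - 2 * a * b - q * d ^ 2) * z
      + 3 * (a ^ 2 * d + a * b ^ 2 + q * b * d ^ 2 - 2 * a * d - b ^ 2) * z ^ 2 = r ^ 3 - 3 * r ^ 2 + 1"
    unfolding r'(4) q_def by Groebner_Basis.algebra
  then have "(a ^ 3 + q * b ^ 3 + q ^ 2 * d ^ 3 + 6 * a * b * d * q - 3 * a ^ 2 - 6 * b * d * q + 1)
      + 3 * (a ^ 2 * b + q * (a * d ^ 2 + b ^ 2 * d) - 2 * a * b - q * d ^ 2) * z
      + 3 * (a ^ 2 * d + a * b ^ 2 + q * b * d ^ 2 - 2 * a * d - b ^ 2) * z ^ 2 = 0"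
    unfolding r(2) .
  note e' = power_basis_independent[OF z(1) nz _ _ _ this]
  have e: "a ^ 3 + q * b ^ 3 + q ^ 2 * d ^ 3 + 6 * a * b * d * q - 3 * a ^ 2 - 6 * b * d * q + 1 = 0"
    "a ^ 2 * b + q * (a * d ^ 2 + b ^ 2 * d) - 2 * a * b - q * d ^ 2 = 0"
    "a ^ 2 * d + a * b ^ 2 + q * b * d ^ 2 - 2 * a * d - b ^ 2 = 0"
  proof -
    show "a ^ 3 + q * b ^ 3 + q ^ 2 * d ^ 3 + 6 * a * b * d * q - 3 * a ^ 2 - 6 * b * d * q + 1 = 0"
      by (rule e'(1)) (use r' qQ in auto)
    have "3 * (a ^ 2 * b + q * (a * d ^ 2 + b ^ 2 * d) - 2 * a * b - q * d ^ 2) = 0"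
      by (rule e'(2)) (use r' qQ in auto)
    then show "a ^ 2 * b + q * (a * d ^ 2 + b ^ 2 * d) - 2 * a * b - q * d ^ 2 = 0"
      by (simp_all only: mult_eq_0_iff zero_neq_numeral[symmetric] simp_thms)
    have "3 * (a ^ 2 * d + a * b ^ 2 + q * b * d ^ 2 - 2 * a * d - b ^ 2) = 0"
      by (rule e'(3)) (use r' qQ in auto)
    then show "a ^ 2 * d + a * b ^ 2 + q * b * d ^ 2 - 2 * a * d - b ^ 2 = 0"
      by (simp_all only: mult_eq_0_iff zero_neq_numeral[symmetric] simp_thms)
  qed
  have bd: "\<not> (b = 0 \<and> d = 0)" using rQ r' by auto
  have "q * d ^ 3 \<noteq> b ^ 3"
  proof
    assume "q * d ^ 3 = b ^ 3"
    then have "(z * d) ^ 3 = b ^ 3" by (simp add: q_def power_mult_distrib)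
    then have zd: "z * d = b"
      by (rule cube_root_unique[OF mult_mem[OF z(1) Rats_mem[OF r'(3)]] Rats_mem[OF r'(2)]])
    have "d = 0" using Rats_linear_relation_imp_Rats[of "- b" d z] zd r' nz by (auto simp: mult.commute)
    then show False using zd bd by simp
  qed
  \<comment> \<open>The elimination of \<open>pure_cubic_cube_roots\<close> with a shift by 1; that
    \<open>a = 1\<close> reflects the trace 3 of \<open>r\<close>.\<close>
  moreover have "(a - 1) * (q * d ^ 3 - b ^ 3) = 0" using e(2,3) by Groebner_Basis.algebra
  ultimately have a1: "a = 1" by simp
  have "b * (q * b * d - 1) = 0" "d * (q * b * d - 1) = 0" using e(2,3) a1 by Groebner_Basis.algebra+
  then have qbd: "q * b * d = 1" using bd by auto
  \<comment> \<open>As \<open>q * b * d = 1\<close>, the term \<open>q ^ 2 * d ^ 3\<close> is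
    \<open>1 / u\<close>, and the constant coefficient reads \<open>u + 1 / u = 1\<close>.\<close>
  define u where "u = q * b ^ 3"
  have "u ^ 2 - u + 1 = 0"
    using e(1) qbd a1 unfolding u_def by Groebner_Basis.algebra
  moreover have "u \<in> \<rat>" using qQ r' by (simp add: u_def)
  ultimately show False using Rats_no_cube_root_of_unity(2) by blast
qed

end

section \<open>Existence of the 3-adic valuation on a cubic field\<close>

lemma (in cubic_field) exists_valuation: "\<exists>v. valued_subfield K v"
proof -
  obtain R where "maximal_subring R" using exists_maximal_subring by blast
  then interpret maximal_subring R .
  \<comment> \<open>Meaningful only where a value exists, which \<open>hv\<close> shows for all
    nonzero elements of \<open>K\<close>.\<close>
  define v where "v z = (SOME q. has_val z q)" for z
  have hv: "has_val z (v z) \<and> (v z \<in> \<int> \<or> 2 * v z \<in> \<int> \<or> 3 * v z \<in> \<int>)" if z: "z \<in> K" "z \<noteq> 0" for z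
  proof -
    obtain a0 a1 a2 a3 where a: "a0 \<in> \<rat>" "a1 \<in> \<rat>" "a2 \<in> \<rat>" "a3 \<in> \<rat>" "a0 \<noteq> 0 \<or> a1 \<noteq> 0 \<or> a2 \<noteq> 0 \<or> a3 \<noteq> 0"
      "a0 * 1 + a1 * z + a2 * z ^ 2 + a3 * z ^ 3 = 0"
      using dependent4[OF one_mem z(1) power_mem[OF z(1), of 2] power_mem[OF z(1), of 3]] by blast
    define a where "a i = (if i = 0 then a0 else if i = 1 then a1 else if i = 2 then a2 else a3)" for i :: nat
    have "(\<Sum>i\<le>(3::nat). a i * z ^ i) = 0"
    proof -
      have "{..3} = {0, 1, 2, 3 :: nat}" by auto
      then show ?thesis using a(6) by (simp add: a_def add.assoc)
    qed
    moreover have "a i \<in> \<rat>" for i using a by (simp add: a_def)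
    moreover have "\<exists>i\<le>3. a i \<noteq> 0"
    proof -
      have "a 0 \<noteq> 0 \<or> a 1 \<noteq> 0 \<or> a 2 \<noteq> 0 \<or> a 3 \<noteq> 0" using a(5) by (simp add: a_def)
      moreover have "(0::nat) \<le> 3" "(1::nat) \<le> 3" "(2::nat) \<le> 3" "(3::nat) \<le> 3" by auto
      ultimately show ?thesis by metis
    qed
    ultimately obtain k l where kl: "k \<in> {1, 2, 3 :: nat}" "has_val z (of_int l / of_nat k)"
      using has_val_cubic[OF z(2), of a] by blast
    have "has_val z (v z)" unfolding v_def using kl(2) by (rule someI)
    then have "v z = of_int l / of_nat k" using kl(2) has_val_unique by blast
    then show ?thesis using kl(1) \<open>has_val z (v z)\<close> by auto
  qed
  have eq: "v z = q" if "z \<in> K" "has_val z q" for z q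
  proof -
    have "z \<noteq> 0" using that by (simp add: has_val_def)
    then have "has_val z (v z)" using hv that by blast
    then show ?thesis using that(2) by (rule has_val_unique)
  qed
  have "valued_subfield K v"
  proof unfold_locales
    fix z w assume "z \<in> K" "w \<in> K" "z \<noteq> 0" "w \<noteq> 0"
    then show "v (z * w) = v z + v w"
      using hv by (intro eq has_val_mult mult_mem) auto
  next
    fix z w assume zw: "z \<in> K" "w \<in> K" "z \<noteq> 0" "w \<noteq> 0" "z + w \<noteq> 0" "v z \<le> v w"
    have "has_val z (v z)" "has_val w (v w)" "has_val (z + w) (v (z + w))"
      using hv zw add_mem by blast+
    then show "v z \<le> v (z + w)" using zw(6) by (rule has_val_add)
  next
    show "v 3 = 1" using numeral_mem has_val_3 by (rule eq)
  next
    fix n :: int assume "\<not> 3 dvd n"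
    then show "v (of_int n) = 0" by (intro eq of_int_mem has_val_unit unit_of_int)
  next
    fix q :: complex assume q: "q \<in> \<rat>" "q \<noteq> 0"
    obtain l where "unit (q * 3 powi (- l))" using rational_unit_part[OF q] by blast
    then have "has_val q (of_int l / of_nat 1)" using q by (intro has_valI) auto
    then have "v q = of_int l" using eq[OF Rats_mem[OF q(1)]] by simp
    then show "v q \<in> \<int>" by simp
  next
    fix z assume "z \<in> K" "z \<noteq> 0"
    then show "v z \<in> \<int> \<or> 2 * v z \<in> \<int> \<or> 3 * v z \<in> \<int>" using hv by blast
  qed
  then show ?thesis by blast
qed

section \<open>Translation between HOL-Algebra subfields and the locales\<close>

lemma complex_ring_simps:
  "carrier complex_ring = UNIV" "monoid.mult complex_ring x y = x * y" "one complex_ring = 1"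
  "ring.zero complex_ring = 0" "add complex_ring x y = x + y"
  by (simp_all add: ring_of_type_algebra_def)

lemma subfield_complex_subfield:
  assumes "subfield K complex_ring"
  shows "complex_subfield K"
proof
  interpret R: Ring.field complex_ring by (rule field_from_type_algebra)
  note simps = complex_ring_simps
  show "1 \<in> K" using subringE(3)[OF subfieldE(1)[OF assms]] by (simp add: simps)
  show "x + y \<in> K" if "x \<in> K" "y \<in> K" for x y
    using subringE(7)[OF subfieldE(1)[OF assms]] that by (simp add: simps)
  show "x * y \<in> K" if "x \<in> K" "y \<in> K" for x y
    using subringE(6)[OF subfieldE(1)[OF assms]] that by (simp add: simps)
  show "- x \<in> K" if "x \<in> K" for x
  proof -
    have "\<ominus>\<^bsub>complex_ring\<^esub> x \<in> K" using subringE(5)[OF subfieldE(1)[OF assms]] that .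
    moreover have "\<ominus>\<^bsub>complex_ring\<^esub> x = - x"
      by (rule R.minus_equality) (auto simp: simps)
    ultimately show ?thesis by simp
  qed
  show "inverse x \<in> K" if "x \<in> K" for x
  proof (cases "x = 0")
    case True
    then show ?thesis using that by simp
  next
    case False
    have "x \<in> K - {\<zero>\<^bsub>complex_ring\<^esub>}" using that False by (simp add: simps)
    then have "inv\<^bsub>complex_ring\<^esub> x \<in> K" using R.subfield_m_inv(1)[OF assms] by blast
    moreover have "inv\<^bsub>complex_ring\<^esub> x = inverse x"
      by (rule R.comm_inv_char) (use False in \<open>auto simp: simps\<close>)
    ultimately show ?thesis by simp
  qed
qed

lemma complex_subfield_subfield:
  assumes "complex_subfield K"
  shows "subfield K complex_ring"
proof -
  interpret complex_subfield K by fact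
  interpret R: Ring.field complex_ring by (rule field_from_type_algebra)
  note simps = complex_ring_simps
  have minus: "\<ominus>\<^bsub>complex_ring\<^esub> x = - x" for x
    by (rule R.minus_equality) (auto simp: simps)
  have inv: "inv\<^bsub>complex_ring\<^esub> x = inverse x" if "x \<noteq> 0" for x
    by (rule R.comm_inv_char) (use that in \<open>auto simp: simps\<close>)
  show ?thesis
  proof (rule R.subfieldI')
    show "subring K complex_ring"
      by (rule R.subringI) (auto simp: minus simps intro: mem_intros)
    show "inv\<^bsub>complex_ring\<^esub> k \<in> K" if "k \<in> K - {\<zero>\<^bsub>complex_ring\<^esub>}" for k
      using that inv by (auto simp: simps intro: mem_intros)
  qed
qed

lemma complex_subfield_Rats: "complex_subfield \<rat>"
  by unfold_locales auto

lemma subfield_Rats: "subfield \<rat> complex_ring"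
  by (rule complex_subfield_subfield[OF complex_subfield_Rats])

lemma number_field_cubic:
  assumes "number_field_of_degree 3 K"
  shows "cubic_field K"
proof -
  have K: "subfield K complex_ring" and dim: "ring.dimension complex_ring 3 \<rat> K"
    using assms by (auto simp: number_field_of_degree_def)
  interpret complex_subfield K by (rule subfield_complex_subfield[OF K])
  interpret R: Ring.field complex_ring by (rule field_from_type_algebra)
  note simps = complex_ring_simps
  have comb: "R.combine (k # ks) (u # us) = k * u + R.combine ks us" "R.combine [] us = 0" "R.combine ks [] = 0"
    for k u :: complex and ks us using R.combine.simps by (simp_all add: simps)
  show ?thesis
  proof unfold_locales
    fix x0 x1 x2 x3 assume x: "x0 \<in> K" "x1 \<in> K" "x2 \<in> K" "x3 \<in> K"
    have "\<not> R.independent \<rat> [x0, x1, x2, x3]"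
      using R.independent_length_le_dimension[OF subfield_Rats dim, of "[x0, x1, x2, x3]"] x by auto
    then obtain ks where ks: "length ks = length [x0, x1, x2, x3]" "R.combine ks [x0, x1, x2, x3] = 0"
        "set ks \<subseteq> \<rat>" "set ks \<noteq> {0}"
      using R.dependent_imp_non_trivial_combine[OF subfield_Rats, of "[x0, x1, x2, x3]"] by (auto simp: simps)
    from ks(1) obtain a0 a1 a2 a3 where k: "ks = [a0, a1, a2, a3]" by (auto simp: length_Suc_conv)
    have "a0 * x0 + a1 * x1 + a2 * x2 + a3 * x3 = 0"
      using ks(2) unfolding k comb by (simp add: add.assoc)
    then show "\<exists>a0\<in>\<rat>. \<exists>a1\<in>\<rat>. \<exists>a2\<in>\<rat>. \<exists>a3\<in>\<rat>. (a0 \<noteq> 0 \<or> a1 \<noteq> 0 \<or> a2 \<noteq> 0 \<or> a3 \<noteq> 0)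
        \<and> a0 * x0 + a1 * x1 + a2 * x2 + a3 * x3 = 0"
      using ks(3,4) unfolding k by auto
  next
    fix z assume z: "z \<in> K" "z \<notin> \<rat>"
    show "\<exists>x\<in>K. \<forall>a\<in>\<rat>. \<forall>b\<in>\<rat>. x \<noteq> a + b * z"
    proof (rule ccontr)
      assume "\<not> ?thesis"
      then have sp: "\<exists>a\<in>\<rat>. \<exists>b\<in>\<rat>. x = a + b * z" if "x \<in> K" for x using that by blast
      obtain Vs where Vs: "set Vs \<subseteq> UNIV" "R.independent \<rat> Vs" "length Vs = 3" "R.Span \<rat> Vs = K"
        using R.exists_base[OF subfield_Rats dim] by (auto simp: simps)
      \<comment> \<open>A base of three elements would lie in the span of two.\<close>
      have "set Vs \<subseteq> R.Span \<rat> [z, 1]"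
      proof
        fix x assume "x \<in> set Vs"
        then have "x \<in> K" using R.Span_base_incl[OF subfield_Rats, of Vs] Vs by (auto simp: simps)
        then obtain a b where ab: "a \<in> \<rat>" "b \<in> \<rat>" "x = a + b * z" using sp by blast
        have "R.combine [b, a] [z, 1] = x" unfolding comb ab by simp
        then show "x \<in> R.Span \<rat> [z, 1]"
          using R.Span_mem_iff_length_version[OF subfield_Rats, of "[z, 1]" x, THEN iffD2, OF _ exI[of _ "[b, a]"]] ab
          by (simp add: simps del: R.combine.simps)
      qed
      moreover have "R.independent \<rat> [z, 1]"
      proof -
        have mem: "x \<in> R.Span \<rat> [1] \<longleftrightarrow> (\<exists>ks. set ks \<subseteq> \<rat> \<and> length ks = 1 \<and> x = R.combine ks [1])" for x
          using R.Span_mem_iff_length_version[OF subfield_Rats, of "[1]" x] by (simp add: simps)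
        have "z \<notin> R.Span \<rat> [1]"
          using z(2) unfolding mem by (auto simp: length_Suc_conv comb simp del: R.combine.simps)
        moreover have "R.independent \<rat> [1]" by (rule R.li_Cons) (auto simp: simps)
        ultimately show ?thesis by (intro R.li_Cons) (simp_all add: simps)
      qed
      ultimately have "length Vs \<le> length [z, 1]"
        using R.independent_length_le[OF subfield_Rats Vs(2), of "[z, 1]"] by (auto simp: simps)
      then show False using Vs(3) by simp
    qed
  qed
qed

section \<open>Torsion points\<close>

lemma triple_point_aux:
  fixes c D p k N e :: complex
  shows "c \<noteq> 0 \<Longrightarrow> p \<noteq> 0 \<Longrightarrow> - ((D / c) ^ 3) / (27 * (p / c) ^ 2) = - (D ^ 3) / (27 * c * p ^ 2)"
    and "k \<noteq> 0 \<Longrightarrow> e \<noteq> 0 \<Longrightarrow> - ((- N / k) ^ 3) / (27 * (- e / k) ^ 2) = N ^ 3 / (27 * k * e ^ 2)"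
    and "k \<noteq> 0 \<Longrightarrow> - e / k + 4 = (4 * k - e) / k"
  by (simp_all add: power_divide divide_simps) (simp_all add: power2_eq_square power3_eq_cube)

text \<open>The third division polynomial is \<open>3 * x * (x ^ 3 + 4 * c)\<close>, with zeros at
  \<open>X = 0\<close> and \<open>X = - 4\<close>. Tripling is, up to sign, the square of the
  isogeny, and the sign does not affect the abscissa; the identity is checked on explicit
  formulas.\<close>

lemma triple_point:
  fixes c x y :: complex
  assumes c: "c \<noteq> 0" and P: "y ^ 2 = x ^ 3 + c"
  defines "P \<equiv> Affine x y"
  shows "(P \<boxplus> P) \<boxplus> P = Infinity \<longleftrightarrow> x ^ 3 / c = 0 \<or> x ^ 3 / c = - 4"
    and "(P \<boxplus> P) \<boxplus> P = Affine x' y' \<Longrightarrow> x' ^ 3 / c = sqrt_neg3_map (sqrt_neg3_map (x ^ 3 / c))"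
proof -
  have X: "x ^ 3 / c = 0 \<longleftrightarrow> x = 0" "x ^ 3 / c = - 4 \<longleftrightarrow> x ^ 3 + 4 * c = 0"
    using c by (auto simp: divide_eq_eq add_eq_0_iff2)
  have "((P \<boxplus> P) \<boxplus> P = Infinity \<longleftrightarrow> x = 0 \<or> x ^ 3 + 4 * c = 0) \<and>
    (\<forall>x' y'. (P \<boxplus> P) \<boxplus> P = Affine x' y' \<longrightarrow> x' ^ 3 / c = sqrt_neg3_map (sqrt_neg3_map (x ^ 3 / c)))"
  proof (cases "y = 0")
    case True
    then have e: "x ^ 3 = - c" using P by (simp add: eq_neg_iff_add_eq_0)
    then have "x \<noteq> 0" using c by auto
    moreover have "x ^ 3 + 4 * c \<noteq> 0" using e c by simp
    moreover have "P \<boxplus> P = Infinity" using True by (simp add: P_def add_opposite)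
    moreover have "sqrt_neg3_map (- 1) = - 1" by (simp add: sqrt_neg3_map_def)
    moreover have "x ^ 3 / c = - 1" using e c by simp
    ultimately show ?thesis by (simp add: P_def)
  next
    case False
    then have "\<not> (x = x \<and> y = - y)" by (simp add: eq_neg_iff_add_eq_0)
    then obtain a b x2 where ab: "P \<boxplus> P = Affine x2 (- (a * x2 + b))" "y = a * x + b" "cuts c a b x x x2"
      unfolding P_def using add_cases_line[OF P P] by metis
    have P2: "(- (a * x2 + b)) ^ 2 = x2 ^ 3 + c" using cuts_on_curve[OF ab(3)] by Groebner_Basis.algebra
    have ty: "2 * a * y = 3 * x ^ 2" using ab(2) cutsD[OF ab(3)] by Groebner_Basis.algebra
    \<comment> \<open>The division polynomial appears as the condition that \<open>2 P\<close> and
      \<open>P\<close> share their abscissa.\<close>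
    have x2: "4 * y ^ 2 * (x2 - x) = - 3 * x * (x ^ 3 + 4 * c)"
      using cutsD(1)[OF ab(3)] ty P by Groebner_Basis.algebra
    show ?thesis
    proof (cases "x2 = x")
      case True
      then have "x = 0 \<or> x ^ 3 + 4 * c = 0" using x2 by simp
      moreover have "(P \<boxplus> P) \<boxplus> P = Infinity"
        unfolding ab(1) unfolding P_def by (rule add_opposite) (use True ab(2) in simp)
      ultimately show ?thesis by simp
    next
      case ne: False
      then have nz: "x \<noteq> 0" "x ^ 3 + 4 * c \<noteq> 0" using x2 False by auto
      obtain d e x3 where de: "(P \<boxplus> P) \<boxplus> P = Affine x3 (- (d * x3 + e))"
        "- (a * x2 + b) = d * x2 + e" "y = d * x + e" "cuts c d e x2 x x3"
        unfolding ab(1) unfolding P_def using add_cases_line[OF P2 P] ne by metis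
      \<comment> \<open>\<open>9 * x ^ 2 * D ^ 2\<close> is the square of the third division
        polynomial, and \<open>N\<close> the numerator of the abscissa of
        \<open>3 P\<close>.\<close>
      define D where "D = x ^ 3 + 4 * c"
      define N where "N = x ^ 9 - 96 * c * x ^ 6 + 48 * c ^ 2 * x ^ 3 + 64 * c ^ 3"
      have D0: "D \<noteq> 0" using nz by (simp add: D_def)
      have "(a + d) * (x2 - x) = - 2 * y" using ab(2) de(2,3) by Groebner_Basis.algebra
      then have "(x2 - x) * (d * (6 * x * y * D)) = (x2 - x) * (16 * y ^ 4 - 9 * x ^ 3 * D)"
        using ty x2 unfolding D_def by Groebner_Basis.algebra
      then have d: "d * (6 * x * y * D) = 16 * y ^ 4 - 9 * x ^ 3 * D" using ne by simp
      have x3: "x3 = d ^ 2 - x2 - x" using cutsD(1)[OF de(4)] by (simp add: algebra_simps)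
      have "(4 * y ^ 2) * (9 * x ^ 2 * D ^ 2 * x3)
          = (d * (6 * x * y * D)) ^ 2 - 9 * x ^ 2 * D ^ 2 * (4 * y ^ 2 * (x2 - x) + 8 * y ^ 2 * x)"
        unfolding x3 by Groebner_Basis.algebra
      also have "\<dots> = (4 * y ^ 2) * N"
        unfolding d x2 using P unfolding D_def N_def by Groebner_Basis.algebra
      finally have x3': "9 * x ^ 2 * D ^ 2 * x3 = N" using False by (simp add: mult_ac)
      then have "x3 = N / (9 * x ^ 2 * D ^ 2)" using nz D0 by (simp add: eq_divide_eq mult.commute)
      then have "x3 ^ 3 / c = N ^ 3 / (729 * x ^ 6 * D ^ 6 * c)"
        by (simp add: power_divide power_mult_distrib power_mult[symmetric])
      moreover have "sqrt_neg3_map (sqrt_neg3_map (x ^ 3 / c)) = N ^ 3 / (729 * x ^ 6 * D ^ 6 * c)"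
      proof -
        have X4: "x ^ 3 / c + 4 = D / c" using c by (simp add: D_def add_divide_distrib)
        have 1: "sqrt_neg3_map (x ^ 3 / c) = - (D ^ 3) / (27 * c * (x ^ 3) ^ 2)"
          unfolding sqrt_neg3_map_def X4 by (rule triple_point_aux(1)) (use c nz in auto)
        have k: "27 * c * (x ^ 3) ^ 2 \<noteq> 0" using c nz by simp
        have "- (D ^ 3) / (27 * c * (x ^ 3) ^ 2) + 4 = (4 * (27 * c * (x ^ 3) ^ 2) - D ^ 3) / (27 * c * (x ^ 3) ^ 2)"
          using k by (rule triple_point_aux(3))
        also have "4 * (27 * c * (x ^ 3) ^ 2) - D ^ 3 = - N" unfolding D_def N_def by Groebner_Basis.algebra
        finally have 2: "- (D ^ 3) / (27 * c * (x ^ 3) ^ 2) + 4 = - N / (27 * c * (x ^ 3) ^ 2)" .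
        have "sqrt_neg3_map (sqrt_neg3_map (x ^ 3 / c)) = N ^ 3 / (27 * (27 * c * (x ^ 3) ^ 2) * (D ^ 3) ^ 2)"
          unfolding 1 unfolding sqrt_neg3_map_def[of "- (D ^ 3) / (27 * c * (x ^ 3) ^ 2)"] 2
          by (rule triple_point_aux(2)) (use k D0 in auto)
        then show ?thesis by (simp add: power_mult[symmetric] mult_ac)
      qed
      ultimately show ?thesis using de(1) nz by simp
    qed
  qed
  then show "(P \<boxplus> P) \<boxplus> P = Infinity \<longleftrightarrow> x ^ 3 / c = 0 \<or> x ^ 3 / c = - 4"
    "(P \<boxplus> P) \<boxplus> P = Affine x' y' \<Longrightarrow> x' ^ 3 / c = sqrt_neg3_map (sqrt_neg3_map (x ^ 3 / c))"
    unfolding X by blast+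
qed

lemma (in group) cyclic_carrier_iso:
  fixes n :: nat
  assumes g: "g \<in> carrier G" and n: "n > 0" "g [^] n = \<one>" "\<And>k::nat. 0 < k \<Longrightarrow> k < n \<Longrightarrow> g [^] k \<noteq> \<one>"
    and S: "S = range (\<lambda>k::nat. g [^] k)"
  shows "G\<lparr>carrier := S\<rparr> \<cong> integer_mod_group n"
proof -
  have pow_mod: "g [^] (k mod n) = g [^] k" for k :: nat
  proof -
    have "g [^] k = g [^] (n * (k div n) + k mod n)" by simp
    also have "\<dots> = (g [^] n) [^] (k div n) \<otimes> g [^] (k mod n)"
      using g by (simp only: nat_pow_mult[symmetric] nat_pow_pow)
    finally show ?thesis using g n(2) by simp
  qed
  have inj: "i = j" if "i < n" "j < n" "g [^] i = g [^] j" "i \<le> j" for i j :: nat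
  proof (rule ccontr)
    assume "i \<noteq> j"
    have "g [^] i \<otimes> g [^] (j - i) = g [^] (i + (j - i))" by (rule nat_pow_mult[OF g])
    also have "\<dots> = g [^] i \<otimes> \<one>" using that g by simp
    finally have "g [^] i \<otimes> g [^] (j - i) = g [^] i \<otimes> \<one>" .
    then have "g [^] (j - i) = \<one>" using g by (subst (asm) l_cancel) auto
    then show False using n(3)[of "j - i"] that \<open>i \<noteq> j\<close> by auto
  qed
  define h where "h k = g [^] nat k" for k :: int
  have "h \<in> iso (integer_mod_group n) (G\<lparr>carrier := S\<rparr>)"
  proof (rule isoI)
    show "h \<in> hom (integer_mod_group n) (G\<lparr>carrier := S\<rparr>)"
    proof (rule homI)
      fix a b assume "a \<in> carrier (integer_mod_group n)" "b \<in> carrier (integer_mod_group n)"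
      then have ab: "a \<ge> 0" "b \<ge> 0" using n by (auto simp: carrier_integer_mod_group)
      have "nat ((a + b) mod int n) = (nat a + nat b) mod n"
        using ab by (simp add: nat_mod_distrib nat_add_distrib)
      then have "g [^] nat ((a + b) mod int n) = g [^] (nat a + nat b)" using pow_mod by simp
      then show "h (a \<otimes>\<^bsub>integer_mod_group n\<^esub> b) = h a \<otimes>\<^bsub>G\<lparr>carrier := S\<rparr>\<^esub> h b"
        using g by (simp add: h_def nat_pow_mult)
    qed (auto simp: h_def S)
    show "bij_betw h (carrier (integer_mod_group n)) (carrier (G\<lparr>carrier := S\<rparr>))"
      unfolding bij_betw_def
    proof
      show "inj_on h (carrier (integer_mod_group n))"
      proof (rule inj_onI)
        fix a b assume "a \<in> carrier (integer_mod_group n)" "b \<in> carrier (integer_mod_group n)" and e: "h a = h b"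
        then have ab: "a \<ge> 0" "b \<ge> 0" "nat a < n" "nat b < n" using n by (auto simp: carrier_integer_mod_group)
        have "nat a = nat b"
          using inj[of "nat a" "nat b"] inj[of "nat b" "nat a"] ab e by (cases "nat a \<le> nat b") (auto simp: h_def)
        then show "a = b" using ab by simp
      qed
      show "h ` carrier (integer_mod_group n) = carrier (G\<lparr>carrier := S\<rparr>)"
      proof
        show "h ` carrier (integer_mod_group n) \<subseteq> carrier (G\<lparr>carrier := S\<rparr>)" by (auto simp: h_def S)
        show "carrier (G\<lparr>carrier := S\<rparr>) \<subseteq> h ` carrier (integer_mod_group n)"
        proof
          fix x assume "x \<in> carrier (G\<lparr>carrier := S\<rparr>)"
          then obtain k :: nat where "x = g [^] k" by (auto simp: S)
          then have "x = h (int (k mod n))" using pow_mod by (simp add: h_def)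
          moreover have "int (k mod n) \<in> carrier (integer_mod_group n)"
            using n by (simp add: carrier_integer_mod_group)
          ultimately show "x \<in> h ` carrier (integer_mod_group n)" by blast
        qed
      qed
    qed
  qed
  then have "integer_mod_group n \<cong> G\<lparr>carrier := S\<rparr>" by (auto simp: is_iso_def)
  then show ?thesis by (rule group.iso_sym[OF group_integer_mod_group])
qed

text \<open>Pigeonhole on the powers of 3 modulo \<open>m\<close>, then cancellation of the smaller
  power. It serves to find \<open>j\<close> with \<open>3 ^ j P = P\<close>.\<close>

lemma three_power_congruent_one:
  fixes m :: nat
  assumes "m > 0" "\<not> 3 dvd m"
  shows "\<exists>j>0. m dvd 3 ^ j - 1"
proof -
  have "\<not> inj (\<lambda>k::nat. 3 ^ k mod m)"
  proof
    assume "inj (\<lambda>k::nat. 3 ^ k mod m)"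
    moreover have "range (\<lambda>k::nat. 3 ^ k mod m) \<subseteq> {..<m}" using assms by auto
    ultimately show False by (meson finite_imageD finite_lessThan finite_subset infinite_UNIV_nat)
  qed
  then obtain a b :: nat where ab: "a \<noteq> b" "3 ^ a mod m = 3 ^ b mod m" by (auto simp: inj_def)
  have main: ?thesis if "i < j" "3 ^ i mod m = 3 ^ j mod m" for i j :: nat
  proof -
    have "m dvd 3 ^ j - 3 ^ i" using that by (metis less_imp_le mod_eq_dvd_iff_nat one_le_numeral power_increasing)
    also have "(3 ^ j - 3 ^ i :: nat) = 3 ^ i * (3 ^ (j - i) - 1)"
      using that by (simp add: algebra_simps power_add[symmetric])
    finally have "m dvd 3 ^ i * (3 ^ (j - i) - 1)" .
    moreover have "coprime m (3 ^ i)"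
    proof -
      have "coprime 3 m" using assms(2) by (intro prime_imp_coprime) auto
      then show ?thesis by (simp add: coprime_commute)
    qed
    ultimately have "m dvd 3 ^ (j - i) - 1" by (simp add: coprime_dvd_mult_right_iff)
    then show ?thesis using that by (intro exI[of _ "j - i"]) auto
  qed
  show ?thesis using main[of a b] main[of b a] ab by (cases a b rule: linorder_cases) auto
qed

section \<open>The exponent of the torsion subgroup\<close>

locale mordell_cubic = cubic_field +
  fixes c :: complex
  assumes c_Rats: "c \<in> \<rat>" and c_nz: "c \<noteq> 0"
begin

abbreviation EK :: "complex point set" where
  "EK \<equiv> carrier (E c)"

sublocale G: comm_group "E c"
  by (rule comm_group_E[OF c_nz])

abbreviation f :: "complex \<Rightarrow> complex" where
  "f \<equiv> sqrt_neg3_map"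

abbreviation power (infixr \<open>[^^]\<close> 75) where
  "P [^^] (n :: nat) \<equiv> P [^]\<^bsub>E c\<^esub> n"

text \<open>The coordinate \<open>X\<close>. Its value 0 at \<open>Infinity\<close> is a dummy that
  also occurs at affine points, so the tripling lemmas assume
  \<open>P \<noteq> Infinity\<close>.\<close>

fun abscissa_cubed :: "complex point \<Rightarrow> complex" where
  "abscissa_cubed Infinity = 0"
| "abscissa_cubed (Affine x y) = x ^ 3 / c"

lemma pow_2: "P \<in> EK \<Longrightarrow> P [^^] 2 = P \<boxplus> P"
  by (simp add: numeral_2_eq_2)

lemma pow_3: "P \<in> EK \<Longrightarrow> P [^^] 3 = (P \<boxplus> P) \<boxplus> P"
  by (simp add: numeral_3_eq_3)

lemma pow_Infinity [simp]: "Infinity [^^] n = Infinity"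
  using G.nat_pow_one[of n] by simp

lemma c_mem: "c \<in> K"
  using c_Rats by (rule Rats_mem)

lemma abscissa_cubed_mem: "P \<in> EK \<Longrightarrow> abscissa_cubed P \<in> K"
  by (cases P) (auto simp: Affine_in_E intro: mem_intros c_mem)

lemma pow_closed: "P \<in> EK \<Longrightarrow> P [^^] n \<in> EK"
  by (rule G.nat_pow_closed)

lemma cubed_eq_Infinity:
  assumes "P \<in> EK" "P \<noteq> Infinity"
  shows "P [^^] 3 = Infinity \<longleftrightarrow> abscissa_cubed P = 0 \<or> abscissa_cubed P = - 4"
  using assms triple_point(1)[OF c_nz] by (cases P) (auto simp: pow_3 Affine_in_E)

lemma abscissa_cubed_triple:
  assumes "P \<in> EK" "P \<noteq> Infinity" "P [^^] 3 \<noteq> Infinity"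
  shows "abscissa_cubed (P [^^] 3) = f (f (abscissa_cubed P))"
proof (cases P)
  case (Affine x y)
  obtain x' y' where "P [^^] 3 = Affine x' y'" using assms(3) by (cases "P [^^] 3") auto
  then show ?thesis
    using triple_point(2)[OF c_nz, of y x x' y'] assms Affine by (auto simp: pow_3 Affine_in_E)
qed (use assms in simp)

lemma f_eq_0_iff: "a \<noteq> 0 \<Longrightarrow> f a = 0 \<longleftrightarrow> a = - 4"
  by (auto simp: sqrt_neg3_map_def add_eq_0_iff2)

lemma no_level_four: "a \<in> K \<Longrightarrow> f (f a) = - 4 \<Longrightarrow> False"
proof -
  assume a: "a \<in> K" "f (f a) = - 4"
  obtain v where "valued_subfield K v" using exists_valuation by blast
  then show False using valued_subfield.no_level_four a by blast
qed

lemma f_mem: "a \<in> K \<Longrightarrow> f a \<in> K"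
  by (auto simp: sqrt_neg3_map_def intro!: mem_intros)

text \<open>Some \<open>j > 0\<close> has \<open>3 ^ j P = P\<close>, so \<open>X\<close> is
  periodic under \<open>f\<close> with period \<open>2 * j\<close>, and
  \<open>periodic_point\<close> leaves only \<open>X = - 1\<close>.\<close>

lemma prime_to_three_torsion:
  assumes P: "P \<in> EK" and m: "m > 0" "\<not> 3 dvd m" "P [^^] m = Infinity"
  shows "P [^^] 2 = Infinity"
proof (cases "P = Infinity")
  case True
  then show ?thesis using G.nat_pow_one[of 2] by simp
next
  case False
  obtain v where "valued_subfield K v" using exists_valuation by blast
  then interpret V: valued_subfield K v .
  have nInf: "P [^^] (3 ^ k) \<noteq> Infinity" for k
  proof
    assume "P [^^] (3 ^ k) = Infinity"
    then have "G.ord P dvd 3 ^ k" "G.ord P dvd m" using G.pow_eq_id[OF P] m by auto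
    moreover have "coprime (3 ^ k) m" using m(2) by (simp add: prime_imp_coprime)
    ultimately have "G.ord P = 1" by (metis coprime_common_divisor_nat)
    then have "P [^^] 1 = Infinity" using G.pow_ord_eq_1[OF P] by simp
    then show False using False P by simp
  qed
  define a where "a k = abscissa_cubed (P [^^] (3 ^ k))" for k
  have pw: "(P [^^] (3 ^ k)) [^^] 3 = P [^^] (3 ^ Suc k)" for k
    using P by (simp add: G.nat_pow_pow mult.commute)
  have aS: "a (Suc k) = f (f (a k))" for k
    using abscissa_cubed_triple[OF pow_closed[OF P] nInf, of k] nInf[of "Suc k"] unfolding a_def pw by simp
  have a0: "a k \<noteq> 0" "a k \<noteq> - 4" for k
    using cubed_eq_Infinity[OF pow_closed[OF P] nInf, of k] nInf[of "Suc k"] unfolding a_def pw by auto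
  have it: "(f ^^ (2 * k)) (a 0) = a k" for k
    by (induction k) (auto simp: aS)
  \<comment> \<open>Even iterates are the coordinates of the multiples \<open>3 ^ k P\<close>; an
    odd one vanishes only after the value -4, and no such multiple is killed by 3.\<close>
  have nz: "(f ^^ i) (a 0) \<noteq> 0" for i
  proof (cases "even i")
    case True
    then show ?thesis using it a0 by (auto elim!: evenE)
  next
    case False
    then obtain k where "i = Suc (2 * k)" by (auto elim!: oddE)
    then show ?thesis using it[of k] a0[of k] f_eq_0_iff[of "a k"] by simp
  qed
  obtain j where j: "j > 0" "m dvd 3 ^ j - 1" using three_power_congruent_one m by blast
  then obtain q where "3 ^ j - 1 = m * q" by (auto elim: dvdE)
  then have "P [^^] (3 ^ j - 1) = (P [^^] m) [^^] q" using P by (simp only: G.nat_pow_pow)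
  then have "P [^^] (3 ^ j - 1) = Infinity" using m(3) by simp
  then have "P [^^] (3 ^ j - 1) \<boxplus> P = P" by simp
  then have "P [^^] Suc (3 ^ j - 1) = P" by (simp only: G.nat_pow_Suc mult_E)
  moreover have "Suc (3 ^ j - 1) = 3 ^ j" by simp
  ultimately have "P [^^] (3 ^ j) = P" by (simp only:)
  then have "a j = a 0" using P by (simp add: a_def)
  moreover have "V.twist_square (a 0)"
  proof (cases P)
    case (Affine x y)
    have y: "y ^ 2 = c * (a 0 + 1)" using P Affine c_nz by (simp add: a_def Affine_in_E distrib_left)
    have yK: "y \<in> K" using P Affine by (simp add: Affine_in_E)
    show ?thesis unfolding V.twist_square_def by (intro bexI[OF _ yK] bexI[OF _ c_Rats] conjI c_nz y)
  qed (use False in simp)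
  ultimately have "a 0 = - 1"
    using V.periodic_point[of "a 0" "2 * j"] it[of j] j nz abscissa_cubed_mem[OF P] P by (auto simp: a_def)
  then show ?thesis
  proof (cases P)
    case (Affine x y)
    then have "x ^ 3 = - c" using \<open>a 0 = - 1\<close> P c_nz by (simp add: a_def divide_eq_eq)
    then have "y = 0" using P Affine by (simp add: Affine_in_E)
    then show ?thesis using P Affine by (simp add: pow_2 add_opposite)
  qed (use False in simp)
qed

text \<open>The coordinate of \<open>3 P\<close> is 0 or -4 and equals \<open>f (f X)\<close>;
  \<open>no_level_four\<close> excludes -4, and \<open>f\<close> reaches 0 only from -4.\<close>

lemma nine_torsion:
  assumes P: "P \<in> EK" "P [^^] 9 = Infinity" "P [^^] 3 \<noteq> Infinity"
  shows "abscissa_cubed P \<noteq> 0" "f (abscissa_cubed P) = - 4" "abscissa_cubed (P [^^] 3) = 0"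
proof -
  have P0: "P \<noteq> Infinity" using P(3) G.nat_pow_one[of 3] by auto
  have "(P [^^] 3) [^^] 3 = Infinity" using P by (simp add: G.nat_pow_pow)
  then have 1: "abscissa_cubed (P [^^] 3) = 0 \<or> abscissa_cubed (P [^^] 3) = - 4"
    using cubed_eq_Infinity[OF pow_closed[OF P(1)] P(3)] by simp
  have 2: "abscissa_cubed (P [^^] 3) = f (f (abscissa_cubed P))"
    by (rule abscissa_cubed_triple[OF P(1) P0 P(3)])
  have nz: "abscissa_cubed P \<noteq> 0" "abscissa_cubed P \<noteq> - 4" using cubed_eq_Infinity[OF P(1) P0] P(3) by auto
  show "abscissa_cubed P \<noteq> 0" by fact
  show 3: "abscissa_cubed (P [^^] 3) = 0" using 1 2 no_level_four abscissa_cubed_mem[OF P(1)] by metis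
  show "f (abscissa_cubed P) = - 4" using 2 3 f_eq_0_iff nz by metis
qed

text \<open>Otherwise \<open>nine_torsion\<close> at \<open>3 P\<close> gives
  \<open>f (f (f X)) = - 4\<close>, which \<open>no_level_four\<close> forbids at
  \<open>f X\<close>.\<close>

lemma no_27_torsion:
  assumes P: "P \<in> EK" "P [^^] 27 = Infinity"
  shows "P [^^] 9 = Infinity"
proof (rule ccontr)
  assume n: "P [^^] 9 \<noteq> Infinity"
  have e: "(P [^^] 3) [^^] 3 = P [^^] 9" "(P [^^] 3) [^^] 9 = P [^^] 27"
    using P(1) by (simp_all add: G.nat_pow_pow)
  have 3: "f (abscissa_cubed (P [^^] 3)) = - 4"
    using nine_torsion[of "P [^^] 3"] pow_closed[OF P(1)] P n e by simp
  have n3: "P [^^] 3 \<noteq> Infinity" using n e(1) G.nat_pow_one[of 3] by auto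
  then have n1: "P \<noteq> Infinity" using G.nat_pow_one[of 3] by auto
  have "abscissa_cubed (P [^^] 3) = f (f (abscissa_cubed P))"
    by (rule abscissa_cubed_triple[OF P(1) n1 n3])
  then show False using 3 no_level_four[OF f_mem[OF abscissa_cubed_mem[OF P(1)]]] by simp
qed

lemma three_power_torsion:
  assumes P: "P \<in> EK" "P [^^] (3 ^ k) = Infinity"
  shows "P [^^] 9 = Infinity"
  using P
proof (induction k arbitrary: P)
  case 0
  then show ?case using G.nat_pow_one[of 9] by simp
next
  case (Suc k)
  have "(P [^^] 3) [^^] (3 ^ k) = Infinity" using Suc.prems by (simp add: G.nat_pow_pow)
  then have "(P [^^] 3) [^^] 9 = Infinity" using Suc.IH pow_closed Suc.prems by blast
  then have "P [^^] 27 = Infinity" using Suc.prems by (simp add: G.nat_pow_pow)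
  then show ?case using no_27_torsion Suc.prems by blast
qed

lemma torsion_18:
  assumes P: "P \<in> EK" and n: "n > 0" "P [^^] n = Infinity"
  shows "P [^^] 18 = Infinity"
proof -
  obtain m where m: "n = 3 ^ multiplicity 3 n * m" "\<not> 3 dvd m"
    by (rule multiplicity_decompose'[of n "3 :: nat"]) (use n in auto)
  define k where "k = multiplicity 3 n"
  have m0: "m > 0" using n m by (cases m) auto
  have "(P [^^] (3 ^ k)) [^^] m = Infinity" using n m P by (simp add: G.nat_pow_pow k_def)
  then have "(P [^^] (3 ^ k)) [^^] 2 = Infinity"
    by (rule prime_to_three_torsion[OF pow_closed[OF P] m0 m(2)])
  then have "(P [^^] 2) [^^] (3 ^ k) = Infinity" using P by (simp add: G.nat_pow_pow mult.commute)
  then have "(P [^^] 2) [^^] 9 = Infinity" by (rule three_power_torsion[OF pow_closed[OF P]])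
  then show ?thesis using P by (simp add: G.nat_pow_pow)
qed

lemma level_three:
  assumes x: "x \<in> K" "x \<noteq> 0" and fx: "f (x ^ 3 / c) = - 4"
  obtains r z where "r \<in> K" "r ^ 3 - 3 * r ^ 2 + 1 = 0" "z \<in> \<rat>" "c = 16 * z ^ 3"
proof -
  define a where "a = x ^ 3 / c"
  define w where "w = (a + 4) / 3"
  \<comment> \<open>The hypothesis becomes \<open>w ^ 3 = 4 * a ^ 2\<close>, a cuspidal cubic
    parametrised by \<open>w = 4 * r ^ 2\<close>, \<open>a = 4 * r ^ 3\<close>; this recovers the
    parameter, and \<open>a = 3 * w - 4\<close> is then the cubic for \<open>r\<close>.\<close>
  define r where "r = w ^ 2 / (4 * a)"
  have a0: "a \<noteq> 0" using x c_nz by (simp add: a_def)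
  have aK: "a \<in> K" using x c_mem by (auto simp: a_def intro: mem_intros)
  then have wK: "w \<in> K" by (auto simp: w_def intro: mem_intros)
  then have rK: "r \<in> K" using aK by (auto simp: r_def intro: mem_intros)
  have aw: "a = 3 * w - 4" by (simp add: w_def)
  have "(a + 4) ^ 3 = 108 * a ^ 2" using fx a0 unfolding a_def[symmetric] by (simp add: sqrt_neg3_map_def divide_eq_eq)
  then have "27 * w ^ 3 = 27 * (4 * a ^ 2)" unfolding aw by Groebner_Basis.algebra
  then have w3: "w ^ 3 = 4 * a ^ 2" by simp
  have w0: "w \<noteq> 0" using w3 a0 by auto
  have r4: "r * (4 * a) = w ^ 2" using a0 by (simp add: r_def)
  have "(4 * a) ^ 3 * (4 * r ^ 3) = (4 * a) ^ 3 * a" using r4 w3 by Groebner_Basis.algebra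
  then have r3: "4 * r ^ 3 = a" using a0 by simp
  have "w ^ 2 * (4 * r ^ 2) = w ^ 2 * w" using r4 w3 r3 by Groebner_Basis.algebra
  then have r2: "4 * r ^ 2 = w" using w0 by simp
  have "4 * (r ^ 3 - 3 * r ^ 2 + 1) = 0" using aw r2 r3 by Groebner_Basis.algebra
  then have r: "r ^ 3 - 3 * r ^ 2 + 1 = 0"
    by (simp only: mult_eq_0_iff zero_neq_numeral[symmetric] simp_thms)
  have r0: "r \<noteq> 0" using r by auto
  \<comment> \<open>Since \<open>x ^ 3 = c * a = 4 * c * r ^ 3\<close>, this is a cube root of
    \<open>c / 16\<close>.\<close>
  define z where "z = x / (4 * r)"
  have zK: "z \<in> K" using x rK by (auto simp: z_def intro: mem_intros)
  have xz: "x = z * (4 * r)" using r0 by (simp add: z_def)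
  have "x ^ 3 = c * a" using c_nz by (simp add: a_def)
  then have "(4 * r ^ 3) * (16 * z ^ 3) = (4 * r ^ 3) * c" using xz r3 by Groebner_Basis.algebra
  then have c16: "c = 16 * z ^ 3" using r0 by simp
  then have "z ^ 3 = c / 16" by simp
  moreover have "c / 16 \<in> \<rat>" using c_Rats by simp
  ultimately have "z ^ 3 \<in> \<rat>" by metis
  then have "z \<in> \<rat>" using no_pure_cubic[OF zK _ rK r] by blast
  then show thesis using that rK r c16 by blast
qed

end

section \<open>The torsion group from its points of order 2, 3 and 9\<close>

context mordell_cubic
begin

abbreviation T :: "complex point monoid" where
  "T \<equiv> torsion_subgroup (E c)"

lemma carrier_T: "carrier T = {P \<in> EK. P [^^] 18 = Infinity}"
proof -
  have "P [^^] 18 = Infinity" if "P \<in> EK" "n > 0" "P [^^] n = Infinity" for P n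
    using torsion_18 that by blast
  then show ?thesis by (auto simp: torsion_subgroup_def intro: exI[of _ 18])
qed

lemma T_iso_cyclic:
  assumes g: "g \<in> EK" "n > 0" "g [^^] n = Infinity" "n dvd 18"
    and ne: "\<And>k. 0 < k \<Longrightarrow> k < n \<Longrightarrow> g [^^] k \<noteq> Infinity"
    and gen: "\<And>P. P \<in> EK \<Longrightarrow> P [^^] 18 = Infinity \<Longrightarrow> \<exists>k. P = g [^^] k"
  shows "T \<cong> integer_mod_group n"
proof -
  have g18: "g [^^] 18 = Infinity"
  proof -
    obtain q where "18 = n * q" using g(4) by (metis dvdE)
    then have "g [^^] 18 = (g [^^] n) [^^] q" using g(1) by (simp only: G.nat_pow_pow)
    then show ?thesis using g(3) by simp
  qed
  have "carrier T = range (\<lambda>k::nat. g [^^] k)"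
  proof
    show "carrier T \<subseteq> range (\<lambda>k::nat. g [^^] k)" using gen by (auto simp: carrier_T)
    have "(g [^^] k) [^^] 18 = Infinity" for k
    proof -
      have "(g [^^] k) [^^] 18 = (g [^^] 18) [^^] k" using g(1) by (simp add: G.nat_pow_pow mult.commute)
      then show ?thesis using g18 by simp
    qed
    then show "range (\<lambda>k::nat. g [^^] k) \<subseteq> carrier T" using pow_closed[OF g(1)] by (auto simp: carrier_T)
  qed
  then have "(E c)\<lparr>carrier := carrier T\<rparr> \<cong> integer_mod_group n"
    using g ne by (intro G.cyclic_carrier_iso[of g n]) auto
  then show ?thesis by (simp add: torsion_subgroup_def)
qed

lemma T_iso_trivial:
  assumes "\<And>P. P \<in> EK \<Longrightarrow> P [^^] 18 = Infinity \<Longrightarrow> P = Infinity"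
  shows "T \<cong> singleton_group (Infinity :: complex point)"
proof -
  have "carrier T = {Infinity}" using assms Infinity_in_E by (auto simp: carrier_T)
  moreover have "monoid.mult T = (\<boxplus>)" by (simp add: torsion_subgroup_def)
  ultimately have "(\<lambda>x. x) \<in> iso T (singleton_group Infinity)"
    by (auto simp: iso_def hom_def singleton_group_def bij_betw_def)
  then show ?thesis by (auto simp: is_iso_def)
qed

lemma two_torsion_unique:
  assumes "P \<in> EK" "P [^^] 2 = Infinity" "P \<noteq> Infinity"
    and "Q \<in> EK" "Q [^^] 2 = Infinity" "Q \<noteq> Infinity"
  shows "P = Q"
proof -
  have *: "\<exists>x. P = Affine x 0 \<and> x \<in> K \<and> x ^ 3 = - c"
    if P: "P \<in> EK" "P [^^] 2 = Infinity" "P \<noteq> Infinity" for P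
  proof (cases P)
    case (Affine x y)
    have "P = point_neg P" using add_eq_Infinity[of P c P] P c_nz by (simp add: pow_2 carrier_E)
    then have "y = 0" using Affine by simp
    then show ?thesis using P Affine by (auto simp: Affine_in_E eq_neg_iff_add_eq_0)
  qed (use P in simp)
  obtain x x' where "P = Affine x 0" "x \<in> K" "x ^ 3 = - c" "Q = Affine x' 0" "x' \<in> K" "x' ^ 3 = - c"
    using *[OF assms(1-3)] *[OF assms(4-6)] by blast
  then show ?thesis using cube_root_unique[of x x'] by simp
qed

text \<open>Cube roots in \<open>K\<close> being unique, each factor of the division polynomial
  gives at most one abscissa; if both gave points, the quotient of the ordinates would be a square
  root of -3.\<close>

lemma three_torsion_unique:
  assumes P: "P \<in> EK" "P [^^] 3 = Infinity" "P \<noteq> Infinity"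
    and Q: "Q \<in> EK" "Q [^^] 3 = Infinity" "Q \<noteq> Infinity"
  shows "Q = P \<or> Q = P [^^] 2"
proof -
  obtain x y x' y' where xy: "P = Affine x y" "Q = Affine x' y'" using P Q by (cases P; cases Q) auto
  have K: "x \<in> K" "y \<in> K" "y ^ 2 = x ^ 3 + c" "x' \<in> K" "y' \<in> K" "y' ^ 2 = x' ^ 3 + c"
    using P Q xy by (auto simp: Affine_in_E)
  have d: "x = 0 \<or> x ^ 3 = - 4 * c" "x' = 0 \<or> x' ^ 3 = - 4 * c"
    using cubed_eq_Infinity[OF P(1,3)] cubed_eq_Infinity[OF Q(1,3)] P Q xy c_nz by (auto simp: divide_eq_eq)
  have mixed: False if y: "y \<in> K" "y' \<in> K" "y ^ 2 = c" "y' ^ 2 = - 3 * c" for y y'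
  proof -
    have y0: "y \<noteq> 0" using y c_nz by auto
    have sq: "(y' / y) ^ 2 = - 3" using y c_nz by (simp add: power_divide)
    have "y' / y \<in> \<rat>" by (rule square_Rats) (use y sq in \<open>auto intro: mem_intros\<close>)
    \<comment> \<open>For \<open>u ^ 2 = - 3\<close>, \<open>(u - 1) / 2\<close> is a primitive cube
      root of unity.\<close>
    then have t: "(y' / y - 1) / 2 \<in> \<rat>" by simp
    have "4 * (((u - 1) / 2) ^ 2 + (u - 1) / 2 + 1) = u ^ 2 + 3" for u :: complex
      by (simp add: power2_eq_square field_simps)
    from this[of "y' / y"] have "((y' / y - 1) / 2) ^ 2 + (y' / y - 1) / 2 + 1 = 0" unfolding sq by (simp only: add.left_inverse mult_eq_0_iff zero_neq_numeral[symmetric] simp_thms)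
    then show False using Rats_no_cube_root_of_unity(1)[OF t] by blast
  qed
  have "x = x'"
  proof (cases "x = 0"; cases "x' = 0")
    assume "x = 0" "x' \<noteq> 0"
    then show ?thesis using mixed[of y y'] K d by auto
  next
    assume "x \<noteq> 0" "x' = 0"
    then show ?thesis using mixed[of y' y] K d by auto
  next
    assume "x \<noteq> 0" "x' \<noteq> 0"
    then show ?thesis using cube_root_unique[of x x'] K d by auto
  qed simp
  then have "Q = P \<or> Q = point_neg P"
    using same_abscissa[of x y c y'] K xy by auto
  moreover have "point_neg P = P [^^] 2"
    using add_eq_Infinity[of "P \<boxplus> P" c P] P c_nz by (simp add: pow_2 pow_3 carrier_E)
  ultimately show ?thesis by auto
qed

lemma ex_two_torsion_iff:
  "(\<exists>P\<in>EK. P [^^] 2 = Infinity \<and> P \<noteq> Infinity) \<longleftrightarrow> cube_in K c"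
proof
  assume "\<exists>P\<in>EK. P [^^] 2 = Infinity \<and> P \<noteq> Infinity"
  then obtain P where P: "P \<in> EK" "P [^^] 2 = Infinity" "P \<noteq> Infinity" by blast
  obtain x y where xy: "P = Affine x y" using P by (cases P) auto
  have "P = point_neg P" using add_eq_Infinity[of P c P] P c_nz by (simp add: pow_2 carrier_E)
  then have "y = 0" using xy by simp
  then have "x \<in> K" "c = (- x) ^ 3" using P xy by (auto simp: Affine_in_E add_eq_0_iff)
  then show "cube_in K c" unfolding cube_in_def using uminus_mem by blast
next
  assume "cube_in K c"
  then obtain x where x: "x \<in> K" "c = x ^ 3" by (auto simp: cube_in_def)
  then have "Affine (- x) 0 \<in> EK" by (auto simp: Affine_in_E intro: mem_intros)
  then show "\<exists>P\<in>EK. P [^^] 2 = Infinity \<and> P \<noteq> Infinity"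
    by (intro bexI[of _ "Affine (- x) 0"]) (auto simp: pow_2 add_opposite)
qed

text \<open>The alternatives are the factors of the division polynomial: \<open>x = 0\<close> with
  \<open>y ^ 2 = c\<close>, and \<open>x ^ 3 = - 4 * c\<close> with
  \<open>y ^ 2 = - 3 * c\<close>.\<close>

lemma ex_three_torsion_iff:
  "(\<exists>P\<in>EK. P [^^] 3 = Infinity \<and> P \<noteq> Infinity)
    \<longleftrightarrow> square_in K c \<or> cube_in K (4 * c) \<and> square_in K (- 3 * c)"
proof
  assume "\<exists>P\<in>EK. P [^^] 3 = Infinity \<and> P \<noteq> Infinity"
  then obtain P where P: "P \<in> EK" "P [^^] 3 = Infinity" "P \<noteq> Infinity" by blast
  obtain x y where xy: "P = Affine x y" using P by (cases P) auto
  have K: "x \<in> K" "y \<in> K" "y ^ 2 = x ^ 3 + c" using P xy by (auto simp: Affine_in_E)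
  have "x = 0 \<or> x ^ 3 = - 4 * c"
    using cubed_eq_Infinity[OF P(1,3)] P xy c_nz by (auto simp: divide_eq_eq)
  then show "square_in K c \<or> cube_in K (4 * c) \<and> square_in K (- 3 * c)"
  proof
    assume "x = 0"
    then have "c = y ^ 2" using K by simp
    then show ?thesis using K by (auto simp: square_in_def)
  next
    assume "x ^ 3 = - 4 * c"
    then have "4 * c = (- x) ^ 3" "- 3 * c = y ^ 2" using K by simp_all
    then show ?thesis unfolding square_in_def cube_in_def using K uminus_mem by blast
  qed
next
  have *: "\<exists>P\<in>EK. P [^^] 3 = Infinity \<and> P \<noteq> Infinity"
    if "x \<in> K" "y \<in> K" "y ^ 2 = x ^ 3 + c" "x = 0 \<or> x ^ 3 = - 4 * c" for x y
  proof -
    have "Affine x y \<in> EK" using that by (simp add: Affine_in_E)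
    then show ?thesis using cubed_eq_Infinity[of "Affine x y"] that c_nz
      by (intro bexI[of _ "Affine x y"]) (auto simp: divide_eq_eq)
  qed
  assume "square_in K c \<or> cube_in K (4 * c) \<and> square_in K (- 3 * c)"
  then show "\<exists>P\<in>EK. P [^^] 3 = Infinity \<and> P \<noteq> Infinity"
  proof
    assume "square_in K c"
    then show ?thesis using *[of 0] zero_mem by (auto simp: square_in_def)
  next
    assume "cube_in K (4 * c) \<and> square_in K (- 3 * c)"
    then obtain x y where xy: "x \<in> K" "y \<in> K" "4 * c = x ^ 3" "- 3 * c = y ^ 2"
      by (auto simp: cube_in_def square_in_def)
    then have "y ^ 2 = (- x) ^ 3 + c" "(- x) ^ 3 = - 4 * c" by (simp_all flip: xy(3,4))
    then show ?thesis using *[of "- x" y] xy uminus_mem by blast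
  qed
qed

lemma pow_mult_eq: "P \<in> EK \<Longrightarrow> (P [^^] a) [^^] b = P [^^] (a * b)"
  by (rule G.nat_pow_pow)

lemma nine_kills:
  assumes "\<not> cube_in K c" "P \<in> EK" "P [^^] 18 = Infinity"
  shows "P [^^] 9 = Infinity"
proof -
  have "(P [^^] 9) [^^] 2 = Infinity" using assms by (simp add: pow_mult_eq)
  then show ?thesis using ex_two_torsion_iff assms pow_closed by blast
qed

lemma T_trivial:
  assumes "\<not> cube_in K c" "\<not> (square_in K c \<or> cube_in K (4 * c) \<and> square_in K (- 3 * c))"
  shows "T \<cong> singleton_group (Infinity :: complex point)"
proof (rule T_iso_trivial)
  fix P assume P: "P \<in> EK" "P [^^] 18 = Infinity"
  have 9: "P [^^] 9 = Infinity" using nine_kills[OF assms(1) P] .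
  have "(P [^^] 3) [^^] 3 = Infinity" using P 9 by (simp add: pow_mult_eq)
  then have "P [^^] 3 = Infinity" using ex_three_torsion_iff assms(2) pow_closed[OF P(1)] by blast
  then show "P = Infinity" using ex_three_torsion_iff assms(2) P by blast
qed

lemma T_two:
  assumes "cube_in K c" "\<not> (square_in K c \<or> cube_in K (4 * c) \<and> square_in K (- 3 * c))"
  shows "T \<cong> integer_mod_group 2"
proof -
  obtain A where A: "A \<in> EK" "A [^^] 2 = Infinity" "A \<noteq> Infinity"
    using ex_two_torsion_iff assms by blast
  show ?thesis
  proof (rule T_iso_cyclic[OF A(1)])
    show "A [^^] k \<noteq> Infinity" if "0 < k" "k < 2" for k
    proof -
      have "k = 1" using that by simp
      then show ?thesis using A by simp
    qed
    fix P assume P: "P \<in> EK" "P [^^] 18 = Infinity"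
    have "((P [^^] 2) [^^] 3) [^^] 3 = Infinity" using P by (simp add: pow_mult_eq pow_closed)
    then have "(P [^^] 2) [^^] 3 = Infinity"
      using ex_three_torsion_iff assms(2) pow_closed P(1) by blast
    then have "P [^^] 2 = Infinity" using ex_three_torsion_iff assms(2) pow_closed P(1) by blast
    then have "P = Infinity \<or> P = A" using two_torsion_unique P A by blast
    then have "P = A [^^] 0 \<or> P = A [^^] 1" using A(1) by simp
    then show "\<exists>k. P = A [^^] k" by blast
  qed (use A in auto)
qed

lemma T_three:
  assumes "\<not> cube_in K c" "square_in K c \<or> cube_in K (4 * c) \<and> square_in K (- 3 * c)"
    and no9: "\<And>P. P \<in> EK \<Longrightarrow> P [^^] 9 = Infinity \<Longrightarrow> P [^^] 3 = Infinity"
  shows "T \<cong> integer_mod_group 3"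
proof -
  obtain B where B: "B \<in> EK" "B [^^] 3 = Infinity" "B \<noteq> Infinity"
    using ex_three_torsion_iff assms by blast
  show ?thesis
  proof (rule T_iso_cyclic[OF B(1)])
    show "B [^^] k \<noteq> Infinity" if k3: "0 < k" "k < 3" for k
    proof
      assume k: "B [^^] k = Infinity"
      consider "k = 1" | "k = 2" using k3 by linarith
      then show False
      proof cases
        case 2
        have "B [^^] 3 = B [^^] 2 \<boxplus> B" by (simp add: numeral_3_eq_3 numeral_2_eq_2)
        then show ?thesis using B k 2 by simp
      qed (use B k in simp)
    qed
    fix P assume P: "P \<in> EK" "P [^^] 18 = Infinity"
    have 9: "P [^^] 9 = Infinity" using nine_kills[OF assms(1) P] .
    then have "P [^^] 3 = Infinity" using no9 P by blast
    then have "P = Infinity \<or> P = B \<or> P = B [^^] 2" using three_torsion_unique P B by blast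
    then have "P = B [^^] 0 \<or> P = B [^^] 1 \<or> P = B [^^] 2" using B(1) by simp
    then show "\<exists>k. P = B [^^] k" by blast
  qed (use B in auto)
qed

lemma T_six:
  assumes "cube_in K c" "square_in K c \<or> cube_in K (4 * c) \<and> square_in K (- 3 * c)"
    and no9: "\<And>P. P \<in> EK \<Longrightarrow> P [^^] 9 = Infinity \<Longrightarrow> P [^^] 3 = Infinity"
  shows "T \<cong> integer_mod_group 6"
proof -
  obtain A where A: "A \<in> EK" "A [^^] 2 = Infinity" "A \<noteq> Infinity"
    using ex_two_torsion_iff assms by blast
  obtain B where B: "B \<in> EK" "B [^^] 3 = Infinity" "B \<noteq> Infinity"
    using ex_three_torsion_iff assms by blast
  define g where "g = A \<boxplus> B"
  have gE: "g \<in> EK" using G.m_closed[OF A(1) B(1)] by (simp add: g_def)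
  have gk: "g [^^] k = A [^^] k \<boxplus> B [^^] k" for k
    using G.nat_pow_distrib[OF A(1) B(1), of k] by (simp add: g_def)
  have Ak: "A [^^] (i + 2 * j) = A [^^] i" for i j
    using G.nat_pow_mult[OF A(1), of i "2 * j"] G.nat_pow_pow[OF A(1), of 2 j] A(2) by simp
  have Bk: "B [^^] (i + 3 * j) = B [^^] i" for i j
    using G.nat_pow_mult[OF B(1), of i "3 * j"] G.nat_pow_pow[OF B(1), of 3 j] B(2) by simp
  \<comment> \<open>Chinese remaindering: 3 is 1 modulo 2 and 0 modulo 3, while 4 is 0 modulo 2 and
    1 modulo 3.\<close>
  have AB: "A [^^] i \<boxplus> B [^^] j = g [^^] (3 * i + 4 * j)" for i j
  proof -
    have "A [^^] (3 * i + 4 * j) = A [^^] i" using Ak[of i "i + 2 * j"] by (simp add: algebra_simps)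
    moreover have "B [^^] (3 * i + 4 * j) = B [^^] j" using Bk[of j "i + j"] by (simp add: algebra_simps)
    ultimately show ?thesis using gk by simp
  qed
  have g3: "g [^^] 3 = A" using AB[of 1 0] A(1) by simp
  have g4: "g [^^] 4 = B" using AB[of 0 1] B(1) by simp
  have g6: "g [^^] 6 = Infinity" using g3 A(2) gE pow_mult_eq[OF gE, of 3 2] by simp
  show ?thesis
  proof (rule T_iso_cyclic[OF gE])
    show "g [^^] k \<noteq> Infinity" if k: "0 < k" "k < 6" for k
    proof
      assume 0: "g [^^] k = Infinity"
      have k3: "A [^^] k = Infinity" using 0 g3 pow_mult_eq[OF gE, of 3 k] pow_mult_eq[OF gE, of k 3] by (simp add: mult.commute)
      have k4: "B [^^] k = Infinity" using 0 g4 pow_mult_eq[OF gE, of 4 k] pow_mult_eq[OF gE, of k 4] by (simp add: mult.commute)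
      have "A [^^] (k mod 2) = Infinity" using Ak[of "k mod 2" "k div 2"] k3 by simp
      then have "even k" using A by (cases "even k") (auto simp: odd_iff_mod_2_eq_one)
      then consider "k = 2" | "k = 4" using k by fastforce
      then show False
      proof cases
        case 1
        have "B [^^] 3 = B [^^] 2 \<boxplus> B" by (simp add: numeral_3_eq_3 numeral_2_eq_2)
        then show ?thesis using B k4 1 by simp
      next
        case 2
        then show ?thesis using Bk[of 1 1] B k4 by simp
      qed
    qed
    fix P assume P: "P \<in> EK" "P [^^] 18 = Infinity"
    have "(P [^^] 2) [^^] 9 = Infinity" using P by (simp add: pow_mult_eq)
    then have 6: "(P [^^] 2) [^^] 3 = Infinity" using no9 pow_closed P by blast
    then have P2: "P [^^] 2 = Infinity \<or> P [^^] 2 = B \<or> P [^^] 2 = B [^^] 2"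
      using three_torsion_unique[OF B pow_closed[OF P(1)]] by blast
    then obtain j where j: "P [^^] 2 = B [^^] j" using B(1) by (metis G.nat_pow_0 G.nat_pow_eone one_E)
    have "(P [^^] 3) [^^] 2 = Infinity" using 6 P by (simp add: pow_mult_eq)
    then have "P [^^] 3 = Infinity \<or> P [^^] 3 = A" using two_torsion_unique pow_closed P A by blast
    then obtain i where i: "P [^^] 3 = A [^^] i" using A(1) by (metis G.nat_pow_0 G.nat_pow_eone one_E)
    have "(P [^^] 2) [^^] 2 = B [^^] (j * 2)" using j B(1) by (simp add: pow_mult_eq)
    then have "P [^^] 4 = B [^^] (2 * j)" using P by (simp add: pow_mult_eq mult.commute)
    \<comment> \<open>As 6 kills \<open>P\<close>, the decomposition
      \<open>P = 7 P = 3 P + 4 P\<close> splits off the 2-part and the 3-part.\<close>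
    have "P [^^] 7 = P [^^] 6 \<boxplus> P" by (simp add: eval_nat_numeral)
    then have "P = P [^^] 7" using 6 P by (simp add: pow_mult_eq)
    also have "\<dots> = P [^^] 3 \<boxplus> P [^^] 4" using G.nat_pow_mult[OF P(1), of 3 4] by simp
    also have "\<dots> = g [^^] (3 * i + 4 * (2 * j))" using AB i \<open>P [^^] 4 = B [^^] (2 * j)\<close> by simp
    finally show "\<exists>k. P = g [^^] k" by blast
  qed (use g6 in auto)
qed

lemma T_nine:
  assumes "\<not> cube_in K c" and g: "g \<in> EK" "g [^^] 9 = Infinity" "g [^^] 3 \<noteq> Infinity"
  shows "T \<cong> integer_mod_group 9"
proof -
  have g3: "g [^^] 3 \<in> EK" "(g [^^] 3) [^^] 3 = Infinity"
    using g pow_closed by (simp_all add: pow_mult_eq)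
  have three: "\<exists>k. P = g [^^] (3 * k)" if P: "P \<in> EK" "P [^^] 3 = Infinity" for P
  proof -
    have "P = Infinity \<or> P = g [^^] 3 \<or> P = (g [^^] 3) [^^] 2"
      using three_torsion_unique[OF g3 g(3) P] by blast
    then have "P = g [^^] (3 * 0) \<or> P = g [^^] (3 * 1) \<or> P = g [^^] (3 * 2)"
      using g(1) by (simp add: pow_mult_eq)
    then show ?thesis by blast
  qed
  show ?thesis
  proof (rule T_iso_cyclic[OF g(1)])
    show "g [^^] k \<noteq> Infinity" if k: "0 < k" "k < 9" for k
    proof
      assume "g [^^] k = Infinity"
      then have "G.ord g dvd k" "G.ord g dvd 9" using G.pow_eq_id[OF g(1)] g(2) by auto
      then have "G.ord g dvd 3 ^ 2" by simp
      then obtain i where i: "i \<le> 2" "G.ord g = 3 ^ i"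
        using divides_primepow_nat[of 3 "G.ord g" 2] by auto
      have "i \<noteq> 2" using i \<open>G.ord g dvd k\<close> k by (auto dest: dvd_imp_le)
      then have "i \<le> 1" using i by simp
      then have "G.ord g dvd 3" using i le_imp_power_dvd[of i 1 3] by simp
      then show False using G.pow_eq_id[OF g(1), of 3] g(3) by simp
    qed
    fix P assume P: "P \<in> EK" "P [^^] 18 = Infinity"
    have 9: "P [^^] 9 = Infinity" using nine_kills[OF assms(1) P] .
    then have "(P [^^] 3) [^^] 3 = Infinity" using P by (simp add: pow_mult_eq)
    then obtain j where j: "P [^^] 3 = g [^^] (3 * j)" using three pow_closed P(1) by blast
    \<comment> \<open>\<open>8 * j\<close> stands for \<open>- j\<close> modulo 9: \<open>Q\<close>
      is \<open>P - j g\<close> and is killed by 3.\<close>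
    define Q where "Q = P \<boxplus> g [^^] (8 * j)"
    have QE: "Q \<in> EK" using G.m_closed[OF P(1) pow_closed[OF g(1)]] by (simp add: Q_def)
    have g27: "g [^^] (9 * n) = Infinity" for n using pow_mult_eq[OF g(1), of 9 n] g(2) by simp
    have "Q [^^] 3 = P [^^] 3 \<boxplus> (g [^^] (8 * j)) [^^] 3"
      using G.nat_pow_distrib[OF P(1) pow_closed[OF g(1)], of "8 * j" 3] by (simp add: Q_def)
    also have "\<dots> = g [^^] (3 * j) \<boxplus> g [^^] (24 * j)" using j g(1) by (simp add: pow_mult_eq)
    also have "\<dots> = g [^^] (27 * j)" using G.nat_pow_mult[OF g(1), of "3 * j" "24 * j"] by simp
    also have "\<dots> = Infinity" using g27[of "3 * j"] by simp
    finally obtain i where i: "Q = g [^^] (3 * i)" using three QE by blast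
    have "P = P \<boxplus> g [^^] (9 * j)" using g27 by simp
    also have "g [^^] (9 * j) = g [^^] (8 * j) \<boxplus> g [^^] j"
      using G.nat_pow_mult[OF g(1), of "8 * j" j] by simp
    also have "P \<boxplus> (g [^^] (8 * j) \<boxplus> g [^^] j) = Q \<boxplus> g [^^] j"
      using G.m_assoc[OF P(1) pow_closed[OF g(1)] pow_closed[OF g(1)], of "8 * j" j] by (simp add: Q_def)
    also have "\<dots> = g [^^] (3 * i + j)" using i G.nat_pow_mult[OF g(1), of "3 * i" j] by simp
    finally show "\<exists>k. P = g [^^] k" by blast
  qed (use g in auto)
qed

text \<open>Adds to \<open>level_three\<close> that \<open>3 P\<close> has abscissa 0, so that its
  ordinate is a square root of \<open>c\<close>.\<close>

lemma nine_torsion_imp: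
  assumes P: "P \<in> EK" "P [^^] 9 = Infinity" "P [^^] 3 \<noteq> Infinity"
  obtains r z where "r \<in> K" "r ^ 3 - 3 * r ^ 2 + 1 = 0" "z \<in> \<rat>" "c = 16 * z ^ 3" "square_in K c"
proof -
  have n1: "P \<noteq> Infinity" using P(3) by auto
  then obtain x y where xy: "P = Affine x y" by (cases P) auto
  obtain x' y' where xy': "P [^^] 3 = Affine x' y'" using P(3) by (cases "P [^^] 3") auto
  have "x \<in> K" using P xy by (simp add: Affine_in_E)
  moreover have "x \<noteq> 0" "f (x ^ 3 / c) = - 4" using nine_torsion[OF P] xy by auto
  ultimately obtain r z where rz: "r \<in> K" "r ^ 3 - 3 * r ^ 2 + 1 = 0" "z \<in> \<rat>" "c = 16 * z ^ 3"
    by (rule level_three)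
  have "x' = 0" using nine_torsion(3)[OF P] xy' c_nz by simp
  moreover have "Affine x' y' \<in> EK" using pow_closed[OF P(1), of 3] xy' by simp
  ultimately have "y' \<in> K" "c = y' ^ 2" by (auto simp: Affine_in_E)
  then have "square_in K c" by (auto simp: square_in_def)
  then show thesis using that rz by blast
qed

end

text \<open>The abscissa is \<open>x = z * (4 * r)\<close> from \<open>level_three\<close> with
  \<open>z = 1\<close>; the ordinate comes from
  \<open>4 * r ^ 3 + 1 = (2 * r ^ 2 - 2 * r - 1) ^ 2\<close>, valid modulo the cubic.\<close>

lemma (in mordell_cubic) nine_torsion_exists:
  assumes r: "r \<in> K" "r ^ 3 - 3 * r ^ 2 + 1 = 0" and c16: "c = 16"
  defines "g \<equiv> Affine (4 * r) (4 * (2 * r ^ 2 - 2 * r - 1))"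
  shows "g \<in> EK" "g [^^] 9 = Infinity" "g [^^] 3 \<noteq> Infinity"
proof -
  have "(4 * (2 * r ^ 2 - 2 * r - 1)) ^ 2 = (4 * r) ^ 3 + 16" using r(2) by Groebner_Basis.algebra
  then show gE: "g \<in> EK"
    using r(1) by (auto simp: g_def Affine_in_E c16 intro!: mem_intros)
  have g1: "g \<noteq> Infinity" by (simp add: g_def)
  have "(4 * r) ^ 3 / c = 4 * r ^ 3" by (simp add: c16 power_mult_distrib)
  then have a: "abscissa_cubed g = 4 * r ^ 3" unfolding g_def abscissa_cubed.simps .
  have r0: "r \<noteq> 0" using r by auto
  have rQ: "r \<notin> \<rat>" using Rats_not_cubic_root r(2) by blast
  have r3: "r ^ 3 \<noteq> - 1"
  proof
    assume "r ^ 3 = - 1"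
    then have "r ^ 3 = (- 1) ^ 3" by simp
    then have "r = - 1" by (rule cube_root_unique[OF r(1) uminus_mem[OF one_mem]])
    then show False using rQ by simp
  qed
  show n3: "g [^^] 3 \<noteq> Infinity"
    using cubed_eq_Infinity[OF gE g1] r0 r3 unfolding a by (auto simp: add_eq_0_iff2)
  have "(4 * r ^ 3 + 4) ^ 3 = 108 * (4 * r ^ 3) ^ 2" using r(2) by Groebner_Basis.algebra
  then have fa: "f (4 * r ^ 3) = - 4" using r0 by (simp add: sqrt_neg3_map_def divide_eq_eq)
  have "abscissa_cubed (g [^^] 3) = f (- 4)"
    using abscissa_cubed_triple[OF gE g1 n3] unfolding a fa .
  then have "abscissa_cubed (g [^^] 3) = 0" by (simp add: sqrt_neg3_map_def)
  then have "(g [^^] 3) [^^] 3 = Infinity"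
    using cubed_eq_Infinity[OF pow_closed[OF gE] n3] by simp
  then show "g [^^] 9 = Infinity" using gE by (simp add: pow_mult_eq)
qed

section \<open>The field generated by a root of \<open>r\<^sup>3 - 3 r\<^sup>2 + 1\<close>\<close>

lemma adjoin_rat_subfield: "complex_subfield (adjoin_rat r)"
proof -
  interpret R: Ring.field complex_ring by (rule field_from_type_algebra)
  show ?thesis unfolding adjoin_rat_def
    by (rule subfield_complex_subfield, rule R.generate_field_is_subfield) (simp add: complex_ring_simps)
qed

lemma adjoin_rat_mem: "r \<in> adjoin_rat r"
  unfolding adjoin_rat_def by (rule generate_field.incl) simp

lemma adjoin_rat_minimal:
  assumes "complex_subfield L" "r \<in> L"
  shows "adjoin_rat r \<subseteq> L"
proof -
  interpret R: Ring.field complex_ring by (rule field_from_type_algebra)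
  show ?thesis unfolding adjoin_rat_def
    by (rule R.generate_field_min_subfield1[OF _ complex_subfield_subfield[OF assms(1)]])
      (use assms in \<open>auto simp: complex_ring_simps\<close>)
qed

lemma (in cubic_field) adjoin_rat_eq:
  assumes "r \<in> K" "r \<notin> \<rat>"
  shows "adjoin_rat r = K"
proof
  show "adjoin_rat r \<subseteq> K" by (rule adjoin_rat_minimal[OF _ assms(1)]) (rule complex_subfield_axioms)
  show "K \<subseteq> adjoin_rat r"
  proof
    fix x assume "x \<in> K"
    then obtain a b d where x: "a \<in> \<rat>" "b \<in> \<rat>" "d \<in> \<rat>" "x = a + b * r + d * r ^ 2"
      using power_basis_spans[OF assms] by blast
    interpret A: complex_subfield "adjoin_rat r" by (rule adjoin_rat_subfield)
    have "a \<in> adjoin_rat r" "b \<in> adjoin_rat r" "d \<in> adjoin_rat r" using x A.Rats_mem by auto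
    then show "x \<in> adjoin_rat r" unfolding x(4) using adjoin_rat_mem by (intro A.mem_intros)
  qed
qed

text \<open>Proved for a bare root, outside \<open>cubic_field\<close>, since it is needed to show
  that \<open>adjoin_rat r\<close> has degree 3.\<close>

lemma cubic_root_independent:
  fixes r :: complex
  assumes r: "r ^ 3 - 3 * r ^ 2 + 1 = 0" and a: "a \<in> \<rat>" "b \<in> \<rat>" "d \<in> \<rat>" "a + b * r + d * r ^ 2 = 0"
  shows "d = 0" "b = 0"
proof -
  have rQ: "r \<notin> \<rat>" using Rats_not_cubic_root r by blast
  have lin: "q = 0" if "p \<in> \<rat>" "q \<in> \<rat>" "p + q * r = 0" for p q
    using Rats_linear_relation_imp_Rats that rQ by blast
  show d: "d = 0"
  proof (rule ccontr)
    assume d: "d \<noteq> 0"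
    define p q where "p = - a / d" and "q = - b / d"
    have pq: "p \<in> \<rat>" "q \<in> \<rat>" using a by (simp_all add: p_def q_def)
    have "d * p = - a" "d * q = - b" using d by (simp_all add: p_def q_def)
    then have "d * r ^ 2 = d * (p + q * r)" using a(4) by Groebner_Basis.algebra
    then have r2: "r ^ 2 = p + q * r" using d by simp
    have e: "(q * p - 3 * p + 1) + (p + q ^ 2 - 3 * q) * r = 0" using r r2 by Groebner_Basis.algebra
    have "p + q ^ 2 - 3 * q = 0" by (rule lin[OF _ _ e]) (use pq in auto)
    moreover from this have "q * p - 3 * p + 1 = 0" using e by simp
    \<comment> \<open>The cubic would be divisible by \<open>t ^ 2 - q * t - p\<close>; its roots
      sum to 3, so the remaining one is \<open>3 - q\<close>.\<close>
    ultimately have "(3 - q) ^ 3 - 3 * (3 - q) ^ 2 + 1 = 0" by Groebner_Basis.algebra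
    moreover have "3 - q \<in> \<rat>" using pq by simp
    ultimately show False using Rats_not_cubic_root by blast
  qed
  show "b = 0" by (rule lin[of a b]) (use a d in auto)
qed

lemma adjoin_rat_cubic_root:
  fixes r :: complex
  assumes r: "r ^ 3 - 3 * r ^ 2 + 1 = 0"
  shows "adjoin_rat r = {a + b * r + d * r ^ 2 | a b d. a \<in> \<rat> \<and> b \<in> \<rat> \<and> d \<in> \<rat>}" (is "_ = ?S")
proof
  have I: "x \<in> ?S" if "x = a + b * r + d * r ^ 2" "a \<in> \<rat>" "b \<in> \<rat>" "d \<in> \<rat>" for x a b d using that by blast
  have mult: "(a + b * r + d * r ^ 2) * (a' + b' * r + d' * r ^ 2)
      = (a * a' - (b * d' + d * b') - 3 * (d * d')) + (a * b' + b * a' - d * d') * r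
        + (a * d' + b * b' + d * a' + 3 * (b * d' + d * b') + 9 * (d * d')) * r ^ 2" for a b d a' b' d'
    using r by Groebner_Basis.algebra
  have "complex_subfield ?S"
  proof
    show "1 \<in> ?S" by (rule I[of _ 1 0 0]) auto
    fix x assume "x \<in> ?S"
    then obtain a b d where x: "x = a + b * r + d * r ^ 2" "a \<in> \<rat>" "b \<in> \<rat>" "d \<in> \<rat>" by blast
    show "- x \<in> ?S" by (rule I[of _ "- a" "- b" "- d"]) (use x in auto)
    show "inverse x \<in> ?S"
    proof (cases "x = 0")
      case True
      show ?thesis by (rule I[of _ 0 0 0]) (use True in auto)
    next
      case False
      \<comment> \<open>The product of \<open>x\<close> and \<open>x'\<close> shall have no
        \<open>r\<close> and no \<open>r ^ 2\<close> part: two linear equations in \<open>A\<close>,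
        \<open>B\<close>, \<open>D\<close>, solved by the cross product of their coefficient
        rows.\<close>
      define A B D where "A = a * (a + 3 * b + 9 * d) + d * (b + 3 * d)"
        and "B = - d * d - b * (a + 3 * b + 9 * d)" and "D = b * (b + 3 * d) - a * d"
      have ABD: "A \<in> \<rat>" "B \<in> \<rat>" "D \<in> \<rat>" using x by (simp_all add: A_def B_def D_def)
      define x' N where "x' = A + B * r + D * r ^ 2" and "N = a * A - (b * D + d * B) - 3 * (d * D)"
      have NQ: "N \<in> \<rat>" using x ABD by (simp add: N_def)
      have "a * B + b * A - d * D = 0" "a * D + b * B + d * A + 3 * (b * D + d * B) + 9 * (d * D) = 0"
        unfolding A_def B_def D_def by Groebner_Basis.algebra+
      then have xN: "x * x' = N" unfolding x(1) x'_def mult N_def by simp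
      have "x' \<noteq> 0"
      proof
        assume x'0: "x' = 0"
        then have "D = 0" "B = 0" using cubic_root_independent[OF r ABD] by (auto simp: x'_def)
        then have ABD0: "A = 0" "B = 0" "D = 0" using x'0 by (auto simp: x'_def)
        show False
        proof (cases "d = 0")
          case True
          then have "b = 0" using ABD0 by (simp add: D_def)
          then have "a = 0" using ABD0 True by (simp add: A_def)
          then show ?thesis using False \<open>b = 0\<close> True x by simp
        next
          case d: False
          have "d * (b ^ 3 + 6 * b ^ 2 * d + 9 * b * d ^ 2 + d ^ 3) = 0"
            using ABD0 unfolding A_def B_def D_def by Groebner_Basis.algebra
          then have e: "b ^ 3 + 6 * b ^ 2 * d + 9 * b * d ^ 2 + d ^ 3 = 0" using d by simp
          \<comment> \<open>The shift by 3 turns the eliminated form in \<open>b / d\<close> into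
            the original cubic, now with a rational root.\<close>
          define s where "s = b / d + 3"
          have "b = d * (s - 3)" using d by (simp add: s_def)
          then have "d ^ 3 * (s ^ 3 - 3 * s ^ 2 + 1) = 0" using e by Groebner_Basis.algebra
          then have "s ^ 3 - 3 * s ^ 2 + 1 = 0" using d by simp
          moreover have "s \<in> \<rat>" using x by (simp add: s_def)
          ultimately show ?thesis using Rats_not_cubic_root by blast
        qed
      qed
      then have N0: "N \<noteq> 0" using xN False by auto
      have "inverse x = x' / N" using xN N0 False by (simp add: field_simps)
      also have "\<dots> = A / N + (B / N) * r + (D / N) * r ^ 2" by (simp add: x'_def add_divide_distrib)
      finally show ?thesis by (rule I) (use ABD NQ in auto)
    qed
    fix y assume "y \<in> ?S"
    then obtain a' b' d' where y: "y = a' + b' * r + d' * r ^ 2" "a' \<in> \<rat>" "b' \<in> \<rat>" "d' \<in> \<rat>" by blast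
    show "x + y \<in> ?S"
      by (rule I[of _ "a + a'" "b + b'" "d + d'"]) (use x y in \<open>auto simp: algebra_simps\<close>)
    have "x * y = (a * a' - (b * d' + d * b') - 3 * (d * d')) + (a * b' + b * a' - d * d') * r
        + (a * d' + b * b' + d * a' + 3 * (b * d' + d * b') + 9 * (d * d')) * r ^ 2"
      unfolding x(1) y(1) by (rule mult)
    then show "x * y \<in> ?S" by (rule I) (use x y in auto)
  qed
  moreover have "r \<in> ?S" by (rule I[of _ 0 1 0]) auto
  ultimately show "adjoin_rat r \<subseteq> ?S" by (rule adjoin_rat_minimal)
  interpret A: complex_subfield "adjoin_rat r" by (rule adjoin_rat_subfield)
  show "?S \<subseteq> adjoin_rat r"
  proof
    fix x assume "x \<in> ?S"
    then obtain a b d where x: "x = a + b * r + d * r ^ 2" "a \<in> \<rat>" "b \<in> \<rat>" "d \<in> \<rat>" by blast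
    have "a \<in> adjoin_rat r" "b \<in> adjoin_rat r" "d \<in> adjoin_rat r" using x A.Rats_mem by auto
    then show "x \<in> adjoin_rat r" unfolding x(1) using adjoin_rat_mem by (intro A.mem_intros)
  qed
qed

lemma number_field_adjoin_rat:
  fixes r :: complex
  assumes r: "r ^ 3 - 3 * r ^ 2 + 1 = 0"
  shows "number_field_of_degree 3 (adjoin_rat r)"
proof -
  interpret R: Ring.field complex_ring by (rule field_from_type_algebra)
  note simps = complex_ring_simps
  have rQ: "r \<notin> \<rat>" using Rats_not_cubic_root r by blast
  have le: "x \<in> R.line_extension \<rat> u V \<longleftrightarrow> (\<exists>k\<in>\<rat>. \<exists>w\<in>V. x = k * u + w)" for x u V
    using R.line_extension_mem_iff[of x \<rat> u V] by (simp add: simps)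
  have sp0: "R.Span \<rat> [] = {0}" by (simp add: simps)
  have sp1: "x \<in> R.Span \<rat> [1] \<longleftrightarrow> x \<in> \<rat>" for x by (simp add: le simps)
  have sp2: "x \<in> R.Span \<rat> [r, 1] \<longleftrightarrow> (\<exists>a\<in>\<rat>. \<exists>b\<in>\<rat>. x = b * r + a)" for x
  proof -
    have "x \<in> R.Span \<rat> [r, 1] \<longleftrightarrow> (\<exists>k\<in>\<rat>. \<exists>w\<in>R.Span \<rat> [1]. x = k * r + w)"
      using le[of x r "R.Span \<rat> [1]"] by simp
    then show ?thesis unfolding Bex_def sp1 by blast
  qed
  have sp3: "x \<in> R.Span \<rat> [r ^ 2, r, 1] \<longleftrightarrow> (\<exists>a\<in>\<rat>. \<exists>b\<in>\<rat>. \<exists>d\<in>\<rat>. x = d * r ^ 2 + (b * r + a))" for x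
  proof -
    have "x \<in> R.Span \<rat> [r ^ 2, r, 1] \<longleftrightarrow> (\<exists>k\<in>\<rat>. \<exists>w\<in>R.Span \<rat> [r, 1]. x = k * r ^ 2 + w)"
      using le[of x "r ^ 2" "R.Span \<rat> [r, 1]"] by simp
    then show ?thesis unfolding Bex_def sp2 by blast
  qed
  have "R.independent \<rat> [1]" using sp0 by (intro R.li_Cons R.li_Nil) (auto simp: simps)
  then have "R.independent \<rat> [r, 1]" using sp1[of r] rQ by (intro R.li_Cons) (simp_all add: simps)
  moreover have "r ^ 2 \<notin> R.Span \<rat> [r, 1]"
  proof
    assume "r ^ 2 \<in> R.Span \<rat> [r, 1]"
    then obtain a b where ab: "a \<in> \<rat>" "b \<in> \<rat>" "r ^ 2 = b * r + a" using sp2 by blast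
    then have "a + b * r + (- 1) * r ^ 2 = 0" by simp
    then have "- 1 = (0 :: complex)" by (rule cubic_root_independent(1)[OF r ab(1,2), rotated]) simp
    then show False by simp
  qed
  ultimately have ind: "R.independent \<rat> [r ^ 2, r, 1]"
    using R.li_Cons[of "r ^ 2" \<rat> "[r, 1]"] by (simp add: simps del: R.Span.simps)
  have "R.Span \<rat> [r ^ 2, r, 1] = adjoin_rat r"
    unfolding adjoin_rat_cubic_root[OF r] set_eq_iff sp3 by (auto simp: algebra_simps)
  then have "R.dimension (length [r ^ 2, r, 1]) \<rat> (adjoin_rat r)"
    by (rule R.dimensionI[OF subfield_Rats ind])
  then show ?thesis
    using complex_subfield_subfield[OF adjoin_rat_subfield] by (simp add: number_field_of_degree_def numeral_3_eq_3)
qed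

lemma exists_cubic_root: "\<exists>r :: complex. r ^ 3 - 3 * r ^ 2 + 1 = 0"
proof -
  have "\<exists>x\<ge>0. x \<le> 1 \<and> (x :: real) ^ 3 - 3 * x ^ 2 + 1 = 0"
    by (rule IVT2') (auto intro!: continuous_intros)
  then obtain x :: real where "x ^ 3 - 3 * x ^ 2 + 1 = 0" by blast
  then have "complex_of_real (x ^ 3 - 3 * x ^ 2 + 1) = 0" by simp
  then show ?thesis by (intro exI[of _ "of_real x"]) simp
qed

section \<open>Rational squares, cubes and sixth powers\<close>

lemma rational_root_of_int:
  fixes z :: complex
  assumes z: "z \<in> \<rat>" "z ^ n = of_int m" and n: "n > 0"
  shows "\<exists>k. z = of_int k"
proof -
  obtain a b :: int where ab: "b > 0" "coprime a b" "z = of_int a / of_int b"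
    using z(1) by (rule Rats_cases')
  have "of_int a ^ n = (of_int m * of_int b ^ n :: complex)"
    using z(2) ab by (simp add: power_divide divide_eq_eq)
  then have "(of_int (a ^ n) :: complex) = of_int (m * b ^ n)" by simp
  then have "a ^ n = m * b ^ n" by (simp only: of_int_eq_iff)
  then have "b ^ n dvd a ^ n" by simp
  then have "b dvd a" using n by simp
  then have "is_unit b" using ab(2) by (meson coprime_common_divisor dvd_refl)
  then have "b = 1" using ab(1) by simp
  then show ?thesis using ab by auto
qed

text \<open>Parameters differing by a sixth power give isomorphic curves; this singles out one
  representative.\<close>

lemma sixth_power_free_unique:
  fixes z :: complex
  assumes "sixth_power_free c" "sixth_power_free m" "c \<noteq> 0" "z \<in> \<rat>" "of_int c = of_int m * z ^ 6"
  shows "c = m"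
proof -
  obtain a b :: int where ab: "b > 0" "coprime a b" "z = of_int a / of_int b"
    using assms(4) by (rule Rats_cases')
  have "of_int c * of_int b ^ 6 = (of_int m * of_int a ^ 6 :: complex)"
    using assms(5) ab by (simp add: power_divide eq_divide_eq)
  then have "(of_int (c * b ^ 6) :: complex) = of_int (m * a ^ 6)" by simp
  then have e: "c * b ^ 6 = m * a ^ 6" by (simp only: of_int_eq_iff)
  have cop: "coprime (a ^ 6) (b ^ 6)" using ab(2) by simp
  have "b ^ 6 dvd m * a ^ 6" using e by (metis dvd_triv_right)
  then have "b ^ 6 dvd m" using cop by (simp add: coprime_dvd_mult_left_iff coprime_commute)
  then have "is_unit b" using assms(2) by (simp add: sixth_power_free_def)
  then have b: "b = 1" using ab(1) by simp
  have "a ^ 6 dvd c" using e b by simp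
  then have "is_unit a" using assms(1) by (simp add: sixth_power_free_def)
  then have "\<bar>a\<bar> = 1" by simp
  then have "a ^ 6 = 1" by (metis even_numeral power_even_abs power_one)
  then show ?thesis using e b by simp
qed

text \<open>Below 729 = 3 ^ 6 the only sixth power other than 1 that could divide is 64 = 2 ^
  6.\<close>

lemma sixth_power_free_small:
  assumes "m \<noteq> 0" "\<bar>m\<bar> < 729" "\<not> 64 dvd m"
  shows "sixth_power_free m"
  unfolding sixth_power_free_def
proof (intro allI impI)
  fix n assume n: "n ^ 6 dvd m"
  have n0: "n \<noteq> 0" using n assms(1) by auto
  have "\<bar>n ^ 6\<bar> \<le> \<bar>m\<bar>" by (rule dvd_imp_le_int[OF assms(1) n])
  then have "\<bar>n\<bar> ^ 6 < 3 ^ 6" using assms(2) by (simp add: power_abs)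
  then have "\<bar>n\<bar> < 3" by (rule power_less_imp_less_base) simp
  moreover have "\<bar>n\<bar> \<noteq> 2"
  proof
    assume "\<bar>n\<bar> = 2"
    then have "n = 2 \<or> n = - 2" by linarith
    then have "n ^ 6 = 64" by auto
    then show False using n assms(3) by simp
  qed
  ultimately have "\<bar>n\<bar> = 1" using n0 by linarith
  then show "is_unit n" by simp
qed

lemma no_integer_cube_4_16: "(k :: int) ^ 3 \<noteq> 4" "k ^ 3 \<noteq> 16" "k ^ 3 \<noteq> 2"
proof -
  have "k ^ 3 \<le> 1 ^ 3 \<or> 3 ^ 3 \<le> k ^ 3 \<or> k = 2"
  proof -
    have "k \<le> 1 \<or> 3 \<le> k \<or> k = 2" by linarith
    then show ?thesis using power_mono_odd[of 3 k 1] power_mono_odd[of 3 3 k] by auto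
  qed
  then show "k ^ 3 \<noteq> 4" "k ^ 3 \<noteq> 16" "k ^ 3 \<noteq> 2" by auto
qed

context cubic_field
begin

text \<open>A cubic field has no quadratic subfield, and a rational root of an integer is an
  integer.\<close>

lemma square_in_of_int_iff: "square_in K (of_int m) \<longleftrightarrow> (\<exists>n. m = n ^ 2)"
proof
  assume "square_in K (of_int m)"
  then obtain y where y: "y \<in> K" "of_int m = y ^ 2" by (auto simp: square_in_def)
  have "y ^ 2 \<in> \<rat>" unfolding y(2)[symmetric] by simp
  then have "y \<in> \<rat>" using square_Rats y(1) by blast
  then obtain k where "y = of_int k" using rational_root_of_int[of y 2 m] y by auto
  then have "(of_int m :: complex) = of_int (k ^ 2)" using y by simp
  then have "m = k ^ 2" by (simp only: of_int_eq_iff)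
  then show "\<exists>n. m = n ^ 2" ..
next
  assume "\<exists>n. m = n ^ 2"
  then obtain n where n: "m = n ^ 2" ..
  show "square_in K (of_int m)"
    unfolding square_in_def n by (intro bexI[of _ "of_int n"] of_int_mem) simp
qed

lemma not_square_in_neg: "m < 0 \<Longrightarrow> \<not> square_in K (of_int m)"
  unfolding square_in_of_int_iff by (metis not_less zero_le_power2)

lemma cube_in_of_int_cases:
  assumes "r \<in> K" "r ^ 3 - 3 * r ^ 2 + 1 = 0" "cube_in K (of_int m)"
  shows "\<exists>k. m = k ^ 3"
proof -
  obtain z where z: "z \<in> K" "of_int m = z ^ 3" using assms(3) by (auto simp: cube_in_def)
  have "z ^ 3 \<in> \<rat>" unfolding z(2)[symmetric] by simp
  then have "z \<in> \<rat>" using no_pure_cubic[OF z(1) _ assms(1,2)] by blast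
  then obtain k where "z = of_int k" using rational_root_of_int[of z 3 m] z by auto
  then have "(of_int m :: complex) = of_int (k ^ 3)" using z by simp
  then have "m = k ^ 3" by (simp only: of_int_eq_iff)
  then show ?thesis ..
qed

lemma cube_in_mult: "cube_in K a \<Longrightarrow> cube_in K b \<Longrightarrow> cube_in K (a * b)"
  unfolding cube_in_def by (metis mult_mem power_mult_distrib)

lemma cube_in_divide: "cube_in K a \<Longrightarrow> cube_in K b \<Longrightarrow> cube_in K (a / b)"
  unfolding cube_in_def by (metis divide_mem power_divide)

text \<open>If \<open>c\<close> and \<open>4 * c\<close> are cubes, so is 4, say of
  \<open>z\<close>, and the cube root of \<open>c\<close> is \<open>b\<close>, \<open>b * z\<close>
  or \<open>b * z ^ 2\<close> with rational \<open>b\<close>; hence \<open>c = k * b ^ 3\<close>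
  with \<open>k\<close> = 1, 4 or 16. As \<open>- 3 * c\<close> is a square, \<open>b\<close> is -3
  times a rational square, and \<open>c\<close> is \<open>- 27 * k\<close> up to a sixth
  power.\<close>

lemma sporadic_six:
  assumes c: "c \<noteq> 0" "sixth_power_free c"
    and cub: "cube_in K (of_int c)" "cube_in K (4 * of_int c)" and sq: "square_in K (- 3 * of_int c)"
  shows "cube_in K 4 \<and> (c = - 27 \<or> c = - 108 \<or> c = - 432)"
proof -
  have c0: "(of_int c :: complex) \<noteq> 0" using c by simp
  have c4: "cube_in K 4" using cube_in_divide[OF cub(2,1)] c0 by simp
  then obtain z where z: "z \<in> K" "z ^ 3 = 4" by (auto simp: cube_in_def)
  obtain x where x: "x \<in> K" "of_int c = x ^ 3" using cub(1) by (auto simp: cube_in_def)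
  obtain y where y: "y \<in> K" "- 3 * of_int c = y ^ 2" using sq by (auto simp: square_in_def)
  have zQ: "z \<notin> \<rat>"
  proof
    assume "z \<in> \<rat>"
    then obtain k where k: "z = of_int k" using rational_root_of_int[of z 3 4] z by auto
    then have "(of_int (k ^ 3) :: complex) = of_int 4" using z by simp
    then have "k ^ 3 = 4" by (simp only: of_int_eq_iff)
    then show False using no_integer_cube_4_16 by blast
  qed
  have "y ^ 2 \<in> \<rat>" unfolding y(2)[symmetric] by simp
  then have yQ: "y \<in> \<rat>" using square_Rats y(1) by blast
  have "z ^ 3 \<in> \<rat>" "x ^ 3 \<in> \<rat>" unfolding z(2) x(2)[symmetric] by simp_all
  then obtain b where b: "b \<in> \<rat>" "x = b \<or> x = b * z \<or> x = b * z ^ 2"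
    using pure_cubic_cube_roots[OF z(1) zQ _ x(1)] by blast
  have b0: "b \<noteq> 0" using b x c0 by auto
  \<comment> \<open>With \<open>n ^ 2 = 9 * k\<close>, so \<open>n\<close> = 3, 6 or 12, the number
    \<open>u = y / (n * b)\<close> satisfies \<open>b = - 3 * u ^ 2\<close>, whence
    \<open>c = - 27 * k * u ^ 6\<close>.\<close>
  have fin: "c = m" if m: "sixth_power_free m" "n \<in> \<rat>" "n \<noteq> 0" "- 3 * (y / (n * b)) ^ 2 = b"
      "of_int c = of_int k * b ^ 3" "m = - 27 * k" for m n k
  proof (rule sixth_power_free_unique[OF c(2) m(1) c(1)])
    show "y / (n * b) \<in> \<rat>" using yQ b m by simp
    define u where "u = y / (n * b)"
    have "of_int c = of_int k * (- 3 * u ^ 2) ^ 3" using m(4,5) by (simp add: u_def)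
    also have "\<dots> = of_int m * u ^ 6" unfolding m(6) by (simp add: power_mult_distrib power_mult[symmetric])
    finally show "of_int c = of_int m * (y / (n * b)) ^ 6" by (simp add: u_def)
  qed
  have sqf: "- 3 * (y / (n * b)) ^ 2 = b" if "n \<noteq> 0" "9 * (of_int k) = (n :: complex) ^ 2" "of_int c = of_int k * b ^ 3" for n k
  proof -
    have "(n * b) ^ 2 * (- 3 * (y / (n * b)) ^ 2) = - 3 * y ^ 2" using that(1) b0 by (simp add: power_divide)
    also have "\<dots> = 9 * of_int k * b ^ 3" unfolding y(2)[symmetric] that(3) by simp
    also have "\<dots> = (n * b) ^ 2 * b" unfolding that(2) by (simp add: power_mult_distrib power2_eq_square power3_eq_cube)
    finally show ?thesis
      by (rule mult_left_cancel[THEN iffD1, rotated]) (use that(1) b0 in simp)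
  qed
  from b(2) have "c = - 27 \<or> c = - 108 \<or> c = - 432"
  proof (elim disjE)
    assume "x = b"
    then have e: "of_int c = of_int 1 * b ^ 3" using x by simp
    have "c = - 27" by (rule fin[of _ 3 1, OF _ _ _ sqf[of 3 1, OF _ _ e] e]) (auto intro: sixth_power_free_small)
    then show ?thesis by simp
  next
    assume "x = b * z"
    then have e: "of_int c = of_int 4 * b ^ 3" using x z by (simp add: power_mult_distrib mult.commute)
    have "c = - 108" by (rule fin[of _ 6 4, OF _ _ _ sqf[of 6 4, OF _ _ e] e]) (auto intro: sixth_power_free_small)
    then show ?thesis by simp
  next
    assume "x = b * z ^ 2"
    then have "of_int c = b ^ 3 * (z ^ 3) ^ 2" using x by (simp add: power_mult_distrib power_mult[symmetric] mult.commute)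
    then have e: "of_int c = of_int 16 * b ^ 3" using z by simp
    have "c = - 432" by (rule fin[of _ 12 16, OF _ _ _ sqf[of 12 16, OF _ _ e] e]) (auto intro: sixth_power_free_small)
    then show ?thesis by simp
  qed
  then show ?thesis using c4 by simp
qed

lemma sporadic_six_converse:
  assumes "cube_in K 4" "c = - 27 \<or> c = - 108 \<or> c = - 432"
  shows "cube_in K (of_int c)" "cube_in K (4 * of_int c)" "square_in K (- 3 * of_int c)"
proof -
  have n: "cube_in K (- 27)" unfolding cube_in_def by (intro bexI[of _ "- 3"]) (auto intro!: mem_intros)
  have n4: "cube_in K (- 108)" using cube_in_mult[OF assms(1) n] by simp
  have n16: "cube_in K (- 432)" using cube_in_mult[OF assms(1) n4] by simp
  have n64: "cube_in K (- 1728)" using cube_in_mult[OF assms(1) n16] by simp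
  have "square_in K 81" "square_in K 324" "square_in K 1296"
    using square_in_of_int_iff[of 81] square_in_of_int_iff[of 324] square_in_of_int_iff[of 1296]
    by (auto intro: exI[of _ 9] exI[of _ 18] exI[of _ 36])
  then show "cube_in K (of_int c)" "cube_in K (4 * of_int c)" "square_in K (- 3 * of_int c)"
    using assms(2) n n4 n16 n64 by auto
qed

end

section \<open>The classification\<close>

lemma iso_class_eqI:
  assumes "Group.group G" "G \<cong> H"
  shows "iso_class G = iso_class H"
proof -
  have "H \<cong> G" using group.iso_sym[OF assms] .
  then show ?thesis
    unfolding iso_class_def using iso_trans[OF _ assms(2)] iso_trans[of _ H G] by blast
qed

context mordell_cubic
begin

lemma group_T: "group T"
proof -
  have "subgroup (carrier T) (E c)"
  proof (rule G.subgroupI)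
    show "carrier T \<noteq> {}" using Infinity_in_E by (auto simp: carrier_T)
    fix P assume "P \<in> carrier T"
    then have P: "P \<in> EK" "P [^^] 18 = Infinity" by (auto simp: carrier_T)
    then show "inv\<^bsub>E c\<^esub> P \<in> carrier T"
      using G.nat_pow_inv[OF P(1), of 18] G.inv_one by (simp add: carrier_T)
    fix Q assume "Q \<in> carrier T"
    then have Q: "Q \<in> EK" "Q [^^] 18 = Infinity" by (auto simp: carrier_T)
    then show "P \<otimes>\<^bsub>E c\<^esub> Q \<in> carrier T"
      using P G.nat_pow_distrib[OF P(1) Q(1), of 18] G.m_closed[OF P(1) Q(1)] by (simp add: carrier_T)
  qed (auto simp: carrier_T)
  then have "group ((E c)\<lparr>carrier := carrier T\<rparr>)" by (rule subgroup.subgroup_is_group) (rule G.is_group)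
  then show ?thesis by (simp add: torsion_subgroup_def)
qed

lemma iso_class_T: "T \<cong> H \<Longrightarrow> iso_class T = iso_class H"
  by (rule iso_class_eqI[OF group_T])

text \<open>Serves the inclusion from left to right in \<open>Phi_M_Q_3\<close>, where
  \<open>c\<close> is an arbitrary nonzero rational.\<close>

lemma T_cases:
  "T \<cong> integer_mod_group 9 \<or> T \<cong> integer_mod_group 6 \<or> T \<cong> integer_mod_group 3 \<or> T \<cong> integer_mod_group 2
    \<or> T \<cong> singleton_group (Infinity :: complex point)"
proof (cases "\<exists>P\<in>EK. P [^^] 9 = Infinity \<and> P [^^] 3 \<noteq> Infinity")
  case True
  then obtain P where P: "P \<in> EK" "P [^^] 9 = Infinity" "P [^^] 3 \<noteq> Infinity" by blast
  then obtain r z where rz: "r \<in> K" "r ^ 3 - 3 * r ^ 2 + 1 = 0" "z \<in> \<rat>" "c = 16 * z ^ 3"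
    by (rule nine_torsion_imp)
  \<comment> \<open>A point of order 9 excludes points of order 2: if \<open>c\<close> were a cube,
    so would be 16, in a field that contains \<open>r\<close>.\<close>
  have "\<not> cube_in K c"
  proof
    assume "cube_in K c"
    moreover have "cube_in K (z ^ 3)" using Rats_mem[OF rz(3)] by (auto simp: cube_in_def)
    ultimately have "cube_in K (c / z ^ 3)" by (rule cube_in_divide)
    moreover have "c / z ^ 3 = of_int 16" using rz(4) c_nz by auto
    ultimately have "cube_in K (of_int 16)" by simp
    then show False using cube_in_of_int_cases[OF rz(1,2)] no_integer_cube_4_16 by metis
  qed
  then show ?thesis using T_nine P by blast
next
  case False
  then show ?thesis using T_trivial T_two T_three T_six by blast
qed

lemma iso_class_T_cases:
  "iso_class T \<in> {iso_class (integer_mod_group 9), iso_class (integer_mod_group 6),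
     iso_class (integer_mod_group 3), iso_class (integer_mod_group 2),
     iso_class (singleton_group (Infinity :: complex point))}"
  using T_cases iso_class_T[of "integer_mod_group 9"] iso_class_T[of "integer_mod_group 6"]
    iso_class_T[of "integer_mod_group 3"] iso_class_T[of "integer_mod_group 2"]
    iso_class_T[of "singleton_group (Infinity :: complex point)"] by auto

end

lemma (in cubic_field) is_adjoin_rat_iff:
  "(\<exists>r. r ^ 3 - 3 * r ^ 2 + 1 = 0 \<and> K = adjoin_rat r) \<longleftrightarrow> (\<exists>r\<in>K. r ^ 3 - 3 * r ^ 2 + 1 = 0)"
proof
  assume "\<exists>r. r ^ 3 - 3 * r ^ 2 + 1 = 0 \<and> K = adjoin_rat r"
  then show "\<exists>r\<in>K. r ^ 3 - 3 * r ^ 2 + 1 = 0" using adjoin_rat_mem by blast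
next
  assume "\<exists>r\<in>K. r ^ 3 - 3 * r ^ 2 + 1 = 0"
  then obtain r where r: "r \<in> K" "r ^ 3 - 3 * r ^ 2 + 1 = 0" by blast
  then have "adjoin_rat r = K" using adjoin_rat_eq Rats_not_cubic_root by blast
  then show "\<exists>r. r ^ 3 - 3 * r ^ 2 + 1 = 0 \<and> K = adjoin_rat r" using r by blast
qed

lemma torsion_classification:
  fixes c :: int
  assumes "c \<noteq> 0" "sixth_power_free c" and K: "number_field_of_degree 3 K"
  defines "T \<equiv> torsion_subgroup (mordell_group K (of_int c))"
    and "K_is_Q_r \<equiv> \<exists>r. r ^ 3 - 3 * r ^ 2 + 1 = 0 \<and> K = adjoin_rat r"
    and "hasA \<equiv> cube_in K (of_int c)"
    and "hasB \<equiv> square_in K (of_int c) \<or> cube_in K (4 * of_int c) \<and> square_in K (- 3 * of_int c)"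
  shows "c = 16 \<and> K_is_Q_r \<Longrightarrow> T \<cong> integer_mod_group 9 \<and> \<not> hasA"
    and "\<not> (c = 16 \<and> K_is_Q_r) \<Longrightarrow> hasA \<Longrightarrow> hasB \<Longrightarrow> T \<cong> integer_mod_group 6"
    and "\<not> (c = 16 \<and> K_is_Q_r) \<Longrightarrow> \<not> hasA \<Longrightarrow> hasB \<Longrightarrow> T \<cong> integer_mod_group 3"
    and "hasA \<Longrightarrow> \<not> hasB \<Longrightarrow> T \<cong> integer_mod_group 2"
    and "\<not> hasA \<Longrightarrow> \<not> hasB \<Longrightarrow> T \<cong> singleton_group (Infinity :: complex point)"
proof -
  interpret cubic_field K by (rule number_field_cubic[OF K])
  interpret M: mordell_cubic K "of_int c" by unfold_locales (use assms(1) in auto)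
  \<comment> \<open>Here \<open>c = 16 * z ^ 3\<close> is also an integer square
    \<open>n ^ 2\<close>, so \<open>z\<close> is the square of \<open>u = n / (4 * z)\<close>, and
    \<open>c = 16 * u ^ 6\<close> forces \<open>c = 16\<close>.\<close>
  have no9: "P [^]\<^bsub>mordell_group K (of_int c)\<^esub> (3::nat) = Infinity"
    if n: "\<not> (c = 16 \<and> K_is_Q_r)" and P: "P \<in> carrier (mordell_group K (of_int c))"
      "P [^]\<^bsub>mordell_group K (of_int c)\<^esub> (9::nat) = Infinity" for P
  proof (rule ccontr)
    assume "P [^]\<^bsub>mordell_group K (of_int c)\<^esub> (3::nat) \<noteq> Infinity"
    then obtain r z :: complex where rz: "r \<in> K" "r ^ 3 - 3 * r ^ 2 + 1 = 0" "z \<in> \<rat>" "of_int c = 16 * z ^ 3"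
        "square_in K (of_int c)"
      by (rule M.nine_torsion_imp[OF P])
    obtain n where n2: "c = n ^ 2" using rz(5) square_in_of_int_iff by blast
    have z0: "z \<noteq> 0" using rz(4) assms(1) by auto
    define u :: complex where "u = of_int n / (4 * z)"
    have "(16 * z ^ 2) * u ^ 2 = of_int (n ^ 2)" using z0 by (simp add: u_def power_divide power_mult_distrib)
    also have "\<dots> = (16 * z ^ 2) * z" using rz(4) n2 by (simp add: power2_eq_square power3_eq_cube)
    finally have u: "u ^ 2 = z" using z0 by simp
    have "(of_int c :: complex) = of_int 16 * u ^ 6" unfolding rz(4) u[symmetric] by (simp add: power_mult[symmetric])
    moreover have "u \<in> \<rat>" using rz(3) by (simp add: u_def)
    moreover have "sixth_power_free 16" by (rule sixth_power_free_small) auto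
    ultimately have "c = 16" using sixth_power_free_unique[OF assms(2) _ assms(1)] by blast
    moreover have K_is_Q_r unfolding K_is_Q_r_def is_adjoin_rat_iff using rz by blast
    ultimately show False using n by simp
  qed
  show "c = 16 \<and> K_is_Q_r \<Longrightarrow> T \<cong> integer_mod_group 9 \<and> \<not> hasA"
  proof -
    assume c16: "c = 16 \<and> K_is_Q_r"
    then obtain r where r: "r \<in> K" "r ^ 3 - 3 * r ^ 2 + 1 = 0" unfolding K_is_Q_r_def is_adjoin_rat_iff by blast
    have na: "\<not> hasA"
      using cube_in_of_int_cases[OF r, of c] c16 no_integer_cube_4_16 unfolding hasA_def by metis
    have "(of_int c :: complex) = 16" using c16 by simp
    then show ?thesis
      using M.T_nine[OF na[unfolded hasA_def] M.nine_torsion_exists[OF r]] na unfolding T_def by simp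
  qed
  show "\<not> (c = 16 \<and> K_is_Q_r) \<Longrightarrow> hasA \<Longrightarrow> hasB \<Longrightarrow> T \<cong> integer_mod_group 6"
    unfolding T_def hasA_def hasB_def by (rule M.T_six[OF _ _ no9])
  show "\<not> (c = 16 \<and> K_is_Q_r) \<Longrightarrow> \<not> hasA \<Longrightarrow> hasB \<Longrightarrow> T \<cong> integer_mod_group 3"
    unfolding T_def hasA_def hasB_def by (rule M.T_three[OF _ _ no9])
  show "hasA \<Longrightarrow> \<not> hasB \<Longrightarrow> T \<cong> integer_mod_group 2"
    unfolding T_def hasA_def hasB_def by (rule M.T_two)
  show "\<not> hasA \<Longrightarrow> \<not> hasB \<Longrightarrow> T \<cong> singleton_group (Infinity :: complex point)"
    unfolding T_def hasA_def hasB_def by (rule M.T_trivial)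
qed

lemma iso_class_in_Phi:
  assumes "number_field_of_degree 3 K" "m \<noteq> 0" "torsion_subgroup (mordell_group K (of_int m)) \<cong> H"
  shows "iso_class H \<in> Phi_M_Q 3"
proof -
  interpret cubic_field K by (rule number_field_cubic[OF assms(1)])
  interpret M: mordell_cubic K "of_int m" by unfold_locales (use assms(2) in auto)
  have "iso_class H = iso_class (torsion_subgroup (mordell_group K (of_rat (of_int m))))"
    using M.iso_class_T[OF assms(3)] by simp
  then show ?thesis unfolding Phi_M_Q_def using assms(1,2) by (intro CollectI exI[of _ K] exI[of _ "of_int m"]) simp
qed

lemma Phi_M_Q_3:
  "Phi_M_Q 3 =
      {iso_class (integer_mod_group 9), iso_class (integer_mod_group 6),
       iso_class (integer_mod_group 3), iso_class (integer_mod_group 2),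
       iso_class (singleton_group (Infinity :: complex point))}" (is "_ = ?S")
proof
  show "Phi_M_Q 3 \<subseteq> ?S"
  proof
    fix X' assume "X' \<in> Phi_M_Q 3"
    then obtain K c where K: "number_field_of_degree 3 K" "c \<noteq> 0"
      "X' = iso_class (torsion_subgroup (mordell_group K (of_rat c)))" by (auto simp: Phi_M_Q_def)
    interpret cubic_field K by (rule number_field_cubic[OF K(1)])
    interpret M: mordell_cubic K "of_rat c" by unfold_locales (use K in auto)
    show "X' \<in> ?S" unfolding K(3) by (rule M.iso_class_T_cases)
  qed
  \<comment> \<open>One field realises all five groups: over it the parameters 16, 1, 4, 8, 2 give
    orders 9, 6, 3, 2, 1.\<close>
  obtain r :: complex where r: "r ^ 3 - 3 * r ^ 2 + 1 = 0" using exists_cubic_root by blast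
  define K where "K = adjoin_rat r"
  have K: "number_field_of_degree 3 K" unfolding K_def by (rule number_field_adjoin_rat[OF r])
  interpret cubic_field K by (rule number_field_cubic[OF K])
  have rK: "r \<in> K" unfolding K_def by (rule adjoin_rat_mem)
  note mem = iso_class_in_Phi[OF K]
  have cube: "\<not> cube_in K (of_int m)" if "m \<in> {2, 4}" for m
    using cube_in_of_int_cases[OF rK r, of m] no_integer_cube_4_16 that by auto
  have sq: "\<not> square_in K (of_int m)" if "m \<in> {2, 8}" for m
  proof -
    have "k ^ 2 \<noteq> m" for k :: int
    proof -
      have "\<bar>k\<bar> \<le> 1 \<or> \<bar>k\<bar> = 2 \<or> 3 \<le> \<bar>k\<bar>" by linarith
      then have "k ^ 2 \<le> 1 \<or> k ^ 2 = 4 \<or> 9 \<le> k ^ 2"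
      proof (elim disjE)
        assume "\<bar>k\<bar> \<le> 1"
        then show ?thesis using power_mono[of "\<bar>k\<bar>" 1 2] by simp
      next
        assume "\<bar>k\<bar> = 2"
        then have "k = 2 \<or> k = - 2" by linarith
        then show ?thesis by auto
      next
        assume "3 \<le> \<bar>k\<bar>"
        then show ?thesis using power_mono[of 3 "\<bar>k\<bar>" 2] by simp
      qed
      then show ?thesis using that by auto
    qed
    then show ?thesis unfolding square_in_of_int_iff by metis
  qed
  have neg: "\<not> square_in K (- 3 * of_int m)" if "m > 0" for m
    using not_square_in_neg[of "- 3 * m"] that by simp
  have sqs: "square_in K 1" "square_in K 4" "cube_in K 1" "cube_in K 8"
  proof -
    show "square_in K 1" unfolding square_in_def by (rule bexI[OF _ one_mem]) simp
    show "square_in K 4" unfolding square_in_def by (rule bexI[of _ 2, OF _ numeral_mem]) simp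
    show "cube_in K 1" unfolding cube_in_def by (rule bexI[OF _ one_mem]) simp
    show "cube_in K 8" unfolding cube_in_def by (rule bexI[of _ 2, OF _ numeral_mem]) simp
  qed
  have isQ: "\<exists>r. r ^ 3 - 3 * r ^ 2 + 1 = 0 \<and> K = adjoin_rat r" using r K_def by blast
  have free: "sixth_power_free m" if "m \<in> {1, 2, 4, 8, 16}" for m
    using that by (intro sixth_power_free_small) auto
  note cl = torsion_classification[OF _ free K]
  have "iso_class (integer_mod_group 9) \<in> Phi_M_Q 3"
    using mem[OF _ cl(1)[of 16, THEN conjunct1]] isQ by simp
  moreover have "iso_class (integer_mod_group 6) \<in> Phi_M_Q 3"
    using mem[OF _ cl(2)[of 1]] sqs by simp
  moreover have "iso_class (integer_mod_group 3) \<in> Phi_M_Q 3"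
    using mem[OF _ cl(3)[of 4]] sqs cube[of 4] by simp
  moreover have "iso_class (integer_mod_group 2) \<in> Phi_M_Q 3"
    using mem[OF _ cl(4)[of 8]] sqs sq[of 8] neg[of 8] by simp
  moreover have "iso_class (singleton_group (Infinity :: complex point)) \<in> Phi_M_Q 3"
    using mem[OF _ cl(5)[of 2]] sqs sq[of 2] cube[of 2] neg[of 2] by simp
  ultimately show "?S \<subseteq> Phi_M_Q 3" by simp
qed

text \<open>The values -108 and -432 stand beside -27 in \<open>C2\<close> because there, too,
  \<open>c\<close> and \<open>4 c\<close> become cubes once 4 is one, and \<open>- 3 c\<close> is a
  square. The clause \<open>\<not> C2\<close> keeps these curves out of \<open>C3\<close> and
  \<open>C4\<close>.\<close>

theorem theorem1:
  fixes c :: int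
  assumes "c \<noteq> 0" and "sixth_power_free c"
  shows "Phi_M_Q 3 =
      {iso_class (integer_mod_group 9), iso_class (integer_mod_group 6),
       iso_class (integer_mod_group 3), iso_class (integer_mod_group 2),
       iso_class (singleton_group (Infinity :: complex point))}
    \<and> (\<forall>K. number_field_of_degree 3 K \<longrightarrow>
        (let T = torsion_subgroup (mordell_group K (of_int c));
             K_is_Q_r = (\<exists>r. r ^ 3 - 3 * r ^ 2 + 1 = 0 \<and> K = adjoin_rat r);
             C1 = (c = 16 \<and> K_is_Q_r);
             C2 = (square_in K (of_int c) \<and> cube_in K (of_int c)
                   \<or> c = -27 \<and> cube_in K 4
                   \<or> (c = -108 \<or> c = -432) \<and> cube_in K 4);
             C3 = (\<not> C2 \<and>
                   (c \<noteq> 16 \<and> square_in K (of_int c) \<and> \<not> cube_in K (of_int c)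
                    \<or> c = 16 \<and> \<not> K_is_Q_r
                    \<or> cube_in K (4 * of_int c) \<and> square_in K (-3 * of_int c)));
             C4 = (\<not> C2 \<and>
                   (c \<noteq> -27 \<and> cube_in K (of_int c) \<and> \<not> square_in K (of_int c)
                    \<or> c = -27 \<and> \<not> cube_in K 4))
         in (C1 \<longrightarrow> T \<cong> integer_mod_group 9)
          \<and> (C2 \<longrightarrow> T \<cong> integer_mod_group 6)
          \<and> (C3 \<longrightarrow> T \<cong> integer_mod_group 3)
          \<and> (C4 \<longrightarrow> T \<cong> integer_mod_group 2)
          \<and> (\<not> C1 \<and> \<not> C2 \<and> \<not> C3 \<and> \<not> C4 \<longrightarrow>
               T \<cong> singleton_group (Infinity :: complex point))))"
proof (intro conjI allI impI, goal_cases)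
  case 1
  show ?case by (rule Phi_M_Q_3)
next
  case K: (2 K)
  interpret cubic_field K by (rule number_field_cubic[OF K])
  note cl = torsion_classification[OF assms K]
  define Q where "Q \<longleftrightarrow> (\<exists>r. r ^ 3 - 3 * r ^ 2 + 1 = 0 \<and> K = adjoin_rat r)"
  define sq cu tw c4 where "sq \<longleftrightarrow> square_in K (of_int c)" and "cu \<longleftrightarrow> cube_in K (of_int c)"
    and "tw \<longleftrightarrow> cube_in K (4 * of_int c) \<and> square_in K (- 3 * of_int c)" and "c4 \<longleftrightarrow> cube_in K 4"
  \<comment> \<open>Cubes \<open>c\<close> whose points of order 3 lie over
    \<open>x ^ 3 = - 4 * c\<close> are the sporadic disjuncts of \<open>C2\<close>.\<close>
  have special: "cu \<and> tw \<longleftrightarrow> c4 \<and> (c = - 27 \<or> c = - 108 \<or> c = - 432)"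
    unfolding cu_def tw_def c4_def
    using sporadic_six[OF assms] sporadic_six_converse[of c] by blast
  have cu27: "c = - 27 \<Longrightarrow> cu"
    unfolding cu_def cube_in_def by (intro bexI[of _ "- 3"]) (auto intro!: mem_intros)
  have sq16: "c = 16 \<Longrightarrow> sq"
    using square_in_of_int_iff[of 16] by (auto simp: sq_def intro: exI[of _ 4])
  \<comment> \<open>Keeps \<open>c = 16\<close> out of the last alternative of
    \<open>C3\<close>.\<close>
  have twneg: "c > 0 \<Longrightarrow> \<not> tw"
    using not_square_in_neg[of "- 3 * c"] by (simp add: tw_def)
  have nine: "c = 16 \<and> Q \<Longrightarrow> \<not> cu" using cl(1) by (simp add: Q_def cu_def)
  note cl' = cl[folded tw_def Q_def sq_def cu_def]
  show ?case
    unfolding Let_def tw_def[symmetric] Q_def[symmetric] sq_def[symmetric] cu_def[symmetric] c4_def[symmetric]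
  proof (intro conjI impI, goal_cases)
    case 1
    then show ?case using cl'(1) by blast
  next
    case 2
    then have "cu" "sq \<or> tw" using special by blast+
    then show ?case using cl'(2) nine by blast
  next
    case 3
    then have "\<not> (c = 16 \<and> Q)" "\<not> cu" "sq \<or> tw" using special sq16 twneg by auto
    then show ?case by (rule cl'(3))
  next
    case 4
    then have "cu" using cu27 by blast
    \<comment> \<open>As \<open>C2\<close> fails, neither condition can hold beside
      \<open>cu\<close>: \<open>sq\<close> would give its first disjunct, and \<open>tw\<close> the
      others by \<open>special\<close>.\<close>
    moreover from this have "\<not> (sq \<or> tw)" using 4 special by blast
    ultimately show ?case by (rule cl'(4))
  next
    case 5
    then have "\<not> cu" "\<not> (sq \<or> tw)" by blast+
    then show ?case by (rule cl'(5))
  qed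
qed

end
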